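(* Let $d\in\{1,2,3\}$, $T>0$, $r\ge 0$, $0<\epsilon<\tfrac14$ (arbitrarily small), and set $$ r_1 := \begin{cases} r+1, & \text{if } r>\frac d2,\\ 1+\frac d2+\epsilon, & \text{if } 0<r\le \frac d2,\\ 1+\frac d4, & \text{if } r=0.\end{cases} $$ For every $u_0\in H^{r_1}(\mathbb{T}^d)$ and $V\in H^{r_1}(\mathbb{T}^d)$, let $u\in\mathcal{C}([0,T],H^{r_1}(\mathbb{T}^d))$ be the unique (mild) solution of the Gross-Pitaevskii equation $$ i\partial_t u(t,x) = -\Delta u(t,x)+V(x)u(t,x)+|u(t,x)|^2u(t,x),\qquad u|_{t=0}=u_0, $$ on $[0,T]\times\mathbb{T}^d$. Then there exist $\tau_{\min}>0$ and $C_T>0$ such that for every time step size $0<\tau\le\tau_{\min}$ the sequence $(u^n)_{n\ge 0}$ defined by $u^0=u_0$ and $$ u^{n+1} = e^{i\tau\Delta}\Big[u^n - i\tau\Big(u^n\,\varphi_1(-i\tau\Delta)V + (u^n)^2\,\varphi_1(-2i\tau\Delta)\overline{u^n}\Big)\Big] $$ satisfies $$ \|u^n-u(n\tau)\|_{H^r}\le C_T\,\tau \qquad\text{for all integers } n\ge 0 \text{ with } 0\le n\tau\le T. $$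
   Context: $\mathbb{T}^d$ is the $d$-dimensional torus $(\mathbb{R}/2\pi\mathbb{Z})^d$; functions are complex valued. For $u=\sum_{k\in\mathbb{Z}^d}u_k\frac{e^{ik\cdot x}}{\sqrt{(2\pi)^d}}\in L^2(\mathbb{T}^d)$ and $r>0$, $\|u\|_{H^r}^2=\sum_{k\in\mathbb{Z}^d}(1+|k|^{2r})|u_k|^2$, and $H^r(\mathbb{T}^d)$ is the space where this is finite; $H^0=L^2$. A mild solution is a solution of Duhamel's formula $u(t)=e^{it\Delta}u_0-i\int_0^t e^{i(t-\zeta)\Delta}\big(Vu(\zeta)+u(\zeta)^2\overline{u(\zeta)}\big)\,d\zeta$. $T$ is a time up to which this solution exists in the stated class. $\varphi_1(z)=\frac{e^z-1}{z}$ (with $\varphi_1(0)=1$). For a function $\varphi$ bounded on $i\mathbb{R}$ and $\xi\in\mathbb{R}$, $\varphi(i\xi\Delta)$ is the Fourier multiplier with symbol $\varphi(-i\xi|k|^2)$, $k\in\mathbb{Z}^d$; likewise $e^{i\xi\Delta}$ has symbol $e^{-i\xi|k|^2}$. In the scheme, $\varphi_1(-i\tau\Delta)$ acts on $V$ only, and $\varphi_1(-2i\tau\Delta)$ acts on $\overline{u^n}$ only. *)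

theory Defs
  imports "HOL-Analysis.Analysis"
begin

text \<open>
  Functions on the torus \<open>(\<real>/2\<pi>\<int>)\<^sup>d\<close> are represented by functions on \<open>\<real>\<^sup>d\<close> (with
  \<open>d = CARD('d)\<close>) that are \<open>2\<pi>\<close>-periodic in every coordinate, and integrals over the torus by
  integrals over the cell \<open>[0, 2\<pi>]\<^sup>d\<close>.  Elements of \<open>L\<^sup>2\<close> and \<open>H\<^sup>r\<close> are
  representatives; two of them denote the same element iff they agree almost everywhere.
\<close>

abbreviation torus_measure :: "(real ^ 'd) measure" where
  "torus_measure \<equiv> lebesgue_on (cbox 0 (\<chi> i. 2 * pi))"

definition torus_periodic :: "(real ^ 'd \<Rightarrow> complex) \<Rightarrow> bool" where
  "torus_periodic f \<longleftrightarrow> (\<forall>x i. f (x + axis i (2 * pi)) = f x)"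

definition torus_L2 :: "(real ^ 'd \<Rightarrow> complex) set" where
  "torus_L2 = {f. torus_periodic f \<and> f \<in> borel_measurable torus_measure \<and>
     integrable torus_measure (\<lambda>x. (cmod (f x))\<^sup>2)}"

definition L2_norm_torus :: "(real ^ 'd \<Rightarrow> complex) \<Rightarrow> real" where
  "L2_norm_torus f = sqrt (\<integral>x. (cmod (f x))\<^sup>2 \<partial>torus_measure)"

definition freq :: "int ^ 'd \<Rightarrow> real ^ 'd" where
  "freq k = (\<chi> i. real_of_int (k $ i))"

text \<open>Coefficients with respect to the orthonormal system \<open>exp (i k\<cdot>x) / sqrt ((2\<pi>)\<^sup>d)\<close>.\<close>

definition fourier_coeff :: "(real ^ 'd \<Rightarrow> complex) \<Rightarrow> int ^ 'd \<Rightarrow> complex" where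
  "fourier_coeff f k =
     (\<integral>x. f x * exp (- \<i> * of_real (freq k \<bullet> x)) / of_real (sqrt ((2 * pi) ^ CARD('d)))
       \<partial>torus_measure)"

text \<open>
  For \<open>r = 0\<close> the space and its norm are those of \<open>L\<^sup>2\<close>; the weighted sum is the definition
  for \<open>r > 0\<close>.  The infinite sum is \<open>0\<close> when it diverges, so the value of \<open>sobolev_norm r\<close>
  is meaningful only on \<open>sobolev r\<close>.
\<close>

definition sobolev :: "real \<Rightarrow> (real ^ 'd \<Rightarrow> complex) set" where
  "sobolev r = {f \<in> torus_L2. r = 0 \<or>
     (\<lambda>k. (1 + norm (freq k) powr (2 * r)) * (cmod (fourier_coeff f k))\<^sup>2) summable_on UNIV}"

definition sobolev_norm :: "real \<Rightarrow> (real ^ 'd \<Rightarrow> complex) \<Rightarrow> real" where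
  "sobolev_norm r f =
     (if r = 0 then L2_norm_torus f
      else sqrt (\<Sum>\<^sub>\<infinity>k. (1 + norm (freq k) powr (2 * r)) * (cmod (fourier_coeff f k))\<^sup>2))"

text \<open>
  A representative of the \<open>L\<^sup>2\<close> function whose coefficients are \<open>m k * fourier_coeff f k\<close>;
  this function is unique up to null sets, and exists if \<open>f \<in> torus_L2\<close> and \<open>m\<close> is bounded.
\<close>

definition fourier_multiplier ::
    "(int ^ 'd \<Rightarrow> complex) \<Rightarrow> (real ^ 'd \<Rightarrow> complex) \<Rightarrow> real ^ 'd \<Rightarrow> complex" where
  "fourier_multiplier m f =
     (SOME g. g \<in> torus_L2 \<and> (\<forall>k. fourier_coeff g k = m k * fourier_coeff f k))"

text \<open>\<open>op_iLap \<phi> \<xi>\<close> is the operator \<open>\<phi>(i\<xi>\<Delta>)\<close>.\<close>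

definition op_iLap ::
    "(complex \<Rightarrow> complex) \<Rightarrow> real \<Rightarrow> (real ^ 'd \<Rightarrow> complex) \<Rightarrow> real ^ 'd \<Rightarrow> complex" where
  "op_iLap \<phi> \<xi> = fourier_multiplier (\<lambda>k. \<phi> (- \<i> * of_real (\<xi> * (norm (freq k))\<^sup>2)))"

definition phi1 :: "complex \<Rightarrow> complex" where
  "phi1 z = (if z = 0 then 1 else (exp z - 1) / z)"

definition continuous_in_sobolev ::
    "real \<Rightarrow> real set \<Rightarrow> (real \<Rightarrow> real ^ 'd \<Rightarrow> complex) \<Rightarrow> bool" where
  "continuous_in_sobolev s J u \<longleftrightarrow>
     (\<forall>t\<in>J. u t \<in> sobolev s) \<and>
     (\<forall>t\<in>J. ((\<lambda>t'. sobolev_norm s (\<lambda>x. u t' x - u t x)) \<longlongrightarrow> 0) (at t within J))"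

text \<open>
  Integral of an \<open>L\<^sup>2\<close>-valued function of a real variable, as a limit in \<open>L\<^sup>2\<close> of
  Riemann sums: the definition of \<open>has_integral\<close> with the \<open>L\<^sup>2\<close> norm in place of the norm of a
  type (\<open>torus_L2\<close> is only a set).  For continuous integrands it is the Riemann or Bochner integral.
\<close>

definition has_L2_integral ::
    "(real \<Rightarrow> real ^ 'd \<Rightarrow> complex) \<Rightarrow> (real ^ 'd \<Rightarrow> complex) \<Rightarrow> real \<Rightarrow> real \<Rightarrow> bool" where
  "has_L2_integral F I a b \<longleftrightarrow>
     I \<in> torus_L2 \<and> (\<forall>\<zeta>\<in>{a..b}. F \<zeta> \<in> torus_L2) \<and>
     (\<forall>e>0. \<exists>\<gamma>. gauge \<gamma> \<and>
        (\<forall>\<D>. \<D> tagged_division_of {a..b} \<and> \<gamma> fine \<D> \<longrightarrow>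
           L2_norm_torus (\<lambda>x. (\<Sum>(\<zeta>, K)\<in>\<D>. measure lborel K *\<^sub>R F \<zeta> x) - I x) < e))"

definition mild_solution_GP ::
    "(real ^ 'd \<Rightarrow> complex) \<Rightarrow> (real ^ 'd \<Rightarrow> complex) \<Rightarrow> real \<Rightarrow>
      (real \<Rightarrow> real ^ 'd \<Rightarrow> complex) \<Rightarrow> bool" where
  "mild_solution_GP V u0 T u \<longleftrightarrow>
     (\<forall>t\<in>{0..T}. \<exists>I.
        has_L2_integral
          (\<lambda>\<zeta>. op_iLap exp (t - \<zeta>) (\<lambda>x. V x * u \<zeta> x + (u \<zeta> x)\<^sup>2 * cnj (u \<zeta> x))) I 0 t \<and>
        (AE x in torus_measure. u t x = op_iLap exp t u0 x - \<i> * I x))"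

primrec GP_scheme ::
    "(real ^ 'd \<Rightarrow> complex) \<Rightarrow> (real ^ 'd \<Rightarrow> complex) \<Rightarrow> real \<Rightarrow> nat \<Rightarrow>
      real ^ 'd \<Rightarrow> complex" where
  "GP_scheme V u0 \<tau> 0 = u0"
| "GP_scheme V u0 \<tau> (Suc n) =
     (let w = GP_scheme V u0 \<tau> n in
      op_iLap exp \<tau>
        (\<lambda>x. w x - \<i> * of_real \<tau> *
           (w x * op_iLap phi1 (- \<tau>) V x
            + (w x)\<^sup>2 * op_iLap phi1 (- 2 * \<tau>) (\<lambda>y. cnj (w y)) x)))"

definition data_regularity :: "nat \<Rightarrow> real \<Rightarrow> real \<Rightarrow> real" where
  "data_regularity d \<epsilon> r =
     (if r > real d / 2 then r + 1
      else if r > 0 then 1 + real d / 2 + \<epsilon>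
      else 1 + real d / 4)"

end

theory Submission
  imports Defs
begin

text \<open>
  Everything happens on the Fourier coefficients \<open>a\<^sub>k\<close> in \<open>f = \<Sum>\<^sub>k a\<^sub>k exp (i k\<cdot>x)\<close>.  In all
  cases \<open>r1 > d/2\<close>, so the data and the solution have absolutely summable coefficients; such
  functions are determined almost everywhere by their coefficients (\<open>fourier_uniqueness\<close>,
  \<open>wiener_AE_series\<close>), and products become convolutions (\<open>wiener_mult\<close>).  The scheme and Duhamel's
  formula turn into statements about sequences (\<open>wiener_scheme\<close>, \<open>mild_solution_coeffs\<close>).

  The scheme makes two errors in one step of Duhamel's formula (\<open>local_error\<close>).  It replaces
  \<open>u(t + \<zeta>)\<close> by the free flow \<open>exp(i\<zeta>\<Delta>) u(t)\<close>, which costs \<open>O(\<zeta>)\<close>.  And for frequencies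
  \<open>k = m + j\<close> it replaces the phase \<open>|k|\<^sup>2 - |m|\<^sup>2\<close> by \<open>|j|\<^sup>2\<close> (with \<open>V\<close> at the frequency \<open>j\<close>).  The
  phases differ by \<open>2 m\<cdot>j\<close>, and \<open>|exp(2i\<zeta> m\<cdot>j) - 1| \<le> 2 (\<zeta>|m||j|)\<^sup>\<gamma>\<close> for every \<open>0 < \<gamma> \<le> 1\<close>: the order
  \<open>\<gamma>\<close> in time costs \<open>\<gamma>\<close> derivatives on each of two factors, not \<open>2\<gamma>\<close> on one.  In the cubic term the
  phase that is kept is \<open>2|l|\<^sup>2\<close> for the frequency \<open>l\<close> of the conjugate, and the rest is again a sum
  of inner products of two frequencies.  Altogether the local error is \<open>O(\<tau>\<^bsup>1+\<gamma>\<^esup>)\<close> in a norm \<open>X\<close>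
  in which products of two \<open>\<gamma>\<close>-th derivatives are bounded.

  Stability holds in a norm \<open>X\<close> that is a module over an algebra norm \<open>Y\<close>, as long as the
  numerical solution stays bounded in \<open>Y\<close> (\<open>gp_step_stable\<close>).  A discrete Gronwall argument then gives
  the global order \<open>\<gamma>\<close> (\<open>conditional_convergence\<close>).  If \<open>X = Y\<close>, the bound on the numerical solution
  comes from the error estimate itself by induction on the number of steps, for small \<open>\<tau>\<close>
  (\<open>convergence_of_algebra\<close>).

  \<^item> For \<open>r > 0\<close>: \<open>X = Y = H\<^sup>s\<close> with \<open>s = r1 - 1 > d/2\<close>, which is an algebra, and \<open>\<gamma> = 1\<close>
    (\<open>sobolev_convergence\<close>).  When \<open>r \<le> d/2\<close> this bounds the error in the stronger norm of
    \<open>H\<^sup>s\<close>, \<open>s = d/2 + \<epsilon>\<close>.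

  \<^item> For \<open>r = 0\<close>: first \<open>X = Y = \<ell>\<^sup>1\<close> with \<open>\<gamma> = 1/8\<close>, which bounds the numerical solution in
    \<open>\<ell>\<^sup>1\<close>; here \<open>d \<le> 3\<close> enters, since \<open>|k|\<^sup>\<gamma> u\<^sub>k\<close> must be summable for \<open>u\<close> in \<open>H\<^bsup>1+d/4\<^esup>\<close>.
    Then \<open>X = \<ell>\<^sup>2\<close>, \<open>Y = \<ell>\<^sup>1\<close> and \<open>\<gamma> = 1\<close>: the products of two first derivatives are bounded in
    \<open>L\<^sup>2\<close> by the critical product estimate \<open>H\<^bsup>d/4\<^esup> \<cdot> H\<^bsup>d/4\<^esup> \<subseteq> L\<^sup>2\<close> (\<open>l2_cv_critical\<close>,
    \<open>l2_convergence\<close>).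

  Errors are majorized by sequences with values in \<open>[0, \<infinity>]\<close>, so that convolutions need no
  convergence hypotheses, and norms are suprema of linear functionals, so that the triangle
  inequality and Minkowski's inequality for integrals are linearity and Fubini's theorem.
\<close>

section \<open>Majorants: sequences with values in the extended nonnegative reals\<close>

abbreviation tot :: "('k \<Rightarrow> ennreal) \<Rightarrow> ennreal" where
  "tot a \<equiv> (\<integral>\<^sup>+k. a k \<partial>count_space UNIV)"

lemma tot_swap_measure:
  fixes f :: "'k::countable \<Rightarrow> 'a \<Rightarrow> ennreal"
  assumes "sigma_finite_measure M" "\<And>k. f k \<in> borel_measurable M"
  shows "(\<integral>\<^sup>+x. tot (\<lambda>k. f k x) \<partial>M) = tot (\<lambda>k. \<integral>\<^sup>+x. f k x \<partial>M)"
proof -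
  interpret pair_sigma_finite "count_space (UNIV::'k set)" M
    using assms(1) sigma_finite_measure_count_space by (simp add: pair_sigma_finite_def)
  have "case_prod f \<in> borel_measurable (count_space UNIV \<Otimes>\<^sub>M M)"
    by (rule measurable_pair_measure_countable1) (use assms in auto)
  from Fubini'[OF this] show ?thesis .
qed

lemma tot_swap:
  fixes f :: "'k::countable \<Rightarrow> 'l::countable \<Rightarrow> ennreal"
  shows "tot (\<lambda>x. tot (\<lambda>k. f k x)) = tot (\<lambda>k. tot (\<lambda>x. f k x))"
  by (rule tot_swap_measure) (auto intro: sigma_finite_measure_count_space)

lemma tot_bij:
  assumes "bij g" shows "tot (\<lambda>k. a (g k)) = tot a"
  using nn_integral_bij_count_space[of g UNIV UNIV a] assms by simp

lemma tot_diff: "tot (\<lambda>j. a (k - j)) = tot (a::'k::ab_group_add \<Rightarrow> _)"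
  by (rule tot_bij, rule involuntory_imp_bij) simp

lemma tot_uminus: "tot (\<lambda>j. a (- j)) = tot (a::'k::ab_group_add \<Rightarrow> _)"
  using tot_diff[of a 0] by simp

lemma tot_shift: "tot (\<lambda>j. a (j + k)) = tot (a::'k::ab_group_add \<Rightarrow> _)"
  by (rule tot_bij, rule bij_betw_byWitness[of _ "\<lambda>j. j - k"]) auto

lemma le_tot: "a k \<le> tot a"
proof -
  have "a k = (\<integral>\<^sup>+j. a k * indicator {k} j \<partial>count_space UNIV)"
    by (subst nn_integral_cmult_indicator) auto
  also have "\<dots> \<le> tot a"
    by (intro nn_integral_mono) (auto split: split_indicator)
  finally show ?thesis .
qed

lemma tot_mono: "(\<And>k. a k \<le> b k) \<Longrightarrow> tot a \<le> tot b"
  by (intro nn_integral_mono) auto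

lemma tot_add: "tot (\<lambda>k. a k + b k) = tot a + tot b"
  by (rule nn_integral_add) auto

lemma tot_cmult: "tot (\<lambda>k. c * a k) = c * tot a"
  by (rule nn_integral_cmult) auto

lemma tot_multc: "tot (\<lambda>k. a k * c) = tot a * c"
  by (rule nn_integral_multc) auto

definition cv :: "('k::ab_group_add \<Rightarrow> ennreal) \<Rightarrow> ('k \<Rightarrow> ennreal) \<Rightarrow> 'k \<Rightarrow> ennreal" where
  "cv a b k = tot (\<lambda>j. a j * b (k - j))"

abbreviation (input) refl_seq :: "('k::ab_group_add \<Rightarrow> 'b) \<Rightarrow> 'k \<Rightarrow> 'b" where
  "refl_seq a \<equiv> (\<lambda>k. a (- k))"

lemma cv_commute: "cv a b = cv b a"
proof
  fix k
  have "cv a b k = tot (\<lambda>j. (\<lambda>j. a j * b (k - j)) (k - j))"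
    unfolding cv_def by (subst tot_diff) simp
  also have "\<dots> = cv b a k"
    by (simp add: cv_def mult.commute)
  finally show "cv a b k = cv b a k" .
qed

lemma tot_mult_cv:
  fixes a b c :: "'k::{ab_group_add,countable} \<Rightarrow> ennreal"
  shows "tot (\<lambda>k. c k * cv a b k) = tot (\<lambda>i. tot (\<lambda>j. c (i + j) * (a i * b j)))"
proof -
  have "tot (\<lambda>k. c k * cv a b k) = tot (\<lambda>k. tot (\<lambda>i. c k * (a i * b (k - i))))"
    by (simp add: cv_def tot_cmult)
  also have "\<dots> = tot (\<lambda>i. tot (\<lambda>k. c k * (a i * b (k - i))))"
    by (rule tot_swap)
  also have "\<dots> = tot (\<lambda>i. tot (\<lambda>j. c (i + j) * (a i * b j)))"
  proof (rule nn_integral_cong)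
    fix i
    show "tot (\<lambda>k. c k * (a i * b (k - i))) = tot (\<lambda>j. c (i + j) * (a i * b j))"
      using tot_shift[of "\<lambda>k. c k * (a i * b (k - i))" i] by (simp add: add.commute)
  qed
  finally show ?thesis .
qed

lemma cv_assoc:
  fixes a b c :: "'k::{ab_group_add,countable} \<Rightarrow> ennreal"
  shows "cv (cv a b) c = cv a (cv b c)"
proof
  fix k
  have "cv (cv a b) c k = tot (\<lambda>m. c (k - m) * cv a b m)"
    by (simp add: cv_def[of "cv a b"] mult.commute)
  also have "\<dots> = tot (\<lambda>i. tot (\<lambda>j. c (k - (i + j)) * (a i * b j)))"
    by (rule tot_mult_cv)
  also have "\<dots> = cv a (cv b c) k"
    by (simp add: cv_def mult_ac tot_cmult[symmetric] diff_diff_eq)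
  finally show "cv (cv a b) c k = cv a (cv b c) k" .
qed

lemma cv_mono: "(\<And>k. a k \<le> a' k) \<Longrightarrow> (\<And>k. b k \<le> b' k) \<Longrightarrow> cv a b k \<le> cv a' b' k"
  unfolding cv_def by (intro tot_mono mult_mono) auto

lemma tot_cv:
  fixes a b :: "'k::{ab_group_add,countable} \<Rightarrow> ennreal"
  shows "tot (cv a b) = tot a * tot b"
  using tot_mult_cv[of "\<lambda>_. 1" a b] by (simp add: tot_cmult tot_multc)

text \<open>
  A norm given as a supremum over a set of nonnegative linear functionals.  The three norms in use
  are of this form: \<open>\<ell>\<^sup>1\<close> with the single functional \<open>1\<close>, and, by duality, \<open>\<ell>\<^sup>2\<close> and weighted \<open>\<ell>\<^sup>2\<close>
  (the norms of \<open>L\<^sup>2\<close> and \<open>H\<^sup>s\<close>).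
\<close>

definition dual_norm :: "('k \<Rightarrow> ennreal) set \<Rightarrow> ('k \<Rightarrow> ennreal) \<Rightarrow> ennreal" where
  "dual_norm \<Phi> a = (SUP \<phi>\<in>\<Phi>. tot (\<lambda>k. \<phi> k * a k))"

lemma dual_normI: "(\<And>\<phi>. \<phi> \<in> \<Phi> \<Longrightarrow> tot (\<lambda>k. \<phi> k * a k) \<le> c) \<Longrightarrow> dual_norm \<Phi> a \<le> c"
  unfolding dual_norm_def by (rule SUP_least)

lemma dual_normD: "\<phi> \<in> \<Phi> \<Longrightarrow> tot (\<lambda>k. \<phi> k * a k) \<le> dual_norm \<Phi> a"
  unfolding dual_norm_def by (rule SUP_upper)

lemma dual_norm_mono: "(\<And>k. a k \<le> b k) \<Longrightarrow> dual_norm \<Phi> a \<le> dual_norm \<Phi> b"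
  unfolding dual_norm_def by (intro SUP_mono') (auto intro!: tot_mono mult_left_mono)

lemma dual_norm_add: "dual_norm \<Phi> (\<lambda>k. a k + b k) \<le> dual_norm \<Phi> a + dual_norm \<Phi> b"
  by (rule dual_normI) (auto simp: distrib_left tot_add intro!: add_mono dual_normD)

lemma dual_norm_cmult: "dual_norm \<Phi> (\<lambda>k. c * a k) \<le> c * dual_norm \<Phi> a"
proof (rule dual_normI)
  fix \<phi> assume "\<phi> \<in> \<Phi>"
  have "tot (\<lambda>k. \<phi> k * (c * a k)) = c * tot (\<lambda>k. \<phi> k * a k)"
    by (simp add: tot_cmult[symmetric] mult_ac)
  also have "\<dots> \<le> c * dual_norm \<Phi> a"
    using \<open>\<phi> \<in> \<Phi>\<close> by (intro mult_left_mono dual_normD) auto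
  finally show "tot (\<lambda>k. \<phi> k * (c * a k)) \<le> c * dual_norm \<Phi> a" .
qed

text \<open>
  Minkowski's inequality for integrals: the norm of an average is at most the largest norm.
\<close>

lemma dual_norm_integral:
  fixes g :: "'k::countable \<Rightarrow> 'a \<Rightarrow> ennreal"
  assumes "sigma_finite_measure M" "\<And>k. g k \<in> borel_measurable M"
    and "\<And>x. x \<in> space M \<Longrightarrow> dual_norm \<Phi> (\<lambda>k. g k x) \<le> c"
  shows "dual_norm \<Phi> (\<lambda>k. \<integral>\<^sup>+x. g k x \<partial>M) \<le> c * emeasure M (space M)"
proof (rule dual_normI)
  fix \<phi> assume "\<phi> \<in> \<Phi>"
  have "tot (\<lambda>k. \<phi> k * (\<integral>\<^sup>+x. g k x \<partial>M)) = tot (\<lambda>k. \<integral>\<^sup>+x. \<phi> k * g k x \<partial>M)"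
    using assms(2) by (simp add: nn_integral_cmult)
  also have "\<dots> = (\<integral>\<^sup>+x. tot (\<lambda>k. \<phi> k * g k x) \<partial>M)"
    by (rule tot_swap_measure[symmetric]) (use assms in auto)
  also have "\<dots> \<le> (\<integral>\<^sup>+x. c \<partial>M)"
    by (intro nn_integral_mono order_trans[OF dual_normD[OF \<open>\<phi> \<in> \<Phi>\<close>] assms(3)])
  finally show "tot (\<lambda>k. \<phi> k * (\<integral>\<^sup>+x. g k x \<partial>M)) \<le> c * emeasure M (space M)"
    by simp
qed

definition l1_dual :: "('k \<Rightarrow> ennreal) set" where "l1_dual = {\<lambda>_. 1}"

definition l2_dual :: "('k \<Rightarrow> ennreal) \<Rightarrow> ('k \<Rightarrow> ennreal) set" where
  "l2_dual w = {\<lambda>k. w k * \<psi> k |\<psi>. tot (\<lambda>k. (\<psi> k)\<^sup>2) \<le> 1}"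

lemma dual_norm_l1: "dual_norm l1_dual a = tot a"
  by (simp add: dual_norm_def l1_dual_def)

definition refl_inv :: "('k::ab_group_add \<Rightarrow> ennreal) set \<Rightarrow> bool" where
  "refl_inv \<Phi> \<longleftrightarrow> (\<forall>\<phi>\<in>\<Phi>. refl_seq \<phi> \<in> \<Phi>)"

lemma dual_norm_refl:
  assumes "refl_inv \<Phi>" shows "dual_norm \<Phi> (refl_seq a) = dual_norm \<Phi> a"
proof -
  have *: "dual_norm \<Phi> (refl_seq a) \<le> dual_norm \<Phi> a" for a
  proof (rule dual_normI)
    fix \<phi> assume "\<phi> \<in> \<Phi>"
    have "tot (\<lambda>k. \<phi> k * a (- k)) = tot (\<lambda>k. \<phi> (- k) * a k)"
      by (subst tot_uminus[symmetric]) simp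
    also have "\<dots> \<le> dual_norm \<Phi> a"
      using \<open>\<phi> \<in> \<Phi>\<close> assms by (intro dual_normD) (auto simp: refl_inv_def)
    finally show "tot (\<lambda>k. \<phi> k * a (- k)) \<le> dual_norm \<Phi> a" .
  qed
  from *[of a] *[of "refl_seq a"] show ?thesis by simp
qed

lemma refl_inv_l1: "refl_inv l1_dual"
  by (simp add: refl_inv_def l1_dual_def)

lemma refl_inv_l2:
  assumes "\<And>k. w (- k) = w k" shows "refl_inv (l2_dual w)"
  unfolding refl_inv_def
proof
  fix \<phi> assume "\<phi> \<in> l2_dual w"
  then obtain \<psi> where \<psi>: "\<phi> = (\<lambda>k. w k * \<psi> k)" "tot (\<lambda>k. (\<psi> k)\<^sup>2) \<le> 1"
    by (auto simp: l2_dual_def)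
  have "tot (\<lambda>k. (\<psi> (- k))\<^sup>2) \<le> 1"
    using tot_uminus[of "\<lambda>k. (\<psi> k)\<^sup>2"] \<psi> by simp
  then show "refl_seq \<phi> \<in> l2_dual w"
    unfolding l2_dual_def using \<psi> assms by (intro CollectI exI[of _ "refl_seq \<psi>"]) auto
qed

lemma ennreal_square_le:
  fixes x :: ennreal assumes "x\<^sup>2 \<le> (ennreal M)\<^sup>2" "0 \<le> M" shows "x \<le> ennreal M"
  using assms by (cases x rule: ennreal_cases)
   (auto simp: ennreal_power ennreal_le_iff power2_le_iff_abs_le top_power_ennreal top_unique)

lemma l2_norm_le:
  assumes "tot (\<lambda>k. (w k * a k)\<^sup>2) \<le> (ennreal M)\<^sup>2" "0 \<le> M"
  shows "dual_norm (l2_dual w) a \<le> ennreal M"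
proof (rule dual_normI)
  fix \<phi> assume "\<phi> \<in> l2_dual w"
  then obtain \<psi> where \<psi>: "\<phi> = (\<lambda>k. w k * \<psi> k)" "tot (\<lambda>k. (\<psi> k)\<^sup>2) \<le> 1"
    by (auto simp: l2_dual_def)
  have "(tot (\<lambda>k. \<psi> k * (w k * a k)))\<^sup>2 \<le> tot (\<lambda>k. (\<psi> k)\<^sup>2) * tot (\<lambda>k. (w k * a k)\<^sup>2)"
    by (rule Cauchy_Schwarz_nn_integral) auto
  also have "\<dots> \<le> 1 * (ennreal M)\<^sup>2"
    using \<psi> assms by (intro mult_mono) auto
  finally show "tot (\<lambda>k. \<phi> k * a k) \<le> ennreal M"
    using assms(2) by (intro ennreal_square_le) (auto simp: \<psi> mult_ac)
qed

text \<open>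
  The half of the duality between \<open>\<ell>\<^sup>2\<close> and itself that recovers a sum of squares from the dual norm;
  the functional to test with is the normalized sequence itself, cut off to \<open>F\<close>.
\<close>

lemma l2_norm_bound_sum:
  fixes w a :: "'k \<Rightarrow> real"
  assumes N: "dual_norm (l2_dual (\<lambda>k. ennreal (w k))) (\<lambda>k. ennreal (a k)) \<le> ennreal M"
    and "0 \<le> M" "\<And>k. 0 \<le> w k" "\<And>k. 0 \<le> a k" "finite F"
  shows "(\<Sum>k\<in>F. (w k * a k)\<^sup>2) \<le> M\<^sup>2"
proof -
  define S where "S = (\<Sum>k\<in>F. (w k * a k)\<^sup>2)"
  have "0 \<le> S" unfolding S_def by (intro sum_nonneg) auto
  show ?thesis
  proof (cases "S = 0")
    case False
    with \<open>0 \<le> S\<close> have S: "0 < S" by simp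
    define \<psi> where "\<psi> k = (if k \<in> F then w k * a k / sqrt S else 0)" for k
    have tot_F: "tot (\<lambda>k. ennreal (f k)) = ennreal (\<Sum>k\<in>F. f k)"
      if "\<And>k. k \<notin> F \<Longrightarrow> f k = 0" "\<And>k. 0 \<le> f k" for f
    proof -
      have "tot (\<lambda>k. ennreal (f k)) = (\<Sum>k\<in>F. ennreal (f k))"
        using assms that by (intro nn_integral_count_space'[OF \<open>finite F\<close>]) auto
      then show ?thesis using that by (simp add: sum_ennreal)
    qed
    have \<psi>0: "0 \<le> \<psi> k" for k using assms S by (auto simp: \<psi>_def)
    have "tot (\<lambda>k. (ennreal (\<psi> k))\<^sup>2) = ennreal (\<Sum>k\<in>F. (\<psi> k)\<^sup>2)"
      using \<psi>0 by (subst tot_F[symmetric]) (auto simp: \<psi>_def ennreal_power)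
    also have "(\<Sum>k\<in>F. (\<psi> k)\<^sup>2) = (\<Sum>k\<in>F. (w k * a k)\<^sup>2 / S)"
      using S by (auto simp: \<psi>_def power_divide intro!: sum.cong)
    also have "\<dots> = S / S"
      by (simp only: S_def[symmetric] sum_divide_distrib[symmetric])
    finally have "(\<lambda>k. ennreal (w k) * ennreal (\<psi> k)) \<in> l2_dual (\<lambda>k. ennreal (w k))"
      using S unfolding l2_dual_def by (intro CollectI exI[of _ "\<lambda>k. ennreal (\<psi> k)"]) auto
    from dual_normD[OF this, of "\<lambda>k. ennreal (a k)"] N
    have "tot (\<lambda>k. ennreal (w k) * ennreal (\<psi> k) * ennreal (a k)) \<le> ennreal M"
      by simp
    also have "tot (\<lambda>k. ennreal (w k) * ennreal (\<psi> k) * ennreal (a k)) = tot (\<lambda>k. ennreal (w k * \<psi> k * a k))"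
      using assms \<psi>0 by (simp add: ennreal_mult'')
    also have "\<dots> = ennreal (\<Sum>k\<in>F. w k * \<psi> k * a k)"
      using assms \<psi>0 by (intro tot_F) (auto simp: \<psi>_def)
    also have "(\<Sum>k\<in>F. w k * \<psi> k * a k) = S / sqrt S"
      by (auto simp: \<psi>_def S_def sum_divide_distrib power2_eq_square mult_ac intro!: sum.cong)
    also have "S / sqrt S = sqrt S" using S by (simp add: real_div_sqrt)
    finally have "sqrt S \<le> M" using assms by simp
    then have "(sqrt S)\<^sup>2 \<le> M\<^sup>2" using S by (intro power_mono) auto
    then show ?thesis using S by (simp add: S_def)
  qed (simp add: S_def)
qed

text \<open>
  Cauchy--Schwarz against \<open>v = 1/w\<close>; with \<open>w(k) = (1 + |k|\<^bsup>2s\<^esup>)\<^bsup>1/2\<^esup>\<close> the hypothesis on \<open>v\<close> is \<open>s > d/2\<close>.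
\<close>

lemma tot_le_l2_norm:
  assumes "\<And>k. v k * w k = 1" "tot (\<lambda>k. (v k)\<^sup>2) \<le> (ennreal c)\<^sup>2" "0 < c"
  shows "tot a \<le> ennreal c * dual_norm (l2_dual w) a"
proof -
  have c: "ennreal c * ennreal (1/c) = 1" using assms by (simp flip: ennreal_mult)
  have "tot (\<lambda>k. (ennreal (1/c) * v k)\<^sup>2) = (ennreal (1/c))\<^sup>2 * tot (\<lambda>k. (v k)\<^sup>2)"
    by (simp add: power_mult_distrib tot_cmult)
  also have "\<dots> \<le> (ennreal (1/c))\<^sup>2 * (ennreal c)\<^sup>2"
    using assms by (intro mult_left_mono) auto
  also have "\<dots> = 1" using c by (metis power_mult_distrib mult.commute power_one)
  finally have "(\<lambda>k. w k * (ennreal (1/c) * v k)) \<in> l2_dual w"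
    unfolding l2_dual_def by (intro CollectI exI[of _ "\<lambda>k. ennreal (1/c) * v k"]) auto
  from dual_normD[OF this, of a]
  have "ennreal (1/c) * tot a \<le> dual_norm (l2_dual w) a"
    using assms(1) by (simp add: tot_cmult[symmetric] mult_ac) (simp add: mult.assoc[symmetric] mult.commute)
  then have "ennreal c * (ennreal (1/c) * tot a) \<le> ennreal c * dual_norm (l2_dual w) a"
    by (intro mult_left_mono) auto
  then show ?thesis using c by (simp add: mult.assoc[symmetric])
qed

text \<open>
  Young's inequality \<open>\<ell>\<^sup>2 * \<ell>\<^sup>1 \<subseteq> \<ell>\<^sup>2\<close>: the unit ball of \<open>\<ell>\<^sup>2\<close>, from which the functionals are taken, is
  invariant under translations.
\<close>

lemma l2_cv_l1:
  fixes a b :: "'k::{ab_group_add,countable} \<Rightarrow> ennreal"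
  shows "dual_norm (l2_dual (\<lambda>_. 1)) (cv a b) \<le> dual_norm (l2_dual (\<lambda>_. 1)) a * tot b"
proof (rule dual_normI)
  fix \<phi> :: "'k \<Rightarrow> ennreal" assume "\<phi> \<in> l2_dual (\<lambda>_. 1)"
  then have \<phi>: "tot (\<lambda>k. (\<phi> k)\<^sup>2) \<le> 1" by (auto simp: l2_dual_def)
  have "tot (\<lambda>k. \<phi> k * cv a b k) = tot (\<lambda>k. \<phi> k * cv b a k)"
    by (simp add: cv_commute)
  also have "\<dots> = tot (\<lambda>i. b i * tot (\<lambda>j. \<phi> (i + j) * a j))"
    by (simp add: tot_mult_cv mult_ac tot_cmult[symmetric])
  also have "\<dots> \<le> tot (\<lambda>i. b i * dual_norm (l2_dual (\<lambda>_. 1)) a)"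
  proof (intro tot_mono mult_left_mono dual_normD)
    fix i
    have "tot (\<lambda>j. (\<phi> (i + j))\<^sup>2) \<le> 1"
      using tot_shift[of "\<lambda>j. (\<phi> j)\<^sup>2" i] \<phi> by (simp add: add.commute)
    then show "(\<lambda>j. \<phi> (i + j)) \<in> l2_dual (\<lambda>_. 1)"
      by (auto simp: l2_dual_def)
  qed auto
  finally show "tot (\<lambda>k. \<phi> k * cv a b k) \<le> dual_norm (l2_dual (\<lambda>_. 1)) a * tot b"
    by (simp add: tot_multc mult.commute)
qed

lemma l2_weight: "dual_norm (l2_dual w) a = dual_norm (l2_dual (\<lambda>_. 1)) (\<lambda>k. w k * a k)"
proof (intro antisym dual_normI)
  fix \<phi> assume "\<phi> \<in> l2_dual w"
  then obtain \<psi> where \<psi>: "\<phi> = (\<lambda>k. w k * \<psi> k)" "tot (\<lambda>k. (\<psi> k)\<^sup>2) \<le> 1"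
    by (auto simp: l2_dual_def)
  then have "\<psi> \<in> l2_dual (\<lambda>_. 1)" by (auto simp: l2_dual_def)
  from dual_normD[OF this, of "\<lambda>k. w k * a k"]
  show "tot (\<lambda>k. \<phi> k * a k) \<le> dual_norm (l2_dual (\<lambda>_. 1)) (\<lambda>k. w k * a k)"
    by (simp add: \<psi> mult_ac)
next
  fix \<psi> :: "'a \<Rightarrow> ennreal" assume "\<psi> \<in> l2_dual (\<lambda>_. 1)"
  then have "(\<lambda>k. w k * \<psi> k) \<in> l2_dual w" by (auto simp: l2_dual_def)
  from dual_normD[OF this, of a]
  show "tot (\<lambda>k. \<psi> k * (w k * a k)) \<le> dual_norm (l2_dual w) a"
    by (simp add: mult_ac)
qed

text \<open>
  The tame product estimate: a weight that is subadditive up to a constant can be moved onto one of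
  the factors, which leaves a product \<open>\<ell>\<^sup>2 * \<ell>\<^sup>1\<close>.
\<close>

lemma l2_weight_cv:
  fixes a b w :: "'k::{ab_group_add,countable} \<Rightarrow> ennreal"
  assumes w: "\<And>i j. w (i + j) \<le> c * (w i + w j)"
  shows "dual_norm (l2_dual w) (cv a b)
     \<le> c * (dual_norm (l2_dual w) a * tot b + tot a * dual_norm (l2_dual w) b)"
proof -
  have "w k * cv a b k \<le> c * (cv (\<lambda>k. w k * a k) b k + cv (\<lambda>k. w k * b k) a k)" for k
  proof -
    have "w k * cv a b k = tot (\<lambda>j. w (j + (k - j)) * (a j * b (k - j)))"
      by (simp add: cv_def tot_cmult)
    also have "\<dots> \<le> tot (\<lambda>j. c * (w j + w (k - j)) * (a j * b (k - j)))"
      by (intro tot_mono mult_right_mono w) auto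
    also have "\<dots> = c * (cv (\<lambda>k. w k * a k) b k + cv a (\<lambda>k. w k * b k) k)"
      by (simp add: cv_def tot_cmult[symmetric] tot_add[symmetric] algebra_simps)
    finally show ?thesis by (simp add: cv_commute[of a])
  qed
  then have "dual_norm (l2_dual w) (cv a b)
      \<le> dual_norm (l2_dual (\<lambda>_. 1)) (\<lambda>k. c * (cv (\<lambda>k. w k * a k) b k + cv (\<lambda>k. w k * b k) a k))"
    unfolding l2_weight[of w] by (rule dual_norm_mono)
  also have "\<dots> \<le> c * (dual_norm (l2_dual (\<lambda>_. 1)) (cv (\<lambda>k. w k * a k) b)
       + dual_norm (l2_dual (\<lambda>_. 1)) (cv (\<lambda>k. w k * b k) a))"
    by (rule order_trans[OF dual_norm_cmult]) (intro mult_left_mono dual_norm_add, simp)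
  also have "\<dots> \<le> c * (dual_norm (l2_dual w) a * tot b + tot a * dual_norm (l2_dual w) b)"
    unfolding l2_weight[of w] mult.commute[of "tot a"]
    by (intro mult_left_mono add_mono l2_cv_l1) auto
  finally show ?thesis .
qed

text \<open>
  One half of the critical product estimate: only the interactions with \<open>R j i\<close> are kept, which will
  say that the frequency \<open>j\<close> of \<open>b\<close> is at most as large as the frequency \<open>i\<close> of \<open>a\<close>.
  Cauchy--Schwarz in \<open>i\<close> uses up \<open>\<psi>\<close> and leaves the tail of \<open>a\<close>; Cauchy--Schwarz in \<open>j\<close> uses up \<open>b\<close>;
  after exchanging the sums, the sum of \<open>v\<^sup>2\<close> over the \<open>j\<close> below \<open>i\<close> remains.
\<close>

lemma l2_cv_half:
  fixes a b \<psi> w :: "'k::{ab_group_add,countable} \<Rightarrow> ennreal"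
  assumes \<psi>: "tot (\<lambda>k. (\<psi> k)\<^sup>2) \<le> 1"
    and vw: "\<And>k. v k * w k = 1"
    and v: "\<And>i. tot (\<lambda>j. if R j i then (v j)\<^sup>2 else 0) \<le> C * (w i)\<^sup>2"
  shows "(tot (\<lambda>j. b j * tot (\<lambda>i. if R j i then \<psi> (i + j) * a i else 0)))\<^sup>2
    \<le> C * tot (\<lambda>k. (w k * a k)\<^sup>2) * tot (\<lambda>k. (w k * b k)\<^sup>2)"
proof -
  define g where "g j = tot (\<lambda>i. if R j i then \<psi> (i + j) * a i else 0)" for j
  have g: "(g j)\<^sup>2 \<le> tot (\<lambda>i. if R j i then (a i)\<^sup>2 else 0)" for j
  proof -
    have "g j = tot (\<lambda>i. \<psi> (i + j) * (if R j i then a i else 0))"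
      by (auto simp: g_def intro!: nn_integral_cong)
    then have "(g j)\<^sup>2 \<le> tot (\<lambda>i. (\<psi> (i + j))\<^sup>2) * tot (\<lambda>i. (if R j i then a i else 0)\<^sup>2)"
      by (simp add: Cauchy_Schwarz_nn_integral)
    also have "tot (\<lambda>i. (\<psi> (i + j))\<^sup>2) = tot (\<lambda>i. (\<psi> i)\<^sup>2)"
      by (rule tot_shift)
    also have "\<dots> * tot (\<lambda>i. (if R j i then a i else 0)\<^sup>2) \<le> 1 * tot (\<lambda>i. (if R j i then a i else 0)\<^sup>2)"
      using \<psi> by (intro mult_right_mono) auto
    also have "\<dots> = tot (\<lambda>i. if R j i then (a i)\<^sup>2 else 0)"
      by (auto intro!: nn_integral_cong)
    finally show ?thesis .
  qed
  have "tot (\<lambda>j. b j * g j) = tot (\<lambda>j. (w j * b j) * (v j * g j))"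
  proof (rule nn_integral_cong)
    fix j
    have "w j * b j * (v j * g j) = (v j * w j) * (b j * g j)" by (simp only: mult_ac)
    then show "b j * g j = w j * b j * (v j * g j)" by (simp add: vw)
  qed
  then have *: "(tot (\<lambda>j. b j * g j))\<^sup>2 \<le> tot (\<lambda>j. (w j * b j)\<^sup>2) * tot (\<lambda>j. (v j * g j)\<^sup>2)"
    by (simp add: Cauchy_Schwarz_nn_integral)
  have "tot (\<lambda>j. (v j * g j)\<^sup>2) \<le> tot (\<lambda>j. (v j)\<^sup>2 * tot (\<lambda>i. if R j i then (a i)\<^sup>2 else 0))"
    unfolding power_mult_distrib by (intro tot_mono mult_left_mono g) auto
  also have "\<dots> = tot (\<lambda>j. tot (\<lambda>i. (a i)\<^sup>2 * (if R j i then (v j)\<^sup>2 else 0)))"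
    unfolding tot_cmult[symmetric] by (intro nn_integral_cong) (auto simp: mult.commute)
  also have "\<dots> = tot (\<lambda>i. (a i)\<^sup>2 * tot (\<lambda>j. (if R j i then (v j)\<^sup>2 else 0)))"
    by (subst tot_swap) (simp only: tot_cmult)
  also have "\<dots> \<le> tot (\<lambda>i. (a i)\<^sup>2 * (C * (w i)\<^sup>2))"
    by (intro tot_mono mult_left_mono v) auto
  also have "\<dots> = C * tot (\<lambda>k. (w k * a k)\<^sup>2)"
    by (simp add: tot_cmult[symmetric] power_mult_distrib mult_ac)
  finally have "tot (\<lambda>j. (v j * g j)\<^sup>2) \<le> C * tot (\<lambda>k. (w k * a k)\<^sup>2)" .
  from order_trans[OF * mult_left_mono[OF this]] show ?thesis
    by (simp add: g_def mult_ac)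
qed

text \<open>
  For \<open>w(k)\<^sup>2 = 1 + |k|\<^bsup>d/2\<^esup>\<close> and \<open>v = 1/w\<close> this is the endpoint product estimate
  \<open>H\<^bsup>d/4\<^esup> \<cdot> H\<^bsup>d/4\<^esup> \<subseteq> L\<^sup>2\<close>, a form of Sobolev's embedding of \<open>H\<^bsup>d/4\<^esup>\<close> into \<open>L\<^sup>4\<close>.  Interactions are split
  according to which of the two frequencies is larger.
\<close>

lemma l2_cv_critical:
  fixes a b w :: "'k::{ab_group_add,countable} \<Rightarrow> ennreal" and p :: "'k \<Rightarrow> real"
  assumes vw: "\<And>k. v k * w k = 1"
    and v: "\<And>i. tot (\<lambda>j. if p j \<le> p i then (v j)\<^sup>2 else 0) \<le> (ennreal C)\<^sup>2 * (w i)\<^sup>2"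
    and a: "tot (\<lambda>k. (w k * a k)\<^sup>2) \<le> (ennreal A)\<^sup>2"
    and b: "tot (\<lambda>k. (w k * b k)\<^sup>2) \<le> (ennreal B)\<^sup>2"
    and nonneg: "0 \<le> A" "0 \<le> B" "0 \<le> C"
  shows "dual_norm (l2_dual (\<lambda>_. 1)) (cv a b) \<le> ennreal (2 * C * A * B)"
proof (rule dual_normI)
  fix \<phi> :: "'k \<Rightarrow> ennreal" assume "\<phi> \<in> l2_dual (\<lambda>_. 1)"
  then have \<phi>: "tot (\<lambda>k. (\<phi> k)\<^sup>2) \<le> 1" by (auto simp: l2_dual_def)
  define H where "H a b = tot (\<lambda>j. b j * tot (\<lambda>i. if p j \<le> p i then \<phi> (i + j) * a i else 0))" for a b
  have H: "H a b \<le> ennreal (C * A * B)"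
    if "tot (\<lambda>k. (w k * a k)\<^sup>2) \<le> (ennreal A)\<^sup>2" "tot (\<lambda>k. (w k * b k)\<^sup>2) \<le> (ennreal B)\<^sup>2"
      "0 \<le> A" "0 \<le> B" for a b A B
  proof (rule ennreal_square_le)
    have "(H a b)\<^sup>2 \<le> (ennreal C)\<^sup>2 * tot (\<lambda>k. (w k * a k)\<^sup>2) * tot (\<lambda>k. (w k * b k)\<^sup>2)"
      unfolding H_def by (rule l2_cv_half[OF \<phi> vw v])
    also have "\<dots> \<le> (ennreal C)\<^sup>2 * (ennreal A)\<^sup>2 * (ennreal B)\<^sup>2"
      using that by (intro mult_mono) auto
    also have "\<dots> = (ennreal (C * A * B))\<^sup>2"
      using that nonneg by (simp add: power_mult_distrib ennreal_mult)
    finally show "(H a b)\<^sup>2 \<le> (ennreal (C * A * B))\<^sup>2" .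
  qed (use that nonneg in auto)
  have "tot (\<lambda>k. \<phi> k * cv a b k) = tot (\<lambda>i. tot (\<lambda>j. \<phi> (i + j) * (a i * b j)))"
    by (rule tot_mult_cv)
  \<comment> \<open>the diagonal \<open>p i = p j\<close> is counted twice\<close>
  also have "\<dots> \<le> tot (\<lambda>i. tot (\<lambda>j. (if p j \<le> p i then \<phi> (i + j) * (a i * b j) else 0)
      + (if p i \<le> p j then \<phi> (i + j) * (a i * b j) else 0)))"
    by (intro tot_mono) auto
  also have "\<dots> = tot (\<lambda>i. tot (\<lambda>j. (if p j \<le> p i then \<phi> (i + j) * (a i * b j) else 0)))
      + tot (\<lambda>i. tot (\<lambda>j. (if p i \<le> p j then \<phi> (i + j) * (a i * b j) else 0)))"
    by (simp only: tot_add)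
  also have "tot (\<lambda>i. tot (\<lambda>j. (if p j \<le> p i then \<phi> (i + j) * (a i * b j) else 0)))
      = tot (\<lambda>j. tot (\<lambda>i. (if p j \<le> p i then \<phi> (i + j) * (a i * b j) else 0)))"
    by (rule tot_swap)
  also have "\<dots> = H a b"
    unfolding H_def tot_cmult[symmetric] by (intro nn_integral_cong) (auto simp: mult_ac)
  also have "tot (\<lambda>i. tot (\<lambda>j. (if p i \<le> p j then \<phi> (i + j) * (a i * b j) else 0))) = H b a"
    unfolding H_def tot_cmult[symmetric] by (intro nn_integral_cong) (auto simp: mult_ac add.commute)
  also have "H a b + H b a \<le> ennreal (C * A * B) + ennreal (C * B * A)"
    using a b nonneg by (intro add_mono H) auto
  also have "\<dots> = ennreal (2 * C * A * B)"
    using nonneg by (simp flip: ennreal_plus add: mult_ac)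
  finally show "tot (\<lambda>k. \<phi> k * cv a b k) \<le> ennreal (2 * C * A * B)" .
qed

section \<open>Weights on the lattice of frequencies\<close>

lemma freq_add: "freq (j + k) = freq j + freq k"
  by (simp add: freq_def vec_eq_iff)

lemma freq_uminus: "freq (- k) = - freq k"
  by (simp add: freq_def vec_eq_iff)

lemma freq_diff: "freq (j - k) = freq j - freq k"
  by (simp add: freq_def vec_eq_iff)

lemma freq_zero [simp]: "freq 0 = 0"
  by (simp add: freq_def vec_eq_iff)

definition wt :: "real \<Rightarrow> int ^ 'd \<Rightarrow> real" where
  "wt s k = sqrt (1 + norm (freq k) powr (2 * s))"

lemma wt_ge_1: "1 \<le> wt s k"
  by (simp add: wt_def)

lemma wt_pos [simp]: "0 < wt s k" "0 \<le> wt s k"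
  using wt_ge_1[of s k] by linarith+

lemma wt_nz [simp]: "wt s k \<noteq> 0"
  using wt_pos(1)[of s k] by linarith

lemma wt_sq: "(wt s k)\<^sup>2 = 1 + norm (freq k) powr (2 * s)"
  by (simp add: wt_def add_nonneg_nonneg)

lemma wt_uminus: "wt s (- k) = wt s k"
  by (simp add: wt_def freq_uminus)

lemma powr_sq: "((x::real) powr s)\<^sup>2 = x powr (2 * s)"
  by (simp add: power2_eq_square flip: powr_add)

lemma wt_add_le:
  assumes "0 \<le> s" shows "wt s (i + j) \<le> 2 powr s * (wt s i + wt s j)"
proof -
  let ?x = "norm (freq i)" and ?y = "norm (freq j)"
  have "norm (freq (i + j)) powr (2 * s) \<le> (2 * max ?x ?y) powr (2 * s)"
    using assms norm_triangle_ineq[of "freq i" "freq j"] by (intro powr_mono2) (auto simp: freq_add)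
  also have "\<dots> = 2 powr (2 * s) * max ?x ?y powr (2 * s)"
    by (simp add: powr_mult)
  also have "\<dots> \<le> 2 powr (2 * s) * (?x powr (2 * s) + ?y powr (2 * s))"
    by (intro mult_left_mono) (auto simp: max_def)
  finally have 1: "norm (freq (i + j)) powr (2 * s) \<le> 2 powr (2 * s) * (?x powr (2 * s) + ?y powr (2 * s))" .
  have "1 \<le> (2::real) powr (2 * s)" using assms by (simp add: ge_one_powr_ge_zero)
  with 1 have "(wt s (i + j))\<^sup>2 \<le> 2 powr (2 * s) * ((wt s i)\<^sup>2 + (wt s j)\<^sup>2)"
    by (simp add: wt_sq distrib_left)
  also have "\<dots> \<le> 2 powr (2 * s) * (wt s i + wt s j)\<^sup>2"
    by (intro mult_left_mono) (auto simp: power2_sum)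
  also have "\<dots> = (2 powr s * (wt s i + wt s j))\<^sup>2"
    by (simp add: power_mult_distrib powr_sq)
  finally show ?thesis by (rule power2_le_imp_le) simp
qed

lemma one_plus_powr_le:
  fixes x p :: real assumes "0 \<le> x" "0 \<le> p"
  shows "(1 + x) powr p \<le> 2 powr p * (1 + x powr p)"
proof -
  have "(1 + x) powr p \<le> (2 * max 1 x) powr p"
    using assms by (intro powr_mono2) auto
  also have "\<dots> = 2 powr p * max 1 x powr p" using assms by (simp add: powr_mult)
  also have "\<dots> \<le> 2 powr p * (1 + x powr p)"
    by (intro mult_left_mono) (auto simp: max_def)
  finally show ?thesis .
qed

definition freq_box :: "nat \<Rightarrow> (int ^ 'd) set" where
  "freq_box R = {k. \<forall>i. \<bar>k $ i\<bar> \<le> int R}"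

lemma PiE_box: "PiE (UNIV::'d::finite set) (\<lambda>_. {-int R..int R}) = {h. \<forall>i. \<bar>h i\<bar> \<le> int R}"
proof -
  have "(x \<in> {-int R..int R}) = (\<bar>x\<bar> \<le> int R)" for x by auto
  then show ?thesis by (simp only: PiE_UNIV_domain Pi_def) simp
qed

lemma sum_freq_box_prod:
  fixes g :: "int \<Rightarrow> real"
  shows "(\<Sum>k\<in>(freq_box R :: (int ^ 'd) set). \<Prod>i\<in>UNIV. g (k $ i)) = (\<Sum>n=-int R..int R. g n) ^ CARD('d)"
proof -
  have "(\<Sum>n=-int R..int R. g n) ^ CARD('d) = (\<Prod>i\<in>(UNIV::'d set). \<Sum>n=-int R..int R. g n)"
    by simp
  also have "\<dots> = (\<Sum>h\<in>PiE (UNIV::'d set) (\<lambda>_. {-int R..int R}). \<Prod>i\<in>UNIV. g (h i))"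
    by (rule prod_sum_PiE) auto
  also have "\<dots> = (\<Sum>k\<in>(freq_box R :: (int ^ 'd) set). \<Prod>i\<in>UNIV. g (k $ i))"
    unfolding PiE_box
    by (rule sum.reindex_bij_witness[of _ vec_nth vec_lambda]) (simp_all add: freq_box_def vec_lambda_inverse)
  finally show ?thesis by simp
qed

lemma finite_freq_box: "finite (freq_box R :: (int ^ 'd) set)"
proof -
  have "finite (PiE (UNIV::'d set) (\<lambda>_. {-int R..int R}))"
    by (intro finite_PiE) auto
  then have "finite (vec_lambda ` {h::'d \<Rightarrow> int. \<forall>i. \<bar>h i\<bar> \<le> int R})"
    unfolding PiE_box by (rule finite_imageI)
  moreover have "freq_box R \<subseteq> vec_lambda ` {h::'d \<Rightarrow> int. \<forall>i. \<bar>h i\<bar> \<le> int R}"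
  proof
    fix k :: "int ^ 'd" assume "k \<in> freq_box R"
    then have "vec_nth k \<in> {h. \<forall>i. \<bar>h i\<bar> \<le> int R}" by (simp add: freq_box_def)
    from imageI[OF this, of vec_lambda]
    show "k \<in> vec_lambda ` {h::'d \<Rightarrow> int. \<forall>i. \<bar>h i\<bar> \<le> int R}"
      by (simp only: vec_lambda_eta)
  qed
  ultimately show ?thesis by (rule rev_finite_subset)
qed

lemma component_le_norm_freq: "\<bar>real_of_int (k $ i)\<bar> \<le> norm (freq k)"
  using component_le_norm_cart[of "freq k" i] by (simp add: freq_def)

lemma sum_symmetric_le:
  fixes h :: "nat \<Rightarrow> real" assumes "\<And>n. 0 \<le> h n"
  shows "(\<Sum>n=-int R..int R. h (nat \<bar>n\<bar>)) \<le> 2 * (\<Sum>n\<le>R. h n)"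
proof -
  have "{-int R..int R} \<subseteq> int ` {..R} \<union> (\<lambda>n. - int n) ` {..R}"
  proof
    fix n assume "n \<in> {-int R..int R}"
    then show "n \<in> int ` {..R} \<union> (\<lambda>n. - int n) ` {..R}"
      by (cases "0 \<le> n") (auto intro: image_eqI[of _ _ "nat n"] image_eqI[of _ _ "nat (- n)"])
  qed
  then have "(\<Sum>n=-int R..int R. h (nat \<bar>n\<bar>)) \<le> (\<Sum>n\<in>int ` {..R} \<union> (\<lambda>n. - int n) ` {..R}. h (nat \<bar>n\<bar>))"
    using assms by (intro sum_mono2) auto
  also have "\<dots> \<le> (\<Sum>n\<in>int ` {..R}. h (nat \<bar>n\<bar>)) + (\<Sum>n\<in>(\<lambda>n. - int n) ` {..R}. h (nat \<bar>n\<bar>))"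
    using assms by (subst sum_Un) (auto intro!: sum_nonneg)
  also have "\<dots> = 2 * (\<Sum>n\<le>R. h n)"
    by (subst (1 2) sum.reindex) (auto simp: inj_on_def)
  finally show ?thesis .
qed

text \<open>
  Boxes exhaust the lattice, and sums of products over boxes factor into one-dimensional sums.
\<close>

lemma tot_le_freq_box:
  fixes f :: "int ^ 'd \<Rightarrow> real"
  assumes "\<And>R. (\<Sum>k\<in>freq_box R. f k) \<le> M" "\<And>k. 0 \<le> f k"
  shows "tot (\<lambda>k. ennreal (f k)) \<le> ennreal M"
proof -
  let ?g = "\<lambda>R k. ennreal (f k) * indicator (freq_box R) k"
  have box: "\<exists>R. k \<in> freq_box R" for k :: "int ^ 'd"
  proof
    have "\<bar>k $ i\<bar> \<le> (\<Sum>i\<in>UNIV. \<bar>k $ i\<bar>)" for i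
      by (rule member_le_sum) auto
    then show "k \<in> freq_box (nat (\<Sum>i\<in>UNIV. \<bar>k $ i\<bar>))"
      by (simp add: freq_box_def sum_nonneg)
  qed
  have "(SUP R. ?g R k) = ennreal (f k)" for k
  proof (rule antisym)
    obtain R where "k \<in> freq_box R" using box by blast
    then have "ennreal (f k) = ?g R k" by simp
    also have "\<dots> \<le> (SUP R. ?g R k)" by (rule SUP_upper) simp
    finally show "ennreal (f k) \<le> (SUP R. ?g R k)" .
  qed (auto intro!: SUP_least split: split_indicator)
  then have "tot (\<lambda>k. ennreal (f k)) = tot (\<lambda>k. SUP R. ?g R k)" by simp
  also have "\<dots> = (SUP R. tot (?g R))"
  proof (rule nn_integral_monotone_convergence_SUP)
    have "freq_box R \<subseteq> (freq_box R' :: (int ^ 'd) set)" if "R \<le> R'" for R R'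
      using that unfolding freq_box_def by (auto intro: order_trans)
    then show "incseq ?g"
      by (auto simp: incseq_def le_fun_def split: split_indicator)
  qed auto
  also have "\<dots> \<le> ennreal M"
  proof (rule SUP_least)
    fix R
    have "tot (?g R) = (\<Sum>k\<in>freq_box R. ?g R k)"
      by (rule nn_integral_count_space'[OF finite_freq_box]) auto
    also have "\<dots> = ennreal (\<Sum>k\<in>freq_box R. f k)"
      using assms(2) by (simp add: sum_ennreal)
    also have "\<dots> \<le> ennreal M" using assms(1) by (rule ennreal_leI)
    finally show "tot (?g R) \<le> ennreal M" .
  qed
  finally show ?thesis .
qed

text \<open>
  Every component of \<open>k\<close> is at most \<open>|k|\<close>, so a power of \<open>1 + |k|\<close> can be shared out equally among the
  components; this reduces lattice sums to dimension one.
\<close>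

lemma powr_le_prod:
  fixes k :: "int ^ 'd" assumes "0 \<le> p"
  shows "(1 + norm (freq k)) powr (- p)
    \<le> (\<Prod>i\<in>UNIV. (1 + real (nat \<bar>k $ i\<bar>)) powr (- (p / CARD('d))))"
proof -
  have "(1 + norm (freq k)) powr (- p) = (\<Prod>i\<in>(UNIV::'d set). (1 + norm (freq k)) powr (- (p / CARD('d))))"
    using add_pos_nonneg[OF zero_less_one norm_ge_zero[of "freq k"]]
    by (simp add: powr_power)
  also have "\<dots> \<le> (\<Prod>i\<in>UNIV. (1 + real (nat \<bar>k $ i\<bar>)) powr (- (p / CARD('d))))"
    using component_le_norm_freq[of k] assms
    by (intro prod_mono conjI powr_mono2') auto
  finally show ?thesis .
qed

lemma tot_freq_powr_finite:
  assumes "p > real CARD('d)"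
  shows "\<exists>c>0. tot (\<lambda>k::int ^ 'd. ennreal ((1 + norm (freq k)) powr (- p))) \<le> ennreal c"
proof -
  define h where "h n = (1 + real n) powr (- (p / CARD('d)))" for n
  have "summable (\<lambda>n. real (Suc n) powr (- (p / CARD('d))))"
    using assms by (subst summable_Suc_iff, subst summable_real_powr_iff) (auto simp: field_simps)
  then have h: "summable h" by (simp add: h_def[abs_def])
  have h0: "0 \<le> h n" for n by (simp add: h_def)
  define c where "c = (2 * suminf h) ^ CARD('d)"
  have "h 0 \<le> suminf h" using sum_le_suminf[OF h, of "{0}"] h0 by simp
  then have "c > 0" by (simp add: c_def h_def)
  have "tot (\<lambda>k::int ^ 'd. ennreal ((1 + norm (freq k)) powr (- p))) \<le> ennreal c"
  proof (rule tot_le_freq_box)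
    fix R
    have "(\<Sum>k\<in>freq_box R. (1 + norm (freq (k::int ^ 'd))) powr (- p))
       \<le> (\<Sum>k\<in>freq_box R. \<Prod>i\<in>UNIV. h (nat \<bar>(k::int ^ 'd) $ i\<bar>))"
      unfolding h_def using assms by (intro sum_mono powr_le_prod) linarith
    also have "\<dots> = (\<Sum>n=-int R..int R. h (nat \<bar>n\<bar>)) ^ CARD('d)"
      by (rule sum_freq_box_prod)
    also have "\<dots> \<le> (2 * (\<Sum>n\<le>R. h n)) ^ CARD('d)"
      using h0 by (intro power_mono sum_symmetric_le sum_nonneg) auto
    also have "\<dots> \<le> c" unfolding c_def using h h0
      by (intro power_mono mult_left_mono sum_le_suminf mult_nonneg_nonneg sum_nonneg) auto
    finally show "(\<Sum>k\<in>freq_box R. (1 + norm (freq (k::int ^ 'd))) powr (- p)) \<le> c" .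
  qed simp
  with \<open>c > 0\<close> show ?thesis by blast
qed

text \<open>
  By induction, since \<open>1 / sqrt (n + 1) \<le> 2 (sqrt (n + 1) - sqrt n)\<close>.
\<close>

lemma sum_inverse_sqrt_le: "(\<Sum>n\<le>R. (1 + real n) powr (- (1/2))) \<le> 2 * sqrt (1 + real R)"
proof (induction R)
  case (Suc R)
  define a where "a = sqrt (1 + real R)"
  define b where "b = sqrt (2 + real R)"
  have ab: "0 \<le> a" "a \<le> b" "0 < b" "b\<^sup>2 = a\<^sup>2 + 1" by (auto simp: a_def b_def)
  have "(b - a) * (b + a) = 1" using ab by (simp add: algebra_simps power2_eq_square)
  moreover have "(b - a) * (b + a) \<le> (b - a) * (2 * b)"
    using ab by (intro mult_left_mono) auto
  ultimately have "1 / b \<le> 2 * (b - a)"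
    using ab by (simp add: field_simps)
  moreover have "(1 + real (Suc R)) powr (- (1/2)) = 1 / b"
    unfolding powr_minus_divide b_def by (subst powr_half_sqrt) auto
  ultimately show ?case using Suc by (simp add: a_def b_def add_ac)
qed simp

text \<open>
  The growth rate \<open>R\<^bsup>d/2\<^esup>\<close> of the sum of \<open>|j|\<^bsup>-d/2\<^esup>\<close> over the ball of radius \<open>R\<close>, which is what makes
  the critical product estimate work.
\<close>

lemma tot_freq_ball_le:
  fixes i :: "int ^ 'd"
  shows "tot (\<lambda>j::int ^ 'd. ennreal (if norm (freq j) \<le> norm (freq i)
      then (1 + norm (freq j)) powr (- (CARD('d) / 2)) else 0))
    \<le> ennreal (8 ^ CARD('d) * (1 + norm (freq i)) powr (CARD('d) / 2))"
proof (rule tot_le_freq_box)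
  fix R
  define x where "x = norm (freq i)"
  define Q where "Q = nat \<lfloor>x\<rfloor>"
  define h where "h n = (1 + real n) powr (- (1/2))" for n
  have h0: "0 \<le> h n" for n by (simp add: h_def)
  have x0: "0 \<le> x" by (simp add: x_def)
  have "(\<Sum>j\<in>(freq_box R::(int ^ 'd) set). if norm (freq j) \<le> x then (1 + norm (freq j)) powr (- (CARD('d) / 2)) else 0)
      = (\<Sum>j\<in>freq_box R \<inter> {j. norm (freq j) \<le> x}. (1 + norm (freq (j::int ^ 'd))) powr (- (CARD('d) / 2)))"
    by (subst sum.inter_restrict[OF finite_freq_box]) simp
  also have "\<dots> \<le> (\<Sum>j\<in>freq_box Q. (1 + norm (freq (j::int ^ 'd))) powr (- (CARD('d) / 2)))"
  proof (rule sum_mono2[OF finite_freq_box])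
    have "\<bar>k $ l\<bar> \<le> int Q" if "norm (freq k) \<le> x" for k :: "int ^ 'd" and l
      using component_le_norm_freq[of k l] that x0 unfolding Q_def by simp linarith
    then show "freq_box R \<inter> {j. norm (freq j) \<le> x} \<subseteq> (freq_box Q :: (int ^ 'd) set)"
      by (auto simp: freq_box_def)
  qed auto
  also have "\<dots> \<le> (\<Sum>k\<in>freq_box Q. \<Prod>i\<in>UNIV. h (nat \<bar>(k::int ^ 'd) $ i\<bar>))"
    using powr_le_prod[of "CARD('d) / 2", where 'd='d] by (intro sum_mono) (simp add: h_def)
  also have "\<dots> = (\<Sum>n=-int Q..int Q. h (nat \<bar>n\<bar>)) ^ CARD('d)"
    by (rule sum_freq_box_prod)
  also have "\<dots> \<le> (2 * (\<Sum>n\<le>Q. h n)) ^ CARD('d)"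
    using h0 by (intro power_mono sum_symmetric_le sum_nonneg) auto
  also have "\<dots> \<le> (2 * (2 * sqrt (1 + real Q))) ^ CARD('d)"
    unfolding h_def by (intro power_mono mult_left_mono sum_inverse_sqrt_le) (auto intro!: sum_nonneg)
  also have "\<dots> \<le> (8 * sqrt (1 + x)) ^ CARD('d)"
  proof (intro power_mono)
    have "sqrt (1 + real Q) \<le> sqrt (1 + x)" using x0 by (simp add: Q_def)
    moreover have "0 \<le> sqrt (1 + x)" using x0 by simp
    ultimately show "2 * (2 * sqrt (1 + real Q)) \<le> 8 * sqrt (1 + x)" by linarith
  qed auto
  also have "\<dots> = 8 ^ CARD('d) * (1 + x) powr (CARD('d) / 2)"
  proof -
    have "sqrt (1 + x) ^ CARD('d) = ((1 + x) powr (1 / 2)) ^ CARD('d)"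
      using x0 by (simp add: powr_half_sqrt)
    also have "\<dots> = (1 + x) powr (CARD('d) / 2)"
      using x0 by (subst powr_power) auto
    finally show ?thesis by (simp add: power_mult_distrib)
  qed
  finally show "(\<Sum>j\<in>(freq_box R::(int ^ 'd) set). if norm (freq j) \<le> norm (freq i) then (1 + norm (freq j)) powr (- (CARD('d) / 2)) else 0)
    \<le> 8 ^ CARD('d) * (1 + norm (freq i)) powr (CARD('d) / 2)"
    by (simp add: x_def)
qed simp

text \<open>
  \<open>H\<^sup>s\<close> embeds into the sequences with \<open>(1 + |k|)\<^sup>\<gamma> a\<^sub>k\<close> summable when \<open>s - \<gamma> > d/2\<close>.
\<close>

lemma weighted_tot_le:
  assumes s: "0 \<le> \<gamma>" "real CARD('d) / 2 < s - \<gamma>"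
  shows "\<exists>c>0. \<forall>a::int ^ 'd \<Rightarrow> ennreal.
    tot (\<lambda>k. ennreal ((1 + norm (freq k)) powr \<gamma>) * a k) \<le> ennreal c * dual_norm (l2_dual (\<lambda>k. ennreal (wt s k))) a"
proof -
  let ?m = "\<lambda>k::int ^ 'd. (1 + norm (freq k)) powr \<gamma>"
  have "0 \<le> s" using s by (smt (verit) of_nat_0_le_iff divide_nonneg_pos)
  obtain c where c: "c > 0" "tot (\<lambda>k::int ^ 'd. ennreal ((1 + norm (freq k)) powr (- (2 * (s - \<gamma>))))) \<le> ennreal c"
    using tot_freq_powr_finite[of "2 * (s - \<gamma>)", where 'd='d] s by auto
  define C where "C = 2 powr s * sqrt c"
  have C: "C > 0" using c by (simp add: C_def)
  have x1: "1 + norm (freq k) \<noteq> 0" for k :: "int ^ 'd" using norm_ge_zero[of "freq k"] by linarith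
  have m: "?m k > 0" for k using x1[of k] by simp
  let ?v = "\<lambda>k. ennreal (?m k / wt s k)" and ?w = "\<lambda>k. ennreal (wt s k / ?m k)"
  have v: "(?m k / wt s k)\<^sup>2 \<le> (2 powr s)\<^sup>2 * (1 + norm (freq k)) powr (- (2 * (s - \<gamma>)))" for k
  proof -
    let ?x = "norm (freq k)"
    have "(1 + ?x) powr (2 * s) \<le> (2 powr s)\<^sup>2 * (wt s k)\<^sup>2"
      using one_plus_powr_le[of ?x "2 * s"] \<open>0 \<le> s\<close>
      by (simp add: wt_sq powr_sq)
    then have "?m k ^ 2 * (1 + ?x) powr (- (2 * s)) * (1 + ?x) powr (2 * s)
       \<le> ?m k ^ 2 * (1 + ?x) powr (- (2 * s)) * ((2 powr s)\<^sup>2 * (wt s k)\<^sup>2)"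
      by (intro mult_left_mono) auto
    also have "?m k ^ 2 * (1 + ?x) powr (- (2 * s)) * (1 + ?x) powr (2 * s) = ?m k ^ 2"
      using m[of k] by (simp add: mult.assoc powr_add[symmetric] x1)
    also have "?m k ^ 2 * (1 + ?x) powr (- (2 * s)) = (1 + ?x) powr (- (2 * (s - \<gamma>)))"
      by (simp add: powr_sq powr_add[symmetric] algebra_simps x1)
    finally show ?thesis
      by (simp add: power_divide pos_divide_le_eq mult_ac)
  qed
  have "tot a' \<le> ennreal C * dual_norm (l2_dual ?w) a'" for a'
  proof (rule tot_le_l2_norm)
    show "?v k * ?w k = 1" for k
      using m[of k] by (simp flip: ennreal_mult)
    have "tot (\<lambda>k. (?v k)\<^sup>2) \<le> tot (\<lambda>k::int ^ 'd. ennreal ((2 powr s)\<^sup>2) * ennreal ((1 + norm (freq k)) powr (- (2 * (s - \<gamma>)))))"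
    proof (rule tot_mono)
      fix k :: "int ^ 'd"
      show "(?v k)\<^sup>2 \<le> ennreal ((2 powr s)\<^sup>2) * ennreal ((1 + norm (freq k)) powr (- (2 * (s - \<gamma>))))"
        using v[of k] by (simp add: ennreal_power flip: ennreal_mult)
    qed
    also have "\<dots> \<le> ennreal ((2 powr s)\<^sup>2) * ennreal c"
      unfolding tot_cmult by (intro mult_left_mono c) auto
    also have "\<dots> = (ennreal C)\<^sup>2"
      using c by (simp add: C_def ennreal_power power_mult_distrib flip: ennreal_mult)
    finally show "tot (\<lambda>k. (?v k)\<^sup>2) \<le> (ennreal C)\<^sup>2" .
  qed (rule C)
  then have *: "tot (\<lambda>k. ennreal (?m k) * a k) \<le> ennreal C * dual_norm (l2_dual ?w) (\<lambda>k. ennreal (?m k) * a k)" for a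
    by simp
  have "dual_norm (l2_dual ?w) (\<lambda>k. ennreal (?m k) * a k) = dual_norm (l2_dual (\<lambda>k. ennreal (wt s k))) a" for a
  proof -
    have "?w k * (ennreal (?m k) * a k) = ennreal (wt s k) * a k" for k
      using m[of k] by (simp add: mult.assoc[symmetric] less_imp_le flip: ennreal_mult)
    then show ?thesis by (simp add: l2_weight[of "?w"] l2_weight[of "\<lambda>k. ennreal (wt s k)"])
  qed
  with * C show ?thesis by auto
qed

text \<open>
  One derivative maps \<open>H\<^bsup>s+1\<^esup>\<close> to \<open>H\<^sup>s\<close>.
\<close>

lemma wt_mult_freq_le:
  assumes "0 < s" shows "wt s k * norm (freq k) \<le> sqrt 2 * wt (s + 1) k"
proof (rule power2_le_imp_le)
  let ?x = "norm (freq k)"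
  have 1: "?x\<^sup>2 * ?x powr (2 * s) = ?x powr (2 * (s + 1))"
  proof (cases "?x = 0")
    case False
    then have "?x\<^sup>2 * ?x powr (2 * s) = ?x powr 2 * ?x powr (2 * s)" by simp
    then show ?thesis by (simp only: powr_add[symmetric] distrib_left) (simp add: add.commute)
  qed simp
  have 2: "?x\<^sup>2 \<le> 1 + ?x powr (2 * (s + 1))"
  proof (cases "?x \<le> 1")
    case True
    then have "?x\<^sup>2 \<le> 1" by (simp add: power_le_one)
    then show ?thesis by (smt (verit) powr_ge_zero)
  next
    case False
    then have "?x powr 2 \<le> ?x powr (2 * (s + 1))" using assms by (intro powr_mono) auto
    moreover have "?x powr 2 = ?x\<^sup>2" using False by simp
    ultimately show ?thesis by simp
  qed
  show "(wt s k * ?x)\<^sup>2 \<le> (sqrt 2 * wt (s + 1) k)\<^sup>2"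
    using 1 2 by (simp add: power_mult_distrib wt_sq algebra_simps)
qed simp

lemma critical_weight:
  fixes i :: "int ^ 'd"
  defines "s \<equiv> real CARD('d) / 4"
  shows "tot (\<lambda>j::int ^ 'd. if norm (freq j) \<le> norm (freq i) then (ennreal (1 / wt s j))\<^sup>2 else 0)
    \<le> (ennreal (2 powr s * 2 powr s * sqrt (8 ^ CARD('d))))\<^sup>2 * (ennreal (wt s i))\<^sup>2"
proof -
  have s0: "0 \<le> s" by (simp add: s_def)
  have up: "(1 + norm (freq k)) powr (CARD('d) / 2) \<le> (2 powr s)\<^sup>2 * (wt s k)\<^sup>2" for k :: "int ^ 'd"
    using one_plus_powr_le[of "norm (freq k)" "2 * s"] s0
    by (simp add: wt_sq powr_sq s_def)
  have dn: "(1 / wt s k)\<^sup>2 \<le> (2 powr s)\<^sup>2 * (1 + norm (freq k)) powr (- (CARD('d) / 2))" for k :: "int ^ 'd"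
    using up[of k] add_pos_nonneg[OF zero_less_one norm_ge_zero[of "freq k"]]
    by (simp add: powr_minus_divide power_divide pos_divide_le_eq pos_le_divide_eq mult_ac)
  have "tot (\<lambda>j::int ^ 'd. if norm (freq j) \<le> norm (freq i) then (ennreal (1 / wt s j))\<^sup>2 else 0)
     \<le> tot (\<lambda>j::int ^ 'd. ennreal ((2 powr s)\<^sup>2) * ennreal (if norm (freq j) \<le> norm (freq i)
      then (1 + norm (freq j)) powr (- (CARD('d) / 2)) else 0))"
    by (rule tot_mono) (use dn in \<open>auto simp: ennreal_power simp flip: ennreal_mult\<close>)
  also have "\<dots> \<le> ennreal ((2 powr s)\<^sup>2) * ennreal (8 ^ CARD('d) * (1 + norm (freq i)) powr (CARD('d) / 2))"
    unfolding tot_cmult by (intro mult_left_mono tot_freq_ball_le) auto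
  also have "\<dots> = ennreal ((2 powr s)\<^sup>2 * (8 ^ CARD('d) * (1 + norm (freq i)) powr (CARD('d) / 2)))"
    by (simp flip: ennreal_mult)
  also have "\<dots> \<le> ennreal ((2 powr s)\<^sup>2 * (8 ^ CARD('d) * ((2 powr s)\<^sup>2 * (wt s i)\<^sup>2)))"
    by (intro ennreal_leI mult_left_mono up) auto
  also have "\<dots> = (ennreal (2 powr s * 2 powr s * sqrt (8 ^ CARD('d))))\<^sup>2 * (ennreal (wt s i))\<^sup>2"
    by (simp add: ennreal_power power_mult_distrib mult_ac flip: ennreal_mult)
  finally show ?thesis .
qed

section \<open>Complex sequences and convolution\<close>

abbreviation (input) csum :: "('k \<Rightarrow> complex) \<Rightarrow> complex" where
  "csum a \<equiv> (\<integral>k. a k \<partial>count_space UNIV)"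

abbreviation (input) nm :: "('k \<Rightarrow> complex) \<Rightarrow> 'k \<Rightarrow> ennreal" where
  "nm a \<equiv> (\<lambda>k. ennreal (cmod (a k)))"

lemma integrable_csum: "integrable (count_space UNIV) (a :: 'k \<Rightarrow> complex) \<longleftrightarrow> tot (nm a) < \<infinity>"
  by (simp add: integrable_iff_bounded)

lemma csum_norm_le: "ennreal (cmod (csum a)) \<le> tot (nm a)"
proof (cases "integrable (count_space UNIV) a")
  case True
  then show ?thesis by (rule integral_norm_bound_ennreal)
qed (simp add: not_integrable_integral_eq)

lemma csum_swap:
  fixes f :: "'k::countable \<Rightarrow> 'a \<Rightarrow> complex"
  assumes M: "sigma_finite_measure M" and f: "\<And>k. f k \<in> borel_measurable M"
    and fin: "tot (\<lambda>k. \<integral>\<^sup>+x. cmod (f k x) \<partial>M) < \<infinity>"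
  shows "(\<integral>x. csum (\<lambda>k. f k x) \<partial>M) = csum (\<lambda>k. \<integral>x. f k x \<partial>M)"
    and "integrable M (\<lambda>x. csum (\<lambda>k. f k x))"
proof -
  interpret pair_sigma_finite "count_space (UNIV::'k set)" M
    using M sigma_finite_measure_count_space by (simp add: pair_sigma_finite_def)
  have meas: "case_prod f \<in> borel_measurable (count_space UNIV \<Otimes>\<^sub>M M)"
    by (rule measurable_pair_measure_countable1) (use f in auto)
  have "(\<integral>\<^sup>+p. cmod (case_prod f p) \<partial>(count_space UNIV \<Otimes>\<^sub>M M)) = tot (\<lambda>k. \<integral>\<^sup>+x. cmod (f k x) \<partial>M)"
    using meas by (subst M2.nn_integral_fst[symmetric]) (auto intro!: nn_integral_cong)
  then have int: "integrable (count_space UNIV \<Otimes>\<^sub>M M) (case_prod f)"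
    using fin meas by (simp add: integrable_iff_bounded)
  show "(\<integral>x. csum (\<lambda>k. f k x) \<partial>M) = csum (\<lambda>k. \<integral>x. f k x \<partial>M)"
    by (rule Fubini_integral[OF int])
  show "integrable M (\<lambda>x. csum (\<lambda>k. f k x))"
    using integrable_snd[OF int] by simp
qed

lemma borel_measurable_csum:
  fixes f :: "'k::countable \<Rightarrow> 'a \<Rightarrow> complex"
  assumes "\<And>k. f k \<in> borel_measurable M"
  shows "(\<lambda>x. csum (\<lambda>k. f k x)) \<in> borel_measurable M"
proof -
  interpret sigma_finite_measure "count_space (UNIV::'k set)"
    by (rule sigma_finite_measure_count_space)
  have "case_prod f \<in> borel_measurable (count_space UNIV \<Otimes>\<^sub>M M)"
    by (rule measurable_pair_measure_countable1) (use assms in auto)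
  from measurable_pair_swap[OF this]
  have "case_prod (\<lambda>x k. f k x) \<in> borel_measurable (M \<Otimes>\<^sub>M count_space UNIV)"
    by (simp add: case_prod_unfold)
  then show ?thesis by (rule borel_measurable_lebesgue_integral)
qed

definition conv :: "('k::{ab_group_add,countable} \<Rightarrow> complex) \<Rightarrow> ('k \<Rightarrow> complex) \<Rightarrow> 'k \<Rightarrow> complex" where
  "conv a b k = csum (\<lambda>j. a j * b (k - j))"

lemma nm_mult: "ennreal (cmod (x * y)) = ennreal (cmod x) * ennreal (cmod y)"
  by (simp add: norm_mult ennreal_mult)

lemma nm_conv_le:
  fixes a b :: "'k::{ab_group_add,countable} \<Rightarrow> complex"
  shows "nm (conv a b) k \<le> cv (nm a) (nm b) k"
  using csum_norm_le[of "\<lambda>j. a j * b (k - j)"] by (simp add: conv_def cv_def nm_mult)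

lemma tot_nm_conv:
  fixes a b :: "'k::{ab_group_add,countable} \<Rightarrow> complex"
  shows "tot (nm (conv a b)) \<le> tot (nm a) * tot (nm b)"
  unfolding tot_cv[symmetric] by (intro tot_mono nm_conv_le)

lemma tot_nm_conv_finite:
  fixes a b :: "'k::{ab_group_add,countable} \<Rightarrow> complex"
  shows "tot (nm a) < \<infinity> \<Longrightarrow> tot (nm b) < \<infinity> \<Longrightarrow> tot (nm (conv a b)) < \<infinity>"
  by (rule le_less_trans[OF tot_nm_conv]) (simp add: ennreal_mult_less_top)

lemma integrable_conv:
  fixes a b :: "'k::{ab_group_add,countable} \<Rightarrow> complex"
  assumes "tot (nm a) < \<infinity>" "tot (nm b) < \<infinity>"
  shows "integrable (count_space UNIV) (\<lambda>j. a j * b (k - j))"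
  unfolding integrable_csum
proof -
  have "tot (nm (\<lambda>j. a j * b (k - j))) = cv (nm a) (nm b) k"
    by (simp add: cv_def nm_mult)
  also have "\<dots> \<le> tot (cv (nm a) (nm b))" by (rule le_tot)
  also have "\<dots> < \<infinity>" using assms by (simp add: tot_cv ennreal_mult_less_top)
  finally show "tot (nm (\<lambda>j. a j * b (k - j))) < \<infinity>" .
qed

lemma conv_diff_left:
  fixes a b :: "'k::{ab_group_add,countable} \<Rightarrow> complex"
  assumes "tot (nm a) < \<infinity>" "tot (nm a') < \<infinity>" "tot (nm b) < \<infinity>"
  shows "conv (\<lambda>k. a k - a' k) b k = conv a b k - conv a' b k"
  unfolding conv_def using assms
  by (subst Bochner_Integration.integral_diff[symmetric]) (auto intro!: integrable_conv simp: left_diff_distrib)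

lemma conv_diff_right:
  fixes a b :: "'k::{ab_group_add,countable} \<Rightarrow> complex"
  assumes "tot (nm a) < \<infinity>" "tot (nm b') < \<infinity>" "tot (nm b) < \<infinity>"
  shows "conv a (\<lambda>k. b k - b' k) k = conv a b k - conv a b' k"
  unfolding conv_def using assms
  by (subst Bochner_Integration.integral_diff[symmetric]) (auto intro!: integrable_conv simp: right_diff_distrib)

text \<open>
  The coefficients of the complex conjugate of a function with coefficients \<open>v\<close>.
\<close>

definition conj_seq :: "('k::ab_group_add \<Rightarrow> complex) \<Rightarrow> 'k \<Rightarrow> complex" where
  "conj_seq v k = cnj (v (- k))"

lemma nm_conj_seq: "nm (conj_seq v) = refl_seq (nm v)"
  by (simp add: conj_seq_def)

lemma tot_nm_conj_seq: "tot (nm (conj_seq v)) = tot (nm v)"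
  unfolding nm_conj_seq by (rule tot_uminus)

text \<open>
  The coefficients of \<open>f\<^sup>2 g\<close>, where \<open>g\<close> is the multiplier \<open>m\<close> applied to \<open>cnj f\<close>: the multiplier
  acts on the conjugate only, as in the scheme.
\<close>

definition cubic :: "('k::{ab_group_add,countable} \<Rightarrow> complex) \<Rightarrow> ('k \<Rightarrow> complex) \<Rightarrow> 'k \<Rightarrow> complex" where
  "cubic m v = conv (conv v v) (\<lambda>k. m k * conj_seq v k)"

lemma nm_multiplier_le: "cmod (m k) \<le> 1 \<Longrightarrow> nm (\<lambda>k. m k * v k) k \<le> nm v k"
  by (simp add: norm_mult mult_left_le_one_le)

lemma tot_multiplier:
  assumes "\<And>k. cmod (m k) \<le> 1" "tot (nm v) < \<infinity>" shows "tot (nm (\<lambda>k. m k * v k)) < \<infinity>"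
  by (rule le_less_trans[OF tot_mono assms(2)]) (rule nm_multiplier_le[of m, OF assms(1)])

text \<open>
  Majorant of the difference of two cubic terms, if \<open>d\<close> majorizes the difference of the arguments and
  \<open>P\<close> both arguments.
\<close>

definition trilin :: "('k::{ab_group_add,countable} \<Rightarrow> ennreal) \<Rightarrow> ('k \<Rightarrow> ennreal) \<Rightarrow> 'k \<Rightarrow> ennreal" where
  "trilin d P k = cv (cv d P) (refl_seq P) k + cv (cv P d) (refl_seq P) k + cv (cv P P) (refl_seq d) k"

lemma nm_cubic_le:
  assumes "\<And>k. cmod (m k) \<le> 1"
  shows "nm (cubic m v) k \<le> cv (cv (nm v) (nm v)) (refl_seq (nm v)) k"
  unfolding cubic_def nm_conj_seq[symmetric] using assms
  by (intro order_trans[OF nm_conv_le] cv_mono nm_conv_le nm_multiplier_le)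

text \<open>
  Telescoping \<open>a a a' - b b b' = (a - b) a a' + b (a - b) a' + b b (a - b)'\<close>.
\<close>

lemma nm_diff_cubic_le:
  assumes m: "\<And>k. cmod (m k) \<le> 1"
    and P: "tot P < \<infinity>" "\<And>k. nm a k \<le> P k" "\<And>k. nm b k \<le> P k"
    and d: "\<And>k. nm (\<lambda>k. a k - b k) k \<le> d k"
  shows "nm (\<lambda>k. cubic m a k - cubic m b k) k \<le> trilin d P k"
proof -
  have a: "tot (nm a) < \<infinity>" and b: "tot (nm b) < \<infinity>"
    using P by (auto intro: le_less_trans[OF tot_mono])
  let ?e = "\<lambda>k. a k - b k"
  have "tot (nm ?e) \<le> tot (nm a) + tot (nm b)"
    unfolding tot_add[symmetric]
    by (intro tot_mono) (simp add: norm_triangle_ineq4 flip: ennreal_plus)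
  then have e: "tot (nm ?e) < \<infinity>" using a b by (simp add: le_less_trans)
  let ?ra = "\<lambda>k. m k * conj_seq a k" and ?rb = "\<lambda>k. m k * conj_seq b k"
  have ra: "tot (nm ?ra) < \<infinity>" and rb: "tot (nm ?rb) < \<infinity>" and re: "tot (nm (\<lambda>k. m k * conj_seq ?e k)) < \<infinity>"
    using a b e by (auto intro!: tot_multiplier m simp del: infinity_ennreal_def simp add: tot_nm_conj_seq[unfolded])
  have re': "m k * conj_seq ?e k = ?ra k - ?rb k" for k
    by (simp add: conj_seq_def algebra_simps)
  have 1: "conv ?e a k = conv a a k - conv b a k" for k
    by (rule conv_diff_left) fact+
  have 2: "conv b ?e k = conv b a k - conv b b k" for k
    by (rule conv_diff_right) fact+
  note fin = tot_nm_conv_finite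
  have "conv (conv ?e a) ?ra k + conv (conv b ?e) ?ra k + conv (conv b b) (\<lambda>k. m k * conj_seq ?e k) k
    = (conv (conv a a) ?ra k - conv (conv b a) ?ra k) + (conv (conv b a) ?ra k - conv (conv b b) ?ra k)
    + (conv (conv b b) ?ra k - conv (conv b b) ?rb k)"
    unfolding 1 2 re' using a b ra rb by (simp only: conv_diff_left conv_diff_right fin)
  then have eq: "cubic m a k - cubic m b k
    = conv (conv ?e a) ?ra k + conv (conv b ?e) ?ra k + conv (conv b b) (\<lambda>k. m k * conj_seq ?e k) k"
    by (simp add: cubic_def)
  have raP: "nm ?ra k \<le> refl_seq P k" for k
    by (rule order_trans[OF nm_multiplier_le[of m, OF m]]) (simp add: conj_seq_def P)
  have reP: "nm (\<lambda>k. m k * conj_seq ?e k) k \<le> refl_seq d k" for k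
    using d[of "-k"] by (intro order_trans[OF nm_multiplier_le[of m, OF m]]) (simp add: conj_seq_def del: complex_cnj_diff)
  have tri: "ennreal (cmod (x + y + z)) \<le> ennreal (cmod x) + ennreal (cmod y) + ennreal (cmod z)" for x y z
    by (simp add: norm_triangle_ineq norm_add_rule_thm order_trans[OF norm_triangle_ineq] flip: ennreal_plus)
  show ?thesis
    unfolding eq trilin_def
    by (rule order_trans[OF tri], intro add_mono)
       (intro order_trans[OF nm_conv_le] cv_mono nm_conv_le d P raP reP)+
qed

lemma trilin_norm_le:
  assumes inv: "refl_inv \<Phi>" "refl_inv \<Psi>"
    and module: "\<And>a b. dual_norm \<Phi> (cv a b) \<le> C * (dual_norm \<Phi> a * dual_norm \<Psi> b)"
    and algebra: "\<And>a b. dual_norm \<Psi> (cv a b) \<le> C * (dual_norm \<Psi> a * dual_norm \<Psi> b)"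
  shows "dual_norm \<Phi> (trilin d P) \<le> 3 * C\<^sup>2 * (dual_norm \<Psi> P)\<^sup>2 * dual_norm \<Phi> d"
proof -
  let ?d = "dual_norm \<Phi> d" and ?P = "dual_norm \<Psi> P"
  have 1: "dual_norm \<Phi> (cv (cv d P) (refl_seq P)) \<le> C * ((C * (?d * ?P)) * ?P)"
    by (rule order_trans[OF module]) (intro mult_mono module; simp add: dual_norm_refl inv)
  have 2: "dual_norm \<Phi> (cv (cv P d) (refl_seq P)) \<le> C * ((C * (?d * ?P)) * ?P)"
    using 1 by (simp add: cv_commute[of P d])
  have 3: "dual_norm \<Phi> (cv (cv P P) (refl_seq d)) \<le> C * (?d * (C * (?P * ?P)))"
    unfolding cv_commute[of "cv P P"]
    by (rule order_trans[OF module]) (intro mult_mono algebra; simp add: dual_norm_refl inv)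
  have "dual_norm \<Phi> (trilin d P) \<le> C * ((C * (?d * ?P)) * ?P) + C * ((C * (?d * ?P)) * ?P) + C * (?d * (C * (?P * ?P)))"
    unfolding trilin_def
    by (rule order_trans[OF dual_norm_add], intro add_mono 3, rule order_trans[OF dual_norm_add], intro add_mono 1 2)
  also have "\<dots> = 3 * C\<^sup>2 * ?P\<^sup>2 * ?d"
  proof -
    have "x + x + x = 3 * x" for x :: ennreal
      by (metis distrib_right mult_1 numeral_Bit1 numeral_One)
    then show ?thesis by (simp add: power2_eq_square mult_ac)
  qed
  finally show ?thesis .
qed

section \<open>Phases and resonances\<close>

text \<open>
  Interpolation between the bounds \<open>2\<close> and \<open>|x|\<close>.
\<close>

lemma cis_minus_one_le:
  assumes "0 < \<gamma>" "\<gamma> \<le> 1" "\<bar>x\<bar> \<le> 2 * y"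
  shows "cmod (cis x - 1) \<le> 2 * y powr \<gamma>"
proof -
  have "cmod (cis x - 1) = 2 * \<bar>sin (x / 2)\<bar>"
    using dist_exp_i_1[of x] by (simp add: cis_conv_exp)
  moreover have "\<bar>sin (x / 2)\<bar> \<le> y powr \<gamma>"
  proof (cases "y \<le> 1")
    case True
    have "\<bar>sin (x / 2)\<bar> \<le> \<bar>x / 2\<bar>" by (rule abs_sin_x_le_abs_x)
    also have "\<dots> \<le> y" using assms by simp
    also have "\<dots> \<le> y powr \<gamma>"
    proof (cases "y = 0")
      case False
      with assms have "0 < y" by simp
      with powr_mono'[of \<gamma> 1 y] True assms show ?thesis by simp
    qed simp
    finally show ?thesis .
  next
    case False
    have "\<bar>sin (x / 2)\<bar> \<le> 1" by simp
    also have "\<dots> \<le> y powr \<gamma>" using False assms by (intro ge_one_powr_ge_zero) auto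
    finally show ?thesis .
  qed
  ultimately show ?thesis by simp
qed

lemma cis_add_minus_one_le: "cmod (cis (x + y) - 1) \<le> cmod (cis x - 1) + cmod (cis y - 1)"
proof -
  have "cis (x + y) - 1 = cis y * (cis x - 1) + (cis y - 1)"
    by (simp add: cis_mult[symmetric] algebra_simps)
  also have "cmod \<dots> \<le> cmod (cis y * (cis x - 1)) + cmod (cis y - 1)" by (rule norm_triangle_ineq)
  finally show ?thesis by (simp add: norm_mult)
qed

lemma phi1_cis: "\<i> * of_real y * phi1 (\<i> * of_real y) = cis y - 1"
  by (simp add: phi1_def cis_conv_exp)

lemma norm_phi1_le: "cmod (phi1 (\<i> * of_real y)) \<le> 1"
proof (cases "y = 0")
  case False
  have "\<bar>y\<bar> * cmod (phi1 (\<i> * of_real y)) = cmod (cis y - 1)"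
    by (simp add: phi1_cis[symmetric] norm_mult)
  also have "\<dots> \<le> 2 * (\<bar>y\<bar> / 2) powr 1" by (rule cis_minus_one_le) auto
  finally show ?thesis using False by simp
qed (simp add: phi1_def)

abbreviation seg :: "real \<Rightarrow> real \<Rightarrow> real measure" where
  "seg a b \<equiv> restrict_space lborel {a..b}"

lemma emeasure_seg: "a \<le> b \<Longrightarrow> emeasure (seg a b) (space (seg a b)) = ennreal (b - a)"
  by (simp add: emeasure_restrict_space space_restrict_space)

lemma sigma_finite_seg: "sigma_finite_measure (seg a b)"
  by (rule sigma_finite_measure_restrict_space) (auto simp: sigma_finite_lborel)

lemma integral_seg_cis:
  assumes "0 \<le> \<tau>"
  shows "(\<integral>s. cis ((s - t) * y) \<partial>seg t (t + \<tau>)) = of_real \<tau> * phi1 (\<i> * of_real (\<tau> * y))"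
proof -
  have cont: "continuous_on {t..t+\<tau>} (\<lambda>s. cis ((s - t) * y))"
    by (intro continuous_intros)
  have "(\<integral>s. cis ((s - t) * y) \<partial>seg t (t + \<tau>)) = (LINT s:{t..t+\<tau>}|lborel. cis ((s - t) * y))"
    by (simp add: integral_restrict_space set_lebesgue_integral_def)
  also have "\<dots> = integral {t..t+\<tau>} (\<lambda>s. cis ((s - t) * y))"
    by (rule set_borel_integral_eq_integral) (use borel_integrable_atLeastAtMost'[OF cont] in auto)
  also have "\<dots> = of_real \<tau> * phi1 (\<i> * of_real (\<tau> * y))"
  proof (cases "y = 0")
    case True
    then show ?thesis using assms by (simp add: phi1_def scaleR_conv_of_real)
  next
    case False
    have "((\<lambda>s. cis ((s - t) * y)) has_integral
        cis ((t + \<tau> - t) * y) / (\<i> * of_real y) - cis ((t - t) * y) / (\<i> * of_real y)) {t..t+\<tau>}"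
    proof (rule fundamental_theorem_of_calculus)
      fix s assume "s \<in> {t..t+\<tau>}"
      have "((\<lambda>z. exp (\<i> * ((z - of_real t) * of_real y)) / (\<i> * of_real y)) has_field_derivative
          exp (\<i> * ((of_real s - of_real t) * of_real y))) (at (of_real s))"
        using False by (auto intro!: derivative_eq_intros) (simp add: mult_ac(1) mult.left_commute[of \<i>])
      from has_vector_derivative_real_field[OF this]
      have "((\<lambda>s. exp (\<i> * of_real ((s - t) * y)) / (\<i> * of_real y)) has_vector_derivative
          exp (\<i> * of_real ((s - t) * y))) (at s within {t..t+\<tau>})"
        by simp
      then show "((\<lambda>s. cis ((s - t) * y) / (\<i> * of_real y)) has_vector_derivative cis ((s - t) * y)) (at s within {t..t+\<tau>})"
        by (simp add: cis_conv_exp)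
    qed (use assms in auto)
    from integral_unique[OF this]
    have "integral {t..t+\<tau>} (\<lambda>s. cis ((s - t) * y)) = (cis (\<tau> * y) - 1) / (\<i> * of_real y)"
      by (simp add: diff_divide_distrib)
    also have "\<dots> = of_real \<tau> * phi1 (\<i> * of_real (\<tau> * y))"
      unfolding phi1_cis[symmetric] using False by simp
    finally show ?thesis .
  qed
  finally show ?thesis .
qed

lemma integral_seg_norm_le:
  fixes f :: "real \<Rightarrow> complex"
  assumes "a \<le> b" "\<And>s. s \<in> {a..b} \<Longrightarrow> ennreal (cmod (f s)) \<le> c"
  shows "ennreal (cmod (\<integral>s. f s \<partial>seg a b)) \<le> ennreal (b - a) * c"
proof (cases "integrable (seg a b) f")
  case True
  then have "ennreal (cmod (\<integral>s. f s \<partial>seg a b)) \<le> (\<integral>\<^sup>+s. cmod (f s) \<partial>seg a b)"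
    by (rule integral_norm_bound_ennreal)
  also have "\<dots> \<le> (\<integral>\<^sup>+s. c \<partial>seg a b)"
    using assms by (intro nn_integral_mono) (auto simp: space_restrict_space)
  also have "\<dots> = ennreal (b - a) * c" using emeasure_seg[OF assms(1)] by (simp add: mult.commute)
  finally show ?thesis .
qed (simp add: not_integrable_integral_eq)

text \<open>
  The function \<open>\<phi>\<^sub>1\<close> of the scheme is the average of the exact phases over one time step.
\<close>

lemma conv_phi1:
  assumes a: "tot (nm a) < \<infinity>" and b: "tot (nm b) < \<infinity>" and "0 \<le> \<tau>"
  shows "(\<integral>s. conv a (\<lambda>j. cis ((s - t) * y j) * b j) k \<partial>seg t (t + \<tau>))
    = of_real \<tau> * conv a (\<lambda>j. phi1 (\<i> * of_real (\<tau> * y j)) * b j) k"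
    and "integrable (seg t (t + \<tau>)) (\<lambda>s. conv a (\<lambda>j. cis ((s - t) * y j) * b j) k)"
proof -
  let ?f = "\<lambda>j s. a j * (cis ((s - t) * y (k - j)) * b (k - j))"
  have meas: "(\<lambda>s. ?f j s) \<in> borel_measurable (seg t (t + \<tau>))" for j
  proof (rule measurable_restrict_space1)
    have "continuous_on UNIV (\<lambda>s. ?f j s)" by (intro continuous_intros)
    then show "(\<lambda>s. ?f j s) \<in> borel_measurable lborel"
      using borel_measurable_continuous_onI by simp
  qed
  have "tot (\<lambda>j. \<integral>\<^sup>+s. cmod (?f j s) \<partial>seg t (t + \<tau>)) = tot (\<lambda>j. nm (\<lambda>j. a j * b (k - j)) j * ennreal \<tau>)"
    using emeasure_seg[of t "t + \<tau>"] \<open>0 \<le> \<tau>\<close> by (simp add: norm_mult)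
  also have "\<dots> < \<infinity>"
    using integrable_conv[OF a b, of k] by (simp add: integrable_csum tot_multc ennreal_mult_less_top)
  finally have fin: "tot (\<lambda>j. \<integral>\<^sup>+s. cmod (?f j s) \<partial>seg t (t + \<tau>)) < \<infinity>" .
  note sw = csum_swap[of "seg t (t + \<tau>)" ?f, OF sigma_finite_seg meas fin]
  show "integrable (seg t (t + \<tau>)) (\<lambda>s. conv a (\<lambda>j. cis ((s - t) * y j) * b j) k)"
    using sw(2) by (simp add: conv_def)
  have "(\<integral>s. conv a (\<lambda>j. cis ((s - t) * y j) * b j) k \<partial>seg t (t + \<tau>))
     = csum (\<lambda>j. \<integral>s. ?f j s \<partial>seg t (t + \<tau>))"
    using sw(1) by (simp add: conv_def)
  also have "\<dots> = csum (\<lambda>j. of_real \<tau> * (a j * (phi1 (\<i> * of_real (\<tau> * y (k - j))) * b (k - j))))"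
  proof (rule Bochner_Integration.integral_cong[OF refl])
    fix j
    have "(\<integral>s. ?f j s \<partial>seg t (t + \<tau>)) = (\<integral>s. a j * b (k - j) * cis ((s - t) * y (k - j)) \<partial>seg t (t + \<tau>))"
      by (simp add: mult_ac)
    also have "\<dots> = a j * b (k - j) * (of_real \<tau> * phi1 (\<i> * of_real (\<tau> * y (k - j))))"
      by (simp add: integral_seg_cis[OF \<open>0 \<le> \<tau>\<close>])
    finally show "(\<integral>s. ?f j s \<partial>seg t (t + \<tau>)) = of_real \<tau> * (a j * (phi1 (\<i> * of_real (\<tau> * y (k - j))) * b (k - j)))"
      by (simp add: mult_ac)
  qed
  finally show "(\<integral>s. conv a (\<lambda>j. cis ((s - t) * y j) * b j) k \<partial>seg t (t + \<tau>))
    = of_real \<tau> * conv a (\<lambda>j. phi1 (\<i> * of_real (\<tau> * y j)) * b j) k"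
    by (simp add: conv_def)
qed

text \<open>
  The symbol of \<open>- \<Delta>\<close>.
\<close>

definition sq_freq :: "int ^ 'd \<Rightarrow> real" where "sq_freq k = (norm (freq k))\<^sup>2"

definition frac_deriv :: "real \<Rightarrow> (int ^ 'd \<Rightarrow> ennreal) \<Rightarrow> int ^ 'd \<Rightarrow> ennreal" where
  "frac_deriv \<gamma> a k = ennreal (norm (freq k) powr \<gamma>) * a k"

lemma sq_freq_add: "sq_freq (i + j) = sq_freq i + sq_freq j + 2 * (freq i \<bullet> freq j)"
  by (simp add: sq_freq_def freq_add power2_norm_eq_inner inner_add_left inner_add_right inner_commute)

text \<open>
  The phase \<open>|i + j|\<^sup>2 - |i|\<^sup>2 - |j|\<^sup>2 = 2 i\<cdot>j\<close> that the scheme neglects.  The bound puts \<open>\<gamma>\<close> derivatives on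
  each of the two factors.
\<close>

lemma resonance_le:
  assumes "0 < \<gamma>" "\<gamma> \<le> 1" "0 \<le> \<zeta>"
  shows "cmod (cis (2 * \<zeta> * (freq i \<bullet> freq j)) - 1)
    \<le> 2 * \<zeta> powr \<gamma> * (norm (freq i) powr \<gamma> * norm (freq j) powr \<gamma>)"
proof -
  have "cmod (cis (2 * \<zeta> * (freq i \<bullet> freq j)) - 1) \<le> 2 * (\<zeta> * (norm (freq i) * norm (freq j))) powr \<gamma>"
    using assms Cauchy_Schwarz_ineq2[of "freq i" "freq j"]
    by (intro cis_minus_one_le) (auto simp: abs_mult intro!: mult_left_mono)
  then show ?thesis using assms by (simp add: powr_mult)
qed

lemma norm_sum3_le: "ennreal (cmod (x + y + z)) \<le> ennreal (cmod x) + ennreal (cmod y) + ennreal (cmod z)"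
  by (simp add: norm_triangle_ineq norm_add_rule_thm order_trans[OF norm_triangle_ineq] flip: ennreal_plus)

text \<open>
  Error of freezing the phase of \<open>V\<close>: the left side compares \<open>exp(-i\<zeta>\<Delta>) (V exp(i\<zeta>\<Delta>) v)\<close> with
  \<open>v exp(-i\<zeta>\<Delta>) V\<close>.
\<close>

lemma linear_resonance_le:
  fixes v V :: "int ^ 'd \<Rightarrow> complex"
  assumes \<gamma>: "0 < \<gamma>" "\<gamma> \<le> 1" "0 \<le> \<zeta>" and v: "tot (nm v) < \<infinity>" and V: "tot (nm V) < \<infinity>"
  shows "ennreal (cmod (cis (\<zeta> * sq_freq k) * conv (\<lambda>j. cis (- (\<zeta> * sq_freq j)) * v j) V k - conv v (\<lambda>j. cis (\<zeta> * sq_freq j) * V j) k))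
    \<le> ennreal (2 * \<zeta> powr \<gamma>) * cv (frac_deriv \<gamma> (nm v)) (frac_deriv \<gamma> (nm V)) k"
proof -
  let ?b = "\<lambda>j. cis (- (\<zeta> * sq_freq j)) * v j" and ?W = "\<lambda>j. cis (\<zeta> * sq_freq j) * V j"
  have b: "tot (nm ?b) < \<infinity>" and W: "tot (nm ?W) < \<infinity>"
    using v V by (simp_all add: norm_mult)
  have ph: "cis (\<zeta> * sq_freq k) * (?b j * V (k - j)) - v j * ?W (k - j)
      = v j * V (k - j) * cis (\<zeta> * sq_freq (k - j)) * (cis (2 * \<zeta> * (freq j \<bullet> freq (k - j))) - 1)" for j
  proof -
    have "sq_freq k = sq_freq j + sq_freq (k - j) + 2 * (freq j \<bullet> freq (k - j))"
      using sq_freq_add[of j "k - j"] by simp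
    then have "cis (\<zeta> * sq_freq k) * cis (- (\<zeta> * sq_freq j)) = cis (\<zeta> * sq_freq (k - j)) * cis (2 * \<zeta> * (freq j \<bullet> freq (k - j)))"
      by (simp add: cis_mult algebra_simps)
    then show ?thesis by (simp add: algebra_simps)
  qed
  have "cis (\<zeta> * sq_freq k) * conv ?b V k - conv v ?W k
      = csum (\<lambda>j. cis (\<zeta> * sq_freq k) * (?b j * V (k - j)) - v j * ?W (k - j))"
    unfolding conv_def using integrable_conv[OF b V, of k] integrable_conv[OF v W, of k]
    by (subst Bochner_Integration.integral_diff) auto
  also have "\<dots> = csum (\<lambda>j. v j * V (k - j) * cis (\<zeta> * sq_freq (k - j)) * (cis (2 * \<zeta> * (freq j \<bullet> freq (k - j))) - 1))"
    unfolding ph ..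
  also have "ennreal (cmod \<dots>) \<le> tot (\<lambda>j. ennreal (cmod (v j * V (k - j) * cis (\<zeta> * sq_freq (k - j)) * (cis (2 * \<zeta> * (freq j \<bullet> freq (k - j))) - 1))))"
    by (rule csum_norm_le)
  also have "\<dots> \<le> tot (\<lambda>j. ennreal (2 * \<zeta> powr \<gamma>) * (frac_deriv \<gamma> (nm v) j * frac_deriv \<gamma> (nm V) (k - j)))"
  proof (rule tot_mono)
    fix j
    have "cmod (v j * V (k - j) * cis (\<zeta> * sq_freq (k - j)) * (cis (2 * \<zeta> * (freq j \<bullet> freq (k - j))) - 1))
      \<le> cmod (v j) * cmod (V (k - j)) * (2 * \<zeta> powr \<gamma> * (norm (freq j) powr \<gamma> * norm (freq (k - j)) powr \<gamma>))"
      unfolding norm_mult norm_cis mult_1_right using \<gamma>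
      by (intro mult_left_mono resonance_le) auto
    then show "ennreal (cmod (v j * V (k - j) * cis (\<zeta> * sq_freq (k - j)) * (cis (2 * \<zeta> * (freq j \<bullet> freq (k - j))) - 1)))
      \<le> ennreal (2 * \<zeta> powr \<gamma>) * (frac_deriv \<gamma> (nm v) j * frac_deriv \<gamma> (nm V) (k - j))"
      using \<gamma> by (simp add: frac_deriv_def mult_ac flip: ennreal_mult)
  qed
  finally show ?thesis by (simp add: cv_def tot_cmult)
qed

text \<open>
  The analogue for the cubic term.  For \<open>k = i + j + l\<close>, where \<open>l\<close> is the frequency of the conjugate,
  whose phase has the opposite sign, the exact phase is
  \<open>|k|\<^sup>2 - |i|\<^sup>2 - |j|\<^sup>2 + |l|\<^sup>2 = 2|l|\<^sup>2 + 2 (i\<cdot>j + i\<cdot>l + j\<cdot>l)\<close>, and the scheme keeps \<open>2|l|\<^sup>2\<close>.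
\<close>

lemma cubic_resonance_le:
  fixes v :: "int ^ 'd \<Rightarrow> complex"
  assumes \<gamma>: "0 < \<gamma>" "\<gamma> \<le> 1" "0 \<le> \<zeta>" and v: "tot (nm v) < \<infinity>"
  defines "n \<equiv> nm v" and "D \<equiv> frac_deriv \<gamma> (nm v)"
  shows "ennreal (cmod (cis (\<zeta> * sq_freq k) * cubic (\<lambda>_. 1) (\<lambda>j. cis (- (\<zeta> * sq_freq j)) * v j) k - cubic (\<lambda>j. cis (\<zeta> * (2 * sq_freq j))) v k))
    \<le> ennreal (2 * \<zeta> powr \<gamma>) * (cv (cv D D) (refl_seq n) k + cv (cv D n) (refl_seq D) k + cv (cv n D) (refl_seq D) k)"
proof -
  let ?b = "\<lambda>j. cis (- (\<zeta> * sq_freq j)) * v j" and ?r = "\<lambda>j. cis (\<zeta> * (2 * sq_freq j)) * conj_seq v j"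
  have b: "tot (nm ?b) < \<infinity>" using v by (simp add: norm_mult)
  have rb: "tot (nm (conj_seq ?b)) < \<infinity>" using b unfolding tot_nm_conj_seq .
  have r: "tot (nm ?r) < \<infinity>" using v tot_nm_conj_seq[of v] by (simp add: norm_mult)
  have qf_m: "sq_freq (- k) = sq_freq k" for k :: "int ^ 'd" by (simp add: sq_freq_def freq_uminus)
  define E where "E i j l = cis (2 * \<zeta> * (freq i \<bullet> freq j) + (2 * \<zeta> * (freq i \<bullet> freq l) + 2 * \<zeta> * (freq j \<bullet> freq l))) - 1"
    for i j l :: "int ^ 'd"
  define F where "F m i = v i * v (m - i) * conj_seq v (k - m) * cis (\<zeta> * (2 * sq_freq (k - m))) * E i (m - i) (k - m)" for m i
  have ph: "cis (\<zeta> * sq_freq k) * (?b i * ?b (m - i) * conj_seq ?b (k - m)) - v i * v (m - i) * ?r (k - m)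
     = F m i" for i m
  proof -
    define j l where "j = m - i" and "l = k - m"
    have k: "k = i + j + l" by (simp add: j_def l_def)
    have q: "sq_freq k = sq_freq i + sq_freq j + sq_freq l + 2 * (freq i \<bullet> freq j) + 2 * (freq i \<bullet> freq l) + 2 * (freq j \<bullet> freq l)"
      unfolding k sq_freq_add freq_add by (simp add: inner_add_left)
    have "cis (\<zeta> * sq_freq k) * cis (- (\<zeta> * sq_freq i)) * cis (- (\<zeta> * sq_freq j)) * cis (\<zeta> * sq_freq l)
       = cis (\<zeta> * (2 * sq_freq l)) * (E i j l + 1)"
      unfolding E_def q by (simp add: cis_mult algebra_simps)
    moreover have "conj_seq ?b l = cis (\<zeta> * sq_freq l) * conj_seq v l"
      by (simp add: conj_seq_def cis_cnj qf_m)
    ultimately have "cis (\<zeta> * sq_freq k) * (?b i * ?b j * conj_seq ?b l) = v i * v j * conj_seq v l * (cis (\<zeta> * (2 * sq_freq l)) * (E i j l + 1))"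
      by (simp add: mult_ac)
    then show ?thesis unfolding F_def j_def[symmetric] l_def[symmetric] by (simp add: algebra_simps)
  qed
  have "cis (\<zeta> * sq_freq k) * cubic (\<lambda>_. 1) ?b k - cubic (\<lambda>j. cis (\<zeta> * (2 * sq_freq j))) v k
     = csum (\<lambda>m. cis (\<zeta> * sq_freq k) * (conv ?b ?b m * conj_seq ?b (k - m)) - conv v v m * ?r (k - m))"
    unfolding cubic_def conv_def[of "conv _ _"]
    using integrable_conv[OF tot_nm_conv_finite[OF b b] rb, of k] integrable_conv[OF tot_nm_conv_finite[OF v v] r, of k]
    by (subst Bochner_Integration.integral_diff) auto
  also have "\<dots> = csum (\<lambda>m. csum (\<lambda>i. F m i))"
  proof (rule Bochner_Integration.integral_cong[OF refl])
    fix m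
    have "cis (\<zeta> * sq_freq k) * (conv ?b ?b m * conj_seq ?b (k - m)) - conv v v m * ?r (k - m)
       = csum (\<lambda>i. cis (\<zeta> * sq_freq k) * (?b i * ?b (m - i) * conj_seq ?b (k - m)) - v i * v (m - i) * ?r (k - m))"
      unfolding conv_def using integrable_conv[OF b b, of m] integrable_conv[OF v v, of m]
      by (subst Bochner_Integration.integral_diff) auto
    then show "cis (\<zeta> * sq_freq k) * (conv ?b ?b m * conj_seq ?b (k - m)) - conv v v m * ?r (k - m)
      = csum (\<lambda>i. F m i)"
      unfolding ph .
  qed
  finally have eq: "cis (\<zeta> * sq_freq k) * cubic (\<lambda>_. 1) ?b k - cubic (\<lambda>j. cis (\<zeta> * (2 * sq_freq j))) v k
     = csum (\<lambda>m. csum (\<lambda>i. F m i))" .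
  have "ennreal (cmod (csum (\<lambda>m. csum (\<lambda>i. F m i))))
     \<le> tot (\<lambda>m. ennreal (cmod (csum (\<lambda>i. F m i))))"
    by (rule csum_norm_le)
  also have "\<dots> \<le> tot (\<lambda>m. tot (\<lambda>i. ennreal (cmod (F m i))))"
    by (rule tot_mono) (rule csum_norm_le)
  also have "\<dots> \<le> tot (\<lambda>m. tot (\<lambda>i. ennreal (2 * \<zeta> powr \<gamma>) *
      (D i * D (m - i) * n (m - k) + D i * n (m - i) * D (m - k) + n i * D (m - i) * D (m - k))))"
  proof (rule tot_mono, rule tot_mono)
    fix m i
    define j l where "j = m - i" and "l = k - m"
    define x y z where "x = norm (freq i) powr \<gamma>" and "y = norm (freq j) powr \<gamma>" and "z = norm (freq l) powr \<gamma>"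
    have xyz: "0 \<le> x" "0 \<le> y" "0 \<le> z" by (simp_all add: x_def y_def z_def)
    have lm: "m - k = - l" "norm (freq (- l)) = norm (freq l)"
      by (simp add: l_def) (simp only: freq_uminus norm_minus_cancel)
    have "cmod (E i j l) \<le> cmod (cis (2 * \<zeta> * (freq i \<bullet> freq j)) - 1)
       + (cmod (cis (2 * \<zeta> * (freq i \<bullet> freq l)) - 1) + cmod (cis (2 * \<zeta> * (freq j \<bullet> freq l)) - 1))"
      unfolding E_def by (intro order_trans[OF cis_add_minus_one_le] add_left_mono cis_add_minus_one_le)
    also have "\<dots> \<le> 2 * \<zeta> powr \<gamma> * (x * y) + (2 * \<zeta> powr \<gamma> * (x * z) + 2 * \<zeta> powr \<gamma> * (y * z))"
      unfolding x_def y_def z_def using \<gamma> by (intro add_mono resonance_le)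
    finally have E: "cmod (E i j l) \<le> 2 * \<zeta> powr \<gamma> * (x * y + x * z + y * z)"
      by (simp add: distrib_left)
    have "cmod (v i * v j * conj_seq v l * cis (\<zeta> * (2 * sq_freq l)) * E i j l)
      = cmod (v i) * cmod (v j) * cmod (conj_seq v l) * cmod (E i j l)"
      by (simp add: norm_mult)
    also have "\<dots> \<le> cmod (v i) * cmod (v j) * cmod (conj_seq v l) * (2 * \<zeta> powr \<gamma> * (x * y + x * z + y * z))"
      by (intro mult_left_mono E) auto
    also have "\<dots> = 2 * \<zeta> powr \<gamma> * ((x * cmod (v i)) * (y * cmod (v j)) * cmod (v (- l))
        + (x * cmod (v i)) * cmod (v j) * (z * cmod (v (- l))) + cmod (v i) * (y * cmod (v j)) * (z * cmod (v (- l))))"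
      by (simp add: conj_seq_def algebra_simps)
    finally have "ennreal (cmod (v i * v j * conj_seq v l * cis (\<zeta> * (2 * sq_freq l)) * E i j l)) \<le> ennreal \<dots>"
      by (rule ennreal_leI)
    also have "\<dots> = ennreal (2 * \<zeta> powr \<gamma>) *
      (D i * D j * n (- l) + D i * n j * D (- l) + n i * D j * D (- l))"
      using xyz unfolding D_def n_def frac_deriv_def lm
      by (simp add: ennreal_mult ennreal_plus x_def y_def z_def)
    finally show "ennreal (cmod (F m i))
      \<le> ennreal (2 * \<zeta> powr \<gamma>) *
      (D i * D (m - i) * n (m - k) + D i * n (m - i) * D (m - k) + n i * D (m - i) * D (m - k))"
      unfolding F_def j_def[symmetric] l_def[symmetric] lm(1) .
  qed
  also have "\<dots> = ennreal (2 * \<zeta> powr \<gamma>) * (cv (cv D D) (refl_seq n) k + cv (cv D n) (refl_seq D) k + cv (cv n D) (refl_seq D) k)"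
    by (simp add: cv_def tot_cmult tot_add tot_multc)
  finally show ?thesis unfolding eq .
qed

section \<open>The equation and the scheme for coefficients\<close>

definition gp_rhs :: "('k::{ab_group_add,countable} \<Rightarrow> complex) \<Rightarrow> ('k \<Rightarrow> complex) \<Rightarrow> 'k \<Rightarrow> complex" where
  "gp_rhs V v k = conv v V k + cubic (\<lambda>_. 1) v k"

definition gp_step :: "(int ^ 'd \<Rightarrow> complex) \<Rightarrow> real \<Rightarrow> (int ^ 'd \<Rightarrow> complex) \<Rightarrow> int ^ 'd \<Rightarrow> complex" where
  "gp_step V \<tau> v k = cis (- (\<tau> * sq_freq k)) * (v k - \<i> * of_real \<tau> *
     (conv v (\<lambda>j. phi1 (\<i> * of_real (\<tau> * sq_freq j)) * V j) k
      + cubic (\<lambda>j. phi1 (\<i> * of_real (\<tau> * (2 * sq_freq j)))) v k))"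

text \<open>
  Lipschitz bound for one step; all multipliers in the scheme have modulus at most one.
\<close>

lemma gp_step_diff_le:
  fixes V a b :: "int ^ 'd \<Rightarrow> complex"
  assumes \<tau>: "0 \<le> \<tau>" and V: "tot (nm V) < \<infinity>"
    and P: "tot P < \<infinity>" "\<And>k. nm a k \<le> P k" "\<And>k. nm b k \<le> P k"
  defines "d \<equiv> nm (\<lambda>k. a k - b k)"
  shows "ennreal (cmod (gp_step V \<tau> a k - gp_step V \<tau> b k)) \<le> d k + ennreal \<tau> * (cv d (nm V) k + trilin d P k)"
proof -
  let ?W = "\<lambda>j. phi1 (\<i> * of_real (\<tau> * sq_freq j)) * V j"
  let ?m = "\<lambda>j. phi1 (\<i> * of_real (\<tau> * (2 * sq_freq j)))"
  have a: "tot (nm a) < \<infinity>" and b: "tot (nm b) < \<infinity>"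
    using P by (auto intro: le_less_trans[OF tot_mono])
  have W: "tot (nm ?W) < \<infinity>" by (rule tot_multiplier[OF norm_phi1_le V])
  define X where "X = conv (\<lambda>k. a k - b k) ?W k"
  define Y where "Y = cubic ?m a k - cubic ?m b k"
  have X: "ennreal (cmod X) \<le> cv d (nm V) k"
    unfolding X_def d_def
    by (rule order_trans[OF nm_conv_le], intro cv_mono nm_multiplier_le[of "\<lambda>j. phi1 (\<i> * of_real (\<tau> * sq_freq j))", OF norm_phi1_le] order_refl)
  have Y: "ennreal (cmod Y) \<le> trilin d P k"
    unfolding Y_def by (rule nm_diff_cubic_le[OF norm_phi1_le P]) (simp add: d_def)
  have "X = conv a ?W k - conv b ?W k"
    unfolding X_def by (rule conv_diff_left[OF a b W])
  moreover have "gp_step V \<tau> a k = cis (- (\<tau> * sq_freq k)) * (a k - \<i> * of_real \<tau> * (conv a ?W k + cubic ?m a k))"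
    "gp_step V \<tau> b k = cis (- (\<tau> * sq_freq k)) * (b k - \<i> * of_real \<tau> * (conv b ?W k + cubic ?m b k))"
    by (simp_all add: gp_step_def)
  moreover have "c * (x - w * (A + p)) - c * (y - w * (B + q)) = c * ((x - y) + - w * (A - B) + - w * (p - q))"
    for c x y w A B p q :: complex
    by (simp add: algebra_simps)
  ultimately have "gp_step V \<tau> a k - gp_step V \<tau> b k = cis (- (\<tau> * sq_freq k)) * ((a k - b k) + - (\<i> * of_real \<tau>) * X + - (\<i> * of_real \<tau>) * Y)"
    by (simp only: Y_def)
  also have "ennreal (cmod \<dots>) = ennreal (cmod ((a k - b k) + - (\<i> * of_real \<tau>) * X + - (\<i> * of_real \<tau>) * Y))"
    by (simp add: norm_mult)
  also have "\<dots> \<le> ennreal (cmod (a k - b k)) + ennreal (cmod (- (\<i> * of_real \<tau>) * X)) + ennreal (cmod (- (\<i> * of_real \<tau>) * Y))"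
    by (rule norm_sum3_le)
  also have "\<dots> = d k + ennreal \<tau> * (ennreal (cmod X) + ennreal (cmod Y))"
    using \<tau> by (simp add: d_def norm_mult ennreal_mult distrib_left add.assoc)
  also have "\<dots> \<le> d k + ennreal \<tau> * (cv d (nm V) k + trilin d P k)"
    by (intro add_left_mono mult_left_mono add_mono X Y) auto
  finally show ?thesis .
qed

lemma norm_sum2_le: "ennreal (cmod (x + y)) \<le> ennreal (cmod x) + ennreal (cmod y)"
  by (simp add: norm_triangle_ineq flip: ennreal_plus)

lemma norm_gp_rhs_le:
  assumes inv: "refl_inv \<Psi>"
    and module: "\<And>a b. dual_norm \<Phi> (cv a b) \<le> C * (dual_norm \<Phi> a * dual_norm \<Psi> b)"
    and V: "dual_norm \<Psi> (nm V) \<le> M" and v: "dual_norm \<Psi> (nm v) \<le> M" "dual_norm \<Phi> (nm v) \<le> M"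
  shows "dual_norm \<Phi> (nm (gp_rhs V v)) \<le> C * (M * M) + C * (C * (M * M) * M)"
proof -
  let ?n = "nm v"
  have "nm (gp_rhs V v) k \<le> cv ?n (nm V) k + cv (cv ?n ?n) (refl_seq ?n) k" for k
    unfolding gp_rhs_def by (rule order_trans[OF norm_sum2_le]) (intro add_mono nm_conv_le nm_cubic_le, simp)
  then have "dual_norm \<Phi> (nm (gp_rhs V v)) \<le> dual_norm \<Phi> (\<lambda>k. cv ?n (nm V) k + cv (cv ?n ?n) (refl_seq ?n) k)"
    by (rule dual_norm_mono)
  also have "\<dots> \<le> dual_norm \<Phi> (cv ?n (nm V)) + dual_norm \<Phi> (cv (cv ?n ?n) (refl_seq ?n))"
    by (rule dual_norm_add)
  also have "\<dots> \<le> C * (dual_norm \<Phi> ?n * dual_norm \<Psi> (nm V)) + C * (C * (dual_norm \<Phi> ?n * dual_norm \<Psi> ?n) * dual_norm \<Psi> ?n)"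
    using module[of "cv ?n ?n" "refl_seq ?n"] unfolding dual_norm_refl[OF inv]
    by (intro add_mono module order_trans[OF module[of "cv ?n ?n"]] mult_left_mono mult_mono)
       (simp_all add: dual_norm_refl[OF inv, of ?n])
  also have "\<dots> \<le> C * (M * M) + C * (C * (M * M) * M)"
    using V v by (intro add_mono mult_left_mono mult_mono) auto
  finally show ?thesis .
qed

lemma borel_measurable_rhs:
  fixes U :: "real \<Rightarrow> 'k::{ab_group_add,countable} \<Rightarrow> complex"
  assumes U: "\<And>k. (\<lambda>s. U s k) \<in> borel_measurable borel"
  shows "(\<lambda>s. gp_rhs V (U s) k) \<in> borel_measurable borel"
proof -
  have cnj: "(\<lambda>x. cnj (f x)) \<in> borel_measurable borel" if "f \<in> borel_measurable borel"
    for f :: "real \<Rightarrow> complex"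
    by (rule measurable_compose[OF that]) (intro borel_measurable_continuous_onI continuous_intros)
  show ?thesis
  unfolding gp_rhs_def cubic_def conv_def conj_seq_def
  by (intro borel_measurable_add borel_measurable_csum borel_measurable_times U borel_measurable_const cnj)
qed

lemma integrable_twisted_rhs:
  fixes U :: "real \<Rightarrow> int ^ 'd \<Rightarrow> complex"
  assumes U: "\<And>k. (\<lambda>s. U s k) \<in> borel_measurable borel"
    and B: "B < \<infinity>" "tot (nm V) \<le> B" "\<And>s. tot (nm (U s)) \<le> B"
  shows "integrable (seg a b) (\<lambda>s. cis ((s - t) * sq_freq k) * gp_rhs V (U s) k)"
proof -
  interpret finite_measure "seg a b"
    by standard (simp add: emeasure_restrict_space space_restrict_space emeasure_lborel_Icc_eq)
  define K where "K = B * B + B * B * B"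
  have "K < \<infinity>" using B by (simp add: K_def ennreal_mult_less_top)
  then obtain R where R: "K = ennreal R" "0 \<le> R" by (cases K rule: ennreal_cases) auto
  have "tot (nm (gp_rhs V (U s))) \<le> K" for s
    using norm_gp_rhs_le[where \<Phi>=l1_dual and \<Psi>=l1_dual and C=1 and M=B and V=V and v="U s", OF refl_inv_l1] B
    by (simp add: dual_norm_l1 tot_cv K_def)
  then have "nm (gp_rhs V (U s)) k \<le> ennreal R" for s
    unfolding R(1) by (rule order_trans[OF le_tot])
  then have le: "cmod (gp_rhs V (U s) k) \<le> R" for s
    using R(2) by simp
  have "(\<lambda>s. cis ((s - t) * sq_freq k)) \<in> borel_measurable borel"
    by (intro borel_measurable_continuous_onI continuous_intros)
  then have "(\<lambda>s. cis ((s - t) * sq_freq k) * gp_rhs V (U s) k) \<in> borel_measurable borel"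
    by (intro borel_measurable_times borel_measurable_rhs U)
  then show ?thesis
    by (intro integrable_const_bound[where B=R]) (auto simp: norm_mult le intro!: measurable_restrict_space1)
qed

text \<open>
  Duhamel's formula for the coefficients, in the interaction picture: \<open>cis (t * sq_freq k) * U t k\<close> are
  the coefficients of \<open>exp(-it\<Delta>) u(t)\<close>.  The sequences are defined and measurable for all times;
  the formula holds on \<open>[0, T]\<close>.
\<close>

locale gp_duhamel =
  fixes V :: "int ^ 'd \<Rightarrow> complex" and U :: "real \<Rightarrow> int ^ 'd \<Rightarrow> complex" and T :: real
  assumes meas: "\<And>k. (\<lambda>s. U s k) \<in> borel_measurable borel"
    and duhamel: "\<And>t t' k. 0 \<le> t \<Longrightarrow> t \<le> t' \<Longrightarrow> t' \<le> T \<Longrightarrow>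
       cis (t' * sq_freq k) * U t' k - cis (t * sq_freq k) * U t k
        = - \<i> * (\<integral>s. cis (s * sq_freq k) * gp_rhs V (U s) k \<partial>seg t t')"

context gp_duhamel
begin

abbreviation (input) scheme_run :: "real \<Rightarrow> (nat \<Rightarrow> int ^ 'd \<Rightarrow> complex) \<Rightarrow> bool" where
  "scheme_run \<tau> w \<equiv> w 0 = U 0 \<and> (\<forall>n. w (Suc n) = gp_step V \<tau> (w n))"

abbreviation (input) err :: "real \<Rightarrow> (nat \<Rightarrow> int ^ 'd \<Rightarrow> complex) \<Rightarrow> nat \<Rightarrow> int ^ 'd \<Rightarrow> ennreal" where
  "err \<tau> w n \<equiv> nm (\<lambda>k. U (real n * \<tau>) k - w n k)"

end

text \<open>
  The error is measured in the norm of \<open>\<Phi>\<close> (the \<open>X\<close> of the introduction), and \<open>\<Psi>\<close> (\<open>Y\<close>) is the norm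
  of an algebra over which \<open>\<Phi>\<close> is a module.  The last three assumptions carry the additional regularity
  of the data and the solution.  They bound products of two derivatives and not the
  derivatives themselves, because for \<open>X = \<ell>\<^sup>2\<close> the latter need not be in \<open>\<Psi> = \<ell>\<^sup>1\<close>.
\<close>

locale gp_evolution = gp_duhamel V U T
  for V :: "int ^ 'd \<Rightarrow> complex" and U :: "real \<Rightarrow> int ^ 'd \<Rightarrow> complex" and T :: real +
  fixes \<Phi> \<Psi> :: "(int ^ 'd \<Rightarrow> ennreal) set" and C M :: ennreal and \<gamma> :: real
  assumes gamma: "0 < \<gamma>" "\<gamma> \<le> 1"
    and finite_consts: "C < \<infinity>" "M < \<infinity>"
    and inv: "refl_inv \<Phi>" "refl_inv \<Psi>"
    and tot_le: "\<And>a. tot a \<le> C * dual_norm \<Psi> a"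
    and module: "\<And>a b. dual_norm \<Phi> (cv a b) \<le> C * (dual_norm \<Phi> a * dual_norm \<Psi> b)"
    and algebra: "\<And>a b. dual_norm \<Psi> (cv a b) \<le> C * (dual_norm \<Psi> a * dual_norm \<Psi> b)"
    and V_le: "dual_norm \<Psi> (nm V) \<le> M"
    and U_le: "\<And>t. dual_norm \<Psi> (nm (U t)) \<le> M" "\<And>t. dual_norm \<Phi> (nm (U t)) \<le> M"
    and DU_DV_le: "\<And>t. dual_norm \<Phi> (cv (frac_deriv \<gamma> (nm (U t))) (frac_deriv \<gamma> (nm V))) \<le> M"
    and DU_DU_le: "\<And>t. dual_norm \<Phi> (cv (frac_deriv \<gamma> (nm (U t))) (frac_deriv \<gamma> (nm (U t)))) \<le> M"
    and DU_DU_refl_le: "\<And>t. dual_norm \<Phi> (cv (frac_deriv \<gamma> (nm (U t))) (refl_seq (frac_deriv \<gamma> (nm (U t))))) \<le> M"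
begin

abbreviation (input) NX :: "(int ^ 'd \<Rightarrow> ennreal) \<Rightarrow> ennreal" where "NX \<equiv> dual_norm \<Phi>"
abbreviation (input) NY :: "(int ^ 'd \<Rightarrow> ennreal) \<Rightarrow> ennreal" where "NY \<equiv> dual_norm \<Psi>"

text \<open>
  Bound for the nonlinearity \<open>V u + |u|\<^sup>2 u\<close> along the solution, in both norms.
\<close>

definition K1 :: ennreal where "K1 = C * (M * M) + C * (C * (M * M) * M)"

lemma K1_finite: "K1 < \<infinity>"
  using finite_consts by (simp add: K1_def ennreal_mult_less_top)

lemma tot_finite: "NY a \<le> c \<Longrightarrow> c < \<infinity> \<Longrightarrow> tot a < \<infinity>"
  using finite_consts by (intro le_less_trans[OF tot_le]) (simp add: ennreal_mult_less_top less_le_trans le_less_trans)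

lemma tot_V: "tot (nm V) < \<infinity>"
  by (rule tot_finite[OF V_le finite_consts(2)])

lemma tot_U: "tot (nm (U t)) < \<infinity>"
  by (rule tot_finite[OF U_le(1) finite_consts(2)])

lemma rhs_le: "NX (nm (gp_rhs V (U s))) \<le> K1" "NY (nm (gp_rhs V (U s))) \<le> K1"
  unfolding K1_def
  by (rule norm_gp_rhs_le[OF inv(2) module V_le U_le] norm_gp_rhs_le[OF inv(2) algebra V_le U_le(1) U_le(1)])+

lemma integrable_rhs: "integrable (seg a b) (\<lambda>s. cis ((s - t) * sq_freq k) * gp_rhs V (U s) k)"
proof (rule integrable_twisted_rhs[OF meas])
  show "C * M < \<infinity>" using finite_consts by (simp add: ennreal_mult_less_top)
  show "tot (nm V) \<le> C * M" "tot (nm (U s)) \<le> C * M" for s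
    by (rule order_trans[OF tot_le], intro mult_left_mono V_le U_le, simp)+
qed

text \<open>
  The solution differs from the free flow by the time integral of the nonlinearity.  The majorant on the
  right does not depend on \<open>s\<close>, so it can be used uniformly in one time step.
\<close>

lemma increment_le:
  assumes "0 \<le> t" "t \<le> s" "s \<le> t'" "t' \<le> T"
  shows "ennreal (cmod (U s k - cis (- ((s - t) * sq_freq k)) * U t k)) \<le> (\<integral>\<^sup>+x. nm (gp_rhs V (U x)) k \<partial>seg t t')"
proof -
  have "U s k - cis (- ((s - t) * sq_freq k)) * U t k
     = cis (- (s * sq_freq k)) * (cis (s * sq_freq k) * U s k - cis (t * sq_freq k) * U t k)"
    by (simp add: right_diff_distrib mult.assoc[symmetric] cis_mult left_diff_distrib)
  also have "\<dots> = cis (- (s * sq_freq k)) * (- \<i> * (\<integral>x. cis (x * sq_freq k) * gp_rhs V (U x) k \<partial>seg t s))"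
    using assms by (subst duhamel) auto
  also have "ennreal (cmod \<dots>) = ennreal (cmod (\<integral>x. cis (x * sq_freq k) * gp_rhs V (U x) k \<partial>seg t s))"
    by (simp add: norm_mult)
  also have "\<dots> \<le> (\<integral>\<^sup>+x. cmod (cis (x * sq_freq k) * gp_rhs V (U x) k) \<partial>seg t s)"
    using integrable_rhs[of t s 0 k] by (intro integral_norm_bound_ennreal) simp
  also have "\<dots> = (\<integral>\<^sup>+x. nm (gp_rhs V (U x)) k * indicator {t..s} x \<partial>lborel)"
    by (simp add: norm_mult nn_integral_restrict_space)
  also have "\<dots> \<le> (\<integral>\<^sup>+x. nm (gp_rhs V (U x)) k * indicator {t..t'} x \<partial>lborel)"
    using assms by (intro nn_integral_mono) (auto split: split_indicator)
  also have "\<dots> = (\<integral>\<^sup>+x. nm (gp_rhs V (U x)) k \<partial>seg t t')"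
    by (simp add: nn_integral_restrict_space)
  finally show ?thesis .
qed

text \<open>
  Constants for the two parts of the local error: replacing the solution by the free flow, and freezing
  the phases.
\<close>

definition K2 :: ennreal where "K2 = C * (K1 * M) + 3 * C\<^sup>2 * (M + K1)\<^sup>2 * K1"
definition K3 :: ennreal where "K3 = M + C * (M * M) + C * (M * M) + C * (M * M)"

lemma K23_finite: "K2 < \<infinity>" "K3 < \<infinity>"
  using finite_consts K1_finite by (simp_all add: K2_def K3_def ennreal_mult_less_top power_less_top_ennreal)

text \<open>
  The error of one step is the integral over \<open>[t, t + \<tau>]\<close> of the difference between the twisted exact
  nonlinearity and the integrand \<open>H\<close> of the scheme.  The coefficients of this difference are bounded
  uniformly in time by \<open>I1\<close> (solution against free flow) and \<open>I2\<close> (frozen phases); the first is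
  \<open>O(\<tau>)\<close> and the second carries the factor \<open>\<tau>\<^sup>\<gamma>\<close>, the larger one for \<open>\<tau> \<le> 1\<close>.
\<close>

lemma local_error:
  assumes t: "0 \<le> t" "0 < \<tau>" "\<tau> \<le> 1" "t + \<tau> \<le> T"
  shows "NX (nm (\<lambda>k. U (t + \<tau>) k - gp_step V \<tau> (U t) k)) \<le> ennreal (\<tau> * \<tau> powr \<gamma>) * (K2 + 2 * K3)"
proof -
  define v where "v = U t"
  define n where "n = nm v"
  define D where "D = frac_deriv \<gamma> n"
  define a where "a = (\<lambda>k. \<integral>\<^sup>+x. nm (gp_rhs V (U x)) k \<partial>seg t (t + \<tau>))"
  \<comment> \<open>dominates both the solution and the free flow during the whole step\<close>
  define P where "P = (\<lambda>k. n k + a k)"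
  define I1 where "I1 = (\<lambda>k. cv a (nm V) k + trilin a P k)"
  define I2 where "I2 = (\<lambda>k. cv D (frac_deriv \<gamma> (nm V)) k
     + (cv (cv D D) (refl_seq n) k + cv (cv D n) (refl_seq D) k + cv (cv n D) (refl_seq D) k))"
  define H where "H s k = conv v (\<lambda>j. cis ((s - t) * sq_freq j) * V j) k + cubic (\<lambda>j. cis ((s - t) * (2 * sq_freq j))) v k"
    for s k
  have v: "tot (nm v) < \<infinity>" unfolding v_def by (rule tot_U)
  have rhs_meas: "(\<lambda>x. nm (gp_rhs V (U x)) k) \<in> borel_measurable (seg t (t + \<tau>))" for k
    using borel_measurable_rhs[of U V k, OF meas] by (intro measurable_restrict_space1) simp
  have a_le: "dual_norm \<Theta> a \<le> K1 * ennreal \<tau>" if "\<And>s. dual_norm \<Theta> (nm (gp_rhs V (U s))) \<le> K1" for \<Theta>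
    unfolding a_def using t emeasure_seg[of t "t + \<tau>"]
      dual_norm_integral[of "seg t (t + \<tau>)" "\<lambda>k x. nm (gp_rhs V (U x)) k" \<Theta> K1, OF sigma_finite_seg rhs_meas that]
    by simp
  note a_le = a_le[OF rhs_le(1)] a_le[OF rhs_le(2)]
  have a_le': "NY a \<le> K1"
    using a_le(2) t mult_left_mono[of "ennreal \<tau>" 1 K1] by (simp add: order_trans)
  have P_le: "NY P \<le> M + K1"
    unfolding P_def by (rule order_trans[OF dual_norm_add]) (intro add_mono a_le', simp add: n_def v_def U_le)
  have tot_P: "tot P < \<infinity>"
    by (rule tot_finite[OF P_le]) (use finite_consts K1_finite in simp)
  have pointwise: "ennreal (cmod (cis ((s - t) * sq_freq k) * gp_rhs V (U s) k - H s k)) \<le> I1 k + ennreal (2 * \<tau> powr \<gamma>) * I2 k"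
    if s: "s \<in> {t..t+\<tau>}" for s k
  proof -
    define z where "z = s - t"
    have z: "0 \<le> z" "z \<le> \<tau>" using s by (auto simp: z_def)
    \<comment> \<open>the free flow\<close>
    define b where "b = (\<lambda>j. cis (- (z * sq_freq j)) * v j)"
    have b: "tot (nm b) < \<infinity>" using v by (simp add: b_def norm_mult)
    have diff: "ennreal (cmod (U s j - b j)) \<le> a j" for j
      using increment_le[of t s "t + \<tau>" j] s t by (simp add: a_def b_def z_def v_def)
    have bP: "nm b j \<le> P j" for j
      by (simp add: b_def norm_mult P_def n_def)
    have UP: "nm (U s) j \<le> P j" for j
    proof -
      have "nm (U s) j \<le> nm b j + ennreal (cmod (U s j - b j))"
        using norm_triangle_sub[of "U s j" "b j"] by (simp flip: ennreal_plus)
      also have "\<dots> \<le> n j + a j" by (intro add_mono diff) (simp add: b_def norm_mult n_def)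
      finally show ?thesis by (simp add: P_def)
    qed
    have 1: "ennreal (cmod (conv (U s) V k - conv b V k)) \<le> cv a (nm V) k"
      unfolding conv_diff_left[OF tot_U b tot_V, symmetric]
      by (rule order_trans[OF nm_conv_le]) (intro cv_mono diff order_refl)
    have 2: "ennreal (cmod (cubic (\<lambda>_. 1) (U s) k - cubic (\<lambda>_. 1) b k)) \<le> trilin a P k"
      by (rule nm_diff_cubic_le[OF _ tot_P UP bP diff]) simp
    define X1 where "X1 = (conv (U s) V k - conv b V k) + (cubic (\<lambda>_. 1) (U s) k - cubic (\<lambda>_. 1) b k)"
    define X2 where "X2 = cis (z * sq_freq k) * conv b V k - conv v (\<lambda>j. cis (z * sq_freq j) * V j) k"
    define X3 where "X3 = cis (z * sq_freq k) * cubic (\<lambda>_. 1) b k - cubic (\<lambda>j. cis (z * (2 * sq_freq j))) v k"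
    have X1: "ennreal (cmod (cis (z * sq_freq k) * X1)) \<le> I1 k"
    proof -
      have "ennreal (cmod (cis (z * sq_freq k) * X1)) \<le> ennreal (cmod (conv (U s) V k - conv b V k)) + ennreal (cmod (cubic (\<lambda>_. 1) (U s) k - cubic (\<lambda>_. 1) b k))"
        unfolding X1_def by (simp add: norm_mult norm_triangle_ineq flip: ennreal_plus)
      also have "\<dots> \<le> I1 k" unfolding I1_def by (intro add_mono 1 2)
      finally show ?thesis .
    qed
    have z\<gamma>: "ennreal (2 * z powr \<gamma>) \<le> ennreal (2 * \<tau> powr \<gamma>)"
      using z gamma by (intro ennreal_leI mult_left_mono powr_mono2) auto
    have X2: "ennreal (cmod X2) \<le> ennreal (2 * \<tau> powr \<gamma>) * cv D (frac_deriv \<gamma> (nm V)) k"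
      unfolding X2_def b_def D_def n_def
      by (rule order_trans[OF linear_resonance_le[OF gamma z(1) v tot_V]]) (intro mult_right_mono z\<gamma>, simp)
    have X3: "ennreal (cmod X3) \<le> ennreal (2 * \<tau> powr \<gamma>) *
       (cv (cv D D) (refl_seq n) k + cv (cv D n) (refl_seq D) k + cv (cv n D) (refl_seq D) k)"
      unfolding X3_def b_def D_def n_def
      by (rule order_trans[OF cubic_resonance_le[OF gamma z(1) v]]) (intro mult_right_mono z\<gamma>, simp)
    have "cis ((s - t) * sq_freq k) * gp_rhs V (U s) k - H s k = cis (z * sq_freq k) * X1 + X2 + X3"
      by (simp add: gp_rhs_def H_def X1_def X2_def X3_def z_def algebra_simps)
    then have "ennreal (cmod (cis ((s - t) * sq_freq k) * gp_rhs V (U s) k - H s k))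
       \<le> ennreal (cmod (cis (z * sq_freq k) * X1)) + ennreal (cmod X2) + ennreal (cmod X3)"
      by (simp only: norm_sum3_le)
    also have "\<dots> \<le> I1 k + ennreal (2 * \<tau> powr \<gamma>) * cv D (frac_deriv \<gamma> (nm V)) k + ennreal (2 * \<tau> powr \<gamma>) *
       (cv (cv D D) (refl_seq n) k + cv (cv D n) (refl_seq D) k + cv (cv n D) (refl_seq D) k)"
      by (intro add_mono X1 X2 X3)
    also have "\<dots> = I1 k + ennreal (2 * \<tau> powr \<gamma>) * I2 k"
      by (simp only: I2_def distrib_left add.assoc)
    finally show ?thesis .
  qed
  \<comment> \<open>integrate the pointwise bound; the integral of \<open>H\<close> is the update of the scheme\<close>
  have err: "nm (\<lambda>k. U (t + \<tau>) k - gp_step V \<tau> v k) k \<le> ennreal \<tau> * (I1 k + ennreal (2 * \<tau> powr \<gamma>) * I2 k)" for k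
  proof -
    let ?R = "\<lambda>s. cis ((s - t) * sq_freq k) * gp_rhs V (U s) k"
    have r: "tot (nm (conj_seq v)) < \<infinity>" using v unfolding tot_nm_conj_seq .
    note c1 = conv_phi1[where t=t and y=sq_freq and k=k and a=v and b=V, OF v tot_V less_imp_le[OF t(2)]]
    note c2 = conv_phi1[where t=t and y="\<lambda>j. 2 * sq_freq j" and k=k and b="conj_seq v", OF tot_nm_conv_finite[OF v v] r less_imp_le[OF t(2)]]
    have H_int: "integrable (seg t (t + \<tau>)) (\<lambda>s. H s k)"
      unfolding H_def cubic_def by (intro Bochner_Integration.integrable_add c1(2) c2(2))
    have H_eq: "(\<integral>s. H s k \<partial>seg t (t + \<tau>)) = of_real \<tau> *
       (conv v (\<lambda>j. phi1 (\<i> * of_real (\<tau> * sq_freq j)) * V j) k + cubic (\<lambda>j. phi1 (\<i> * of_real (\<tau> * (2 * sq_freq j)))) v k)"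
      unfolding H_def cubic_def
      by (subst Bochner_Integration.integral_add[OF c1(2) c2(2)]) (simp only: c1(1) c2(1) distrib_left)
    have "cis (\<tau> * sq_freq k) * U (t + \<tau>) k - v k
      = cis (- (t * sq_freq k)) * (cis ((t + \<tau>) * sq_freq k) * U (t + \<tau>) k - cis (t * sq_freq k) * U t k)"
      by (simp add: right_diff_distrib mult.assoc[symmetric] cis_mult distrib_right v_def)
    also have "\<dots> = cis (- (t * sq_freq k)) * (- \<i> * (\<integral>s. cis (s * sq_freq k) * gp_rhs V (U s) k \<partial>seg t (t + \<tau>)))"
      using t by (subst duhamel) auto
    also have "\<dots> = - \<i> * (cis (- (t * sq_freq k)) * (\<integral>s. cis (s * sq_freq k) * gp_rhs V (U s) k \<partial>seg t (t + \<tau>)))"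
      by simp
    also have "cis (- (t * sq_freq k)) * (\<integral>s. cis (s * sq_freq k) * gp_rhs V (U s) k \<partial>seg t (t + \<tau>)) = (\<integral>s. ?R s \<partial>seg t (t + \<tau>))"
      by (subst integral_mult_right_zero[symmetric])
         (simp add: mult.assoc[symmetric] cis_mult left_diff_distrib)
    finally have du: "cis (\<tau> * sq_freq k) * U (t + \<tau>) k - v k = - \<i> * (\<integral>s. ?R s \<partial>seg t (t + \<tau>))" .
    have "U (t + \<tau>) k - gp_step V \<tau> v k = cis (- (\<tau> * sq_freq k)) * ((cis (\<tau> * sq_freq k) * U (t + \<tau>) k - v k)
        + \<i> * (\<integral>s. H s k \<partial>seg t (t + \<tau>)))"
    proof -
      have "cis (- (\<tau> * sq_freq k)) * (cis (\<tau> * sq_freq k) * U (t + \<tau>) k) = U (t + \<tau>) k"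
        by (simp add: mult.assoc[symmetric] cis_mult)
      moreover have "x - e * (y - \<i> * c * X) = e * ((z - y) + \<i> * (c * X))" if "e * z = x" for e x y z c X :: complex
        unfolding that[symmetric] by (simp add: algebra_simps)
      ultimately show ?thesis unfolding gp_step_def H_eq by blast
    qed
    also have "\<dots> = cis (- (\<tau> * sq_freq k)) * (- \<i> * ((\<integral>s. ?R s \<partial>seg t (t + \<tau>)) - (\<integral>s. H s k \<partial>seg t (t + \<tau>))))"
      unfolding du by (simp only: right_diff_distrib mult_minus_left minus_diff_eq) (simp add: algebra_simps)
    finally have "U (t + \<tau>) k - gp_step V \<tau> v k = cis (- (\<tau> * sq_freq k)) * (- \<i> * (\<integral>s. ?R s - H s k \<partial>seg t (t + \<tau>)))"
      by (simp only: Bochner_Integration.integral_diff[OF integrable_rhs H_int])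
    then have "cmod (U (t + \<tau>) k - gp_step V \<tau> v k) = cmod (\<integral>s. ?R s - H s k \<partial>seg t (t + \<tau>))"
      by (simp only: norm_mult norm_cis norm_minus_cancel norm_ii mult_1)
    then have "nm (\<lambda>k. U (t + \<tau>) k - gp_step V \<tau> v k) k = ennreal (cmod (\<integral>s. ?R s - H s k \<partial>seg t (t + \<tau>)))"
      by (rule arg_cong)
    also have "\<dots> \<le> ennreal (t + \<tau> - t) * (I1 k + ennreal (2 * \<tau> powr \<gamma>) * I2 k)"
      using t by (intro integral_seg_norm_le pointwise) auto
    finally show ?thesis by simp
  qed
  have I1_le: "NX I1 \<le> ennreal \<tau> * K2"
  proof -
    have "NX I1 \<le> NX (cv a (nm V)) + NX (trilin a P)"
      unfolding I1_def by (rule dual_norm_add)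
    also have "\<dots> \<le> C * (NX a * NY (nm V)) + 3 * C\<^sup>2 * (NY P)\<^sup>2 * NX a"
      by (intro add_mono module trilin_norm_le inv algebra)
    also have "\<dots> \<le> C * ((K1 * ennreal \<tau>) * M) + 3 * C\<^sup>2 * (M + K1)\<^sup>2 * (K1 * ennreal \<tau>)"
      by (intro add_mono mult_mono power_mono a_le V_le P_le mult_left_mono) auto
    also have "\<dots> = ennreal \<tau> * K2" by (simp add: K2_def distrib_left mult_ac)
    finally show ?thesis .
  qed
  have D_le: "NX (cv D D) \<le> M" "NX (cv D (refl_seq D)) \<le> M" "NX (cv D (frac_deriv \<gamma> (nm V))) \<le> M"
    unfolding D_def n_def v_def by (rule DU_DU_le DU_DU_refl_le DU_DV_le)+
  have n_le: "NY n \<le> M" "NY (refl_seq n) \<le> M"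
    unfolding dual_norm_refl[OF inv(2)] by (simp_all add: n_def v_def U_le)
  have I2_le: "NX I2 \<le> K3"
  proof -
    \<comment> \<open>both derivatives are brought together, since only their product is controlled\<close>
    have e1: "cv (cv D n) (refl_seq D) = cv (cv D (refl_seq D)) n"
      by (simp add: cv_assoc) (simp add: cv_commute)
    have e2: "cv (cv n D) (refl_seq D) = cv (cv D (refl_seq D)) n"
      using e1 by (simp add: cv_commute[of n D])
    have "NX I2 \<le> NX (cv D (frac_deriv \<gamma> (nm V))) + (NX (cv (cv D D) (refl_seq n))
       + NX (cv (cv D (refl_seq D)) n) + NX (cv (cv D (refl_seq D)) n))"
      unfolding I2_def e1 e2
      by (intro order_trans[OF dual_norm_add] add_mono order_refl)
    also have "\<dots> \<le> M + (C * (M * M) + C * (M * M) + C * (M * M))"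
      by (intro add_mono D_le order_trans[OF module] mult_left_mono mult_mono n_le) auto
    finally show ?thesis by (simp add: K3_def add.assoc)
  qed
  have "NX (nm (\<lambda>k. U (t + \<tau>) k - gp_step V \<tau> v k)) \<le> NX (\<lambda>k. ennreal \<tau> * (I1 k + ennreal (2 * \<tau> powr \<gamma>) * I2 k))"
    by (rule dual_norm_mono) (rule err)
  also have "\<dots> \<le> ennreal \<tau> * (NX I1 + ennreal (2 * \<tau> powr \<gamma>) * NX I2)"
    by (intro order_trans[OF dual_norm_cmult] mult_left_mono order_trans[OF dual_norm_add] add_mono dual_norm_cmult) auto
  also have "\<dots> \<le> ennreal \<tau> * (ennreal \<tau> * K2 + ennreal (2 * \<tau> powr \<gamma>) * K3)"
    by (intro mult_left_mono add_mono I1_le I2_le) auto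
  also have "\<dots> \<le> ennreal \<tau> * (ennreal (\<tau> powr \<gamma>) * K2 + ennreal (2 * \<tau> powr \<gamma>) * K3)"
  proof (intro mult_left_mono add_mono mult_right_mono ennreal_leI)
    show "\<tau> \<le> \<tau> powr \<gamma>" using powr_mono'[of \<gamma> 1 \<tau>] t gamma by simp
  qed auto
  also have "\<dots> = ennreal (\<tau> * \<tau> powr \<gamma>) * (K2 + 2 * K3)"
    using t by (simp add: ennreal_mult distrib_left mult_ac)
  finally show ?thesis by (simp add: v_def)
qed

section \<open>Stability and global error\<close>

lemma gp_step_stable:
  assumes \<tau>: "0 \<le> \<tau>" and ab: "NY (nm a) \<le> R" "NY (nm b) \<le> R" and R: "R < \<infinity>"
  shows "NX (nm (\<lambda>k. gp_step V \<tau> a k - gp_step V \<tau> b k))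
    \<le> (1 + ennreal \<tau> * (C * M + 3 * C\<^sup>2 * (R + R)\<^sup>2)) * NX (nm (\<lambda>k. a k - b k))"
proof -
  define d where "d = nm (\<lambda>k. a k - b k)"
  define P where "P = (\<lambda>k. nm a k + nm b k)"
  have P_le: "NY P \<le> R + R"
    unfolding P_def by (rule order_trans[OF dual_norm_add]) (intro add_mono ab)
  have tot_P: "tot P < \<infinity>" by (rule tot_finite[OF P_le]) (use R in simp)
  have pw: "nm (\<lambda>k. gp_step V \<tau> a k - gp_step V \<tau> b k) k \<le> d k + ennreal \<tau> * (cv d (nm V) k + trilin d P k)" for k
    unfolding d_def by (rule gp_step_diff_le[OF \<tau> tot_V tot_P]) (simp_all add: P_def)
  have "NX (nm (\<lambda>k. gp_step V \<tau> a k - gp_step V \<tau> b k)) \<le> NX (\<lambda>k. d k + ennreal \<tau> * (cv d (nm V) k + trilin d P k))"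
    by (rule dual_norm_mono) (rule pw)
  also have "\<dots> \<le> NX d + ennreal \<tau> * (NX (cv d (nm V)) + NX (trilin d P))"
    by (intro order_trans[OF dual_norm_add] add_mono order_refl order_trans[OF dual_norm_cmult] mult_left_mono dual_norm_add) auto
  also have "\<dots> \<le> NX d + ennreal \<tau> * (C * (NX d * NY (nm V)) + 3 * C\<^sup>2 * (NY P)\<^sup>2 * NX d)"
    by (intro add_mono order_refl mult_left_mono module trilin_norm_le inv algebra) auto
  also have "\<dots> \<le> NX d + ennreal \<tau> * (C * (NX d * M) + 3 * C\<^sup>2 * (R + R)\<^sup>2 * NX d)"
    by (intro add_mono order_refl mult_left_mono mult_mono power_mono V_le P_le) auto
  also have "\<dots> = (1 + ennreal \<tau> * (C * M + 3 * C\<^sup>2 * (R + R)\<^sup>2)) * NX d"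
    by (simp add: distrib_left distrib_right mult_ac)
  finally show ?thesis by (simp add: d_def)
qed

text \<open>
  Discrete Gronwall.  The bound for \<open>w n\<close> in \<open>\<Psi>\<close> may be deduced from the error bound for the same \<open>n\<close>,
  which allows bootstrapping; the induction runs with the bound \<open>B n\<close>, which grows with \<open>n\<close> and stays
  below \<open>G \<tau>\<^sup>\<gamma>\<close> up to time \<open>T\<close>.
\<close>

lemma conditional_convergence:
  assumes R: "R < \<infinity>" "M \<le> R" and T: "0 \<le> T"
  shows "\<exists>G\<ge>0. \<forall>\<tau> w. 0 < \<tau> \<and> \<tau> \<le> 1 \<and> scheme_run \<tau> w \<and>
     (\<forall>n. real n * \<tau> \<le> T \<longrightarrow> NX (err \<tau> w n) \<le> ennreal (G * \<tau> powr \<gamma>)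
         \<longrightarrow> NY (nm (w n)) \<le> R)
     \<longrightarrow> (\<forall>n. real n * \<tau> \<le> T \<longrightarrow> NX (err \<tau> w n) \<le> ennreal (G * \<tau> powr \<gamma>))"
proof -
  have "K2 + 2 * K3 < \<infinity>" using K23_finite by (simp add: ennreal_mult_less_top)
  then obtain D where D: "K2 + 2 * K3 = ennreal D" "0 \<le> D"
    by (cases "K2 + 2 * K3" rule: ennreal_cases) auto
  have "C * M + 3 * C\<^sup>2 * (R + R)\<^sup>2 < \<infinity>"
    using finite_consts R by (simp add: ennreal_mult_less_top power_less_top_ennreal)
  then obtain L where L: "C * M + 3 * C\<^sup>2 * (R + R)\<^sup>2 = ennreal L" "0 \<le> L"
    by (cases "C * M + 3 * C\<^sup>2 * (R + R)\<^sup>2" rule: ennreal_cases) auto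
  define G where "G = T * D * exp (L * T)"
  have "0 \<le> G" using D T by (simp add: G_def)
  moreover have "NX (err \<tau> w n) \<le> ennreal (G * \<tau> powr \<gamma>)"
    if \<tau>: "0 < \<tau>" "\<tau> \<le> 1" and w: "w 0 = U 0" "\<And>n. w (Suc n) = gp_step V \<tau> (w n)"
      and bd: "\<And>n. real n * \<tau> \<le> T \<Longrightarrow> NX (err \<tau> w n) \<le> ennreal (G * \<tau> powr \<gamma>)
         \<Longrightarrow> NY (nm (w n)) \<le> R" and n: "real n * \<tau> \<le> T" for \<tau> w n
  proof -
    define e where "e n = NX (err \<tau> w n)" for n
    define B where "B n = (real n * \<tau>) * (\<tau> powr \<gamma> * D) * exp (L * (real n * \<tau>))" for n
    have B_le: "B n \<le> G * \<tau> powr \<gamma>" if "real n * \<tau> \<le> T" for n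
    proof -
      have "B n \<le> T * (\<tau> powr \<gamma> * D) * exp (L * T)"
        unfolding B_def using that \<tau> D L T by (intro mult_mono mult_nonneg_nonneg) (auto intro: mult_left_mono)
      then show ?thesis by (simp add: G_def mult_ac)
    qed
    have "e n \<le> ennreal (B n)" using n
    proof (induction n)
      case 0
      have "e 0 \<le> 0" unfolding e_def by (rule dual_normI) (simp add: w)
      then show ?case by simp
    next
      case (Suc n)
      have nT: "real n * \<tau> \<le> T" "real n * \<tau> + \<tau> \<le> T" using Suc.prems \<tau> by (simp_all add: distrib_right)
      have e_n: "e n \<le> ennreal (B n)" by (rule Suc.IH[OF nT(1)])
      then have "e n \<le> ennreal (G * \<tau> powr \<gamma>)"
        using B_le[OF nT(1)] by (meson ennreal_leI order_trans)
      then have wR: "NY (nm (w n)) \<le> R" using bd nT by (simp add: e_def)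
      let ?t = "real n * \<tau>"
      have split: "nm (\<lambda>k. U (?t + \<tau>) k - gp_step V \<tau> (w n) k) k
          \<le> nm (\<lambda>k. U (?t + \<tau>) k - gp_step V \<tau> (U ?t) k) k + nm (\<lambda>k. gp_step V \<tau> (U ?t) k - gp_step V \<tau> (w n) k) k" for k
        using norm_sum2_le[of "U (?t + \<tau>) k - gp_step V \<tau> (U ?t) k" "gp_step V \<tau> (U ?t) k - gp_step V \<tau> (w n) k"] by simp
      have "e (Suc n) = NX (nm (\<lambda>k. U (?t + \<tau>) k - gp_step V \<tau> (w n) k))"
        by (simp add: e_def w distrib_right add.commute)
      also have "\<dots> \<le> NX (nm (\<lambda>k. U (?t + \<tau>) k - gp_step V \<tau> (U ?t) k))
         + NX (nm (\<lambda>k. gp_step V \<tau> (U ?t) k - gp_step V \<tau> (w n) k))"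
        by (rule order_trans[OF dual_norm_mono dual_norm_add]) (rule split)
      also have "\<dots> \<le> ennreal (\<tau> * \<tau> powr \<gamma>) * ennreal D + (1 + ennreal \<tau> * ennreal L) * e n"
        unfolding D(1)[symmetric] L(1)[symmetric] e_def
        using \<tau> nT R wR by (intro add_mono local_error gp_step_stable order_trans[OF U_le(1)]) auto
      also have "\<dots> \<le> ennreal (\<tau> * \<tau> powr \<gamma>) * ennreal D + (1 + ennreal \<tau> * ennreal L) * ennreal (B n)"
        by (intro add_left_mono mult_left_mono e_n) auto
      also have "\<dots> = ennreal (\<tau> * \<tau> powr \<gamma> * D + (1 + \<tau> * L) * B n)"
      proof -
        have "0 \<le> B n" using \<tau> D by (simp add: B_def)
        then show ?thesis using \<tau> D L
          by (simp add: ennreal_mult ennreal_plus distrib_right mult_ac)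
      qed
      also have "\<tau> * \<tau> powr \<gamma> * D + (1 + \<tau> * L) * B n \<le> B (Suc n)"
      proof -
        let ?D = "\<tau> powr \<gamma> * D" and ?E = "exp (L * (real (Suc n) * \<tau>))"
        have 1: "1 \<le> ?E" using L \<tau> by simp
        have "(1 + \<tau> * L) * exp (L * ?t) \<le> exp (\<tau> * L) * exp (L * ?t)"
          using exp_ge_add_one_self[of "\<tau> * L"] by (intro mult_right_mono) auto
        also have "\<dots> = ?E" by (simp add: exp_add[symmetric] algebra_simps)
        finally have 2: "(1 + \<tau> * L) * exp (L * ?t) \<le> ?E" .
        have "\<tau> * \<tau> powr \<gamma> * D + (1 + \<tau> * L) * B n = \<tau> * ?D * 1 + ?t * ?D * ((1 + \<tau> * L) * exp (L * ?t))"
          by (simp add: B_def mult_ac)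
        also have "\<dots> \<le> \<tau> * ?D * ?E + ?t * ?D * ?E"
          using 1 2 \<tau> D by (intro add_mono mult_left_mono) auto
        also have "\<dots> = B (Suc n)" by (simp add: B_def distrib_right)
        finally show ?thesis .
      qed
      finally show ?case by (simp add: ennreal_leI)
    qed
    also have "ennreal (B n) \<le> ennreal (G * \<tau> powr \<gamma>)"
      by (rule ennreal_leI[OF B_le[OF n]])
    finally show ?thesis by (simp add: e_def)
  qed
  ultimately show ?thesis by (intro exI[of _ G]) blast
qed

lemma convergence_of_bounded:
  assumes R: "R < \<infinity>" and T: "0 \<le> T"
  shows "\<exists>G\<ge>0. \<forall>\<tau> w. 0 < \<tau> \<and> \<tau> \<le> 1 \<and> scheme_run \<tau> w \<and>
     (\<forall>n. real n * \<tau> \<le> T \<longrightarrow> NY (nm (w n)) \<le> R)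
     \<longrightarrow> (\<forall>n. real n * \<tau> \<le> T \<longrightarrow> NX (err \<tau> w n) \<le> ennreal (G * \<tau> powr \<gamma>))"
proof -
  have "max R M < \<infinity>" using R finite_consts by simp
  from conditional_convergence[OF this _ T] show ?thesis
    by (simp add: le_max_iff_disj) meson
qed

text \<open>
  If the error is measured in the algebra norm itself, then for \<open>G \<tau>\<^sup>\<gamma> \<le> 1\<close> the error bound for \<open>w n\<close>
  implies \<open>\<parallel>w n\<parallel> \<le> M + 1\<close>, so the hypothesis of \<open>conditional_convergence\<close> is automatic.
\<close>

lemma convergence_of_algebra:
  assumes eq: "\<Phi> = \<Psi>" and T: "0 \<le> T"
  shows "\<exists>G\<ge>0. \<exists>\<tau>0>0. \<tau>0 \<le> 1 \<and> (\<forall>\<tau> w n. 0 < \<tau> \<and> \<tau> \<le> \<tau>0 \<and> scheme_run \<tau> w \<and> real n * \<tau> \<le> T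
     \<longrightarrow> NY (err \<tau> w n) \<le> ennreal (G * \<tau> powr \<gamma>) \<and> NY (nm (w n)) \<le> M + 1)"
proof -
  have "M + 1 < \<infinity>" "M \<le> M + 1" using finite_consts by simp_all
  from conditional_convergence[OF this T] obtain G where G: "0 \<le> G" and conv: "\<forall>\<tau> w. 0 < \<tau> \<and> \<tau> \<le> 1 \<and> scheme_run \<tau> w \<and>
     (\<forall>n. real n * \<tau> \<le> T \<longrightarrow> NX (err \<tau> w n) \<le> ennreal (G * \<tau> powr \<gamma>)
         \<longrightarrow> NY (nm (w n)) \<le> M + 1)
     \<longrightarrow> (\<forall>n. real n * \<tau> \<le> T \<longrightarrow> NX (err \<tau> w n) \<le> ennreal (G * \<tau> powr \<gamma>))"
    by (elim exE conjE)
  \<comment> \<open>small enough for \<open>G \<tau>\<^sup>\<gamma> \<le> 1\<close>, also when \<open>G = 0\<close>\<close>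
  define \<tau>0 where "\<tau>0 = (1 / (G + 1)) powr (1 / \<gamma>)"
  have \<tau>0: "0 < \<tau>0" "\<tau>0 \<le> 1"
    using G gamma by (auto simp: \<tau>0_def intro!: powr_le1)
  have small: "G * \<tau> powr \<gamma> \<le> 1" if "0 < \<tau>" "\<tau> \<le> \<tau>0" for \<tau>
  proof -
    have "\<tau> powr \<gamma> \<le> \<tau>0 powr \<gamma>" using that gamma by (intro powr_mono2) auto
    also have "\<dots> = 1 / (G + 1)" using G gamma by (simp add: \<tau>0_def powr_powr)
    finally have "G * \<tau> powr \<gamma> \<le> G * (1 / (G + 1))" using G by (intro mult_left_mono)
    also have "\<dots> \<le> 1" using G by (simp add: field_simps)
    finally show ?thesis .
  qed
  have bd: "NY (nm (w n)) \<le> M + 1"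
    if "0 < \<tau>" "\<tau> \<le> \<tau>0" "NY (err \<tau> w n) \<le> ennreal (G * \<tau> powr \<gamma>)" for \<tau> w n
  proof -
    have pw: "nm (w n) k \<le> nm (U (real n * \<tau>)) k + nm (\<lambda>k. U (real n * \<tau>) k - w n k) k" for k
      using norm_triangle_sub[of "w n k" "U (real n * \<tau>) k"] by (simp add: norm_minus_commute flip: ennreal_plus)
    have "NY (nm (w n)) \<le> NY (nm (U (real n * \<tau>))) + NY (err \<tau> w n)"
      by (rule order_trans[OF dual_norm_mono dual_norm_add]) (rule pw)
    also have "\<dots> \<le> M + ennreal 1"
      using that small[OF that(1,2)] by (intro add_mono U_le order_trans[OF that(3)] ennreal_leI)
    finally show ?thesis by simp
  qed
  have est: "NY (err \<tau> w n) \<le> ennreal (G * \<tau> powr \<gamma>)"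
    if "0 < \<tau>" "\<tau> \<le> \<tau>0" "w 0 = U 0" "\<And>n. w (Suc n) = gp_step V \<tau> (w n)" "real n * \<tau> \<le> T" for \<tau> w n
    unfolding eq[symmetric]
  proof (rule conv[rule_format, of \<tau> w n])
    show "0 < \<tau> \<and> \<tau> \<le> 1 \<and> scheme_run \<tau> w \<and>
     (\<forall>n. real n * \<tau> \<le> T \<longrightarrow> NX (err \<tau> w n) \<le> ennreal (G * \<tau> powr \<gamma>)
         \<longrightarrow> NY (nm (w n)) \<le> M + 1)"
      using that \<tau>0 bd[of \<tau> _ w] unfolding eq by (intro conjI allI impI) auto
  qed (rule that)
  show ?thesis
  proof (rule exI[of _ G], rule conjI[OF G], rule exI[of _ \<tau>0], intro conjI \<tau>0 allI impI)
    fix \<tau> w n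
    assume *: "0 < \<tau> \<and> \<tau> \<le> \<tau>0 \<and> scheme_run \<tau> w \<and> real n * \<tau> \<le> T"
    then show 1: "NY (err \<tau> w n) \<le> ennreal (G * \<tau> powr \<gamma>)"
      using est[of \<tau> w n] by simp
    show "NY (nm (w n)) \<le> M + 1"
      by (rule bd[where \<tau>=\<tau> and w=w and n=n]) (use * 1 in auto)
  qed
qed

end

section \<open>The norms in which the scheme converges\<close>

lemma l2_dual_norm_le:
  assumes "\<And>k. w k * a k \<le> c * (w' k * a' k)"
  shows "dual_norm (l2_dual w) a \<le> c * dual_norm (l2_dual w') a'"
  unfolding l2_weight[of w] l2_weight[of w']
  by (rule order_trans[OF dual_norm_mono dual_norm_cmult]) (rule assms)

lemma wt_mono:
  assumes "0 < s" "s \<le> s'" shows "wt s k \<le> sqrt 2 * wt s' k"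
proof (rule power2_le_imp_le)
  let ?x = "norm (freq k)"
  have "?x powr (2 * s) \<le> 1 + ?x powr (2 * s')"
  proof (cases "?x \<le> 1")
    case True
    then have "?x powr (2 * s) \<le> 1" using assms by (intro powr_le1) auto
    then show ?thesis by (smt (verit) powr_ge_zero)
  next
    case False
    then have "?x powr (2 * s) \<le> ?x powr (2 * s')" using assms by (intro powr_mono) auto
    then show ?thesis by simp
  qed
  moreover have "0 \<le> ?x powr (2 * s')" by simp
  moreover have "1 + a \<le> 2 * (1 + b)" if "a \<le> 1 + b" "0 \<le> b" for a b :: real using that by simp
  ultimately have "1 + ?x powr (2 * s) \<le> 2 * (1 + ?x powr (2 * s'))" by blast
  then show "(wt s k)\<^sup>2 \<le> (sqrt 2 * wt s' k)\<^sup>2"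
    by (simp add: wt_sq power_mult_distrib)
qed simp

lemma wt_norm_mono:
  assumes "0 < s" "s \<le> s'"
  shows "dual_norm (l2_dual (\<lambda>k. ennreal (wt s k))) a \<le> ennreal (sqrt 2) * dual_norm (l2_dual (\<lambda>k. ennreal (wt s' k))) a"
  by (rule l2_dual_norm_le)
     (use wt_mono[OF assms] in \<open>auto simp: mult.assoc[symmetric] intro!: mult_right_mono simp flip: ennreal_mult\<close>)

lemma wt_frac_deriv_le:
  assumes "0 < s"
  shows "ennreal (wt s k) * frac_deriv 1 a k \<le> ennreal (sqrt 2) * (ennreal (wt (s + 1) k) * a k)"
proof -
  have "ennreal (wt s k) * frac_deriv 1 a k = ennreal (wt s k * norm (freq k)) * a k"
    by (simp add: frac_deriv_def mult.assoc[symmetric] ennreal_mult)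
  also have "\<dots> \<le> ennreal (sqrt 2 * wt (s + 1) k) * a k"
    by (intro mult_right_mono ennreal_leI wt_mult_freq_le assms) auto
  finally show ?thesis by (simp add: ennreal_mult mult.assoc)
qed

abbreviation hs_dual :: "real \<Rightarrow> (int ^ 'd \<Rightarrow> ennreal) set" where
  "hs_dual s \<equiv> l2_dual (\<lambda>k. ennreal (wt s k))"

lemma tot_le_hs_norm:
  assumes "real CARD('d) / 2 < s"
  shows "\<exists>c>0. \<forall>a::int ^ 'd \<Rightarrow> ennreal. tot a \<le> ennreal c * dual_norm (hs_dual s) a"
proof -
  have "(1 + norm (freq k)) powr 0 = 1" for k :: "int ^ 'd"
    using add_pos_nonneg[OF zero_less_one norm_ge_zero[of "freq k"]] by simp
  then show ?thesis using weighted_tot_le[of 0 s, where 'd='d] assms by simp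
qed

context gp_duhamel
begin

text \<open>
  For \<open>s > d/2\<close> take \<open>\<Phi> = \<Psi> = H\<^sup>s\<close> and \<open>\<gamma> = 1\<close>: first derivatives of the data are in the algebra \<open>H\<^sup>s\<close>.
\<close>

lemma sobolev_convergence:
  assumes s: "real CARD('d) / 2 < s" and T: "0 \<le> T" and B: "B < \<infinity>"
    and V: "dual_norm (hs_dual (s + 1)) (nm V) \<le> B"
    and U: "\<And>t. dual_norm (hs_dual (s + 1)) (nm (U t)) \<le> B"
  shows "\<exists>G\<ge>0. \<exists>\<tau>0>0. \<forall>\<tau> w n. 0 < \<tau> \<and> \<tau> \<le> \<tau>0 \<and> scheme_run \<tau> w \<and> real n * \<tau> \<le> T
     \<longrightarrow> dual_norm (hs_dual s) (err \<tau> w n) \<le> ennreal (G * \<tau>)"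
proof -
  have s0: "0 < s" using s by (smt (verit) of_nat_0_le_iff divide_nonneg_pos)
  obtain c where c: "c > 0" "\<And>a::int ^ 'd \<Rightarrow> ennreal. tot a \<le> ennreal c * dual_norm (hs_dual s) a"
    using tot_le_hs_norm[OF s] by blast
  define C where "C = ennreal (c + 2 powr s * (2 * c))"
  define M where "M = ennreal (sqrt 2) * B + C * ((ennreal (sqrt 2) * B) * (ennreal (sqrt 2) * B))"
  have C: "ennreal c \<le> C" "C < \<infinity>" unfolding C_def using c by (auto intro!: ennreal_leI)
  have low: "dual_norm (hs_dual s) a \<le> M" if "dual_norm (hs_dual (s + 1)) a \<le> B" for a :: "int ^ 'd \<Rightarrow> ennreal"
  proof -
    have "dual_norm (hs_dual s) a \<le> ennreal (sqrt 2) * dual_norm (hs_dual (s + 1)) a"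
      using s0 by (intro wt_norm_mono) auto
    also have "\<dots> \<le> ennreal (sqrt 2) * B" using that by (intro mult_left_mono) auto
    also have "\<dots> \<le> M" by (simp add: M_def)
    finally show ?thesis .
  qed
  have D: "dual_norm (hs_dual s) (frac_deriv 1 a) \<le> ennreal (sqrt 2) * B" if "dual_norm (hs_dual (s + 1)) a \<le> B" for a :: "int ^ 'd \<Rightarrow> ennreal"
    by (rule order_trans[OF l2_dual_norm_le[OF wt_frac_deriv_le[OF s0]]]) (use that in \<open>intro mult_left_mono, auto\<close>)
  have alg: "dual_norm (hs_dual s) (cv a b) \<le> C * (dual_norm (hs_dual s) a * dual_norm (hs_dual s) b)" for a b :: "int ^ 'd \<Rightarrow> ennreal"
  proof -
    let ?a = "dual_norm (hs_dual s) a" and ?b = "dual_norm (hs_dual s) b"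
    have "dual_norm (hs_dual s) (cv a b) \<le> ennreal (2 powr s) * (?a * tot b + tot a * ?b)"
      by (rule l2_weight_cv)
         (use wt_add_le[of s] s0 in \<open>auto simp flip: ennreal_plus ennreal_mult intro!: ennreal_leI\<close>)
    also have "\<dots> \<le> ennreal (2 powr s) * (?a * (ennreal c * ?b) + (ennreal c * ?a) * ?b)"
      by (intro mult_left_mono add_mono mult_right_mono c) auto
    also have "\<dots> = ennreal (2 powr s * (2 * c)) * (?a * ?b)"
      using c by (simp add: ennreal_mult mult_2[symmetric] mult_ac)
    also have "\<dots> \<le> C * (?a * ?b)"
      unfolding C_def using c by (intro mult_right_mono ennreal_leI) auto
    finally show ?thesis .
  qed
  have DD: "dual_norm (hs_dual s) (cv a b) \<le> M"
    if "dual_norm (hs_dual s) a \<le> ennreal (sqrt 2) * B" "dual_norm (hs_dual s) b \<le> ennreal (sqrt 2) * B" for a b :: "int ^ 'd \<Rightarrow> ennreal"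
  proof -
    have "dual_norm (hs_dual s) (cv a b) \<le> C * ((ennreal (sqrt 2) * B) * (ennreal (sqrt 2) * B))"
      by (rule order_trans[OF alg]) (intro mult_left_mono mult_mono that; simp)
    also have "\<dots> \<le> M" by (simp add: M_def)
    finally show ?thesis .
  qed
  have inv: "refl_inv (hs_dual s :: (int ^ 'd \<Rightarrow> ennreal) set)" "refl_inv (hs_dual (s + 1) :: (int ^ 'd \<Rightarrow> ennreal) set)"
    by (intro refl_inv_l2; simp add: wt_uminus)+
  interpret gp_evolution V U T "hs_dual s" "hs_dual s" C M 1
  proof
    show "M < \<infinity>" using B C by (simp add: M_def ennreal_mult_less_top)
    show "tot a \<le> C * dual_norm (hs_dual s) a" for a :: "int ^ 'd \<Rightarrow> ennreal"
      by (rule order_trans[OF c(2)]) (intro mult_right_mono C; simp)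
    show "dual_norm (hs_dual s) (cv (frac_deriv 1 (nm (U t))) (refl_seq (frac_deriv 1 (nm (U t))))) \<le> M" for t
      by (rule DD) (simp_all only: dual_norm_refl[OF inv(1)] D[OF U])
  qed (fact C inv(1) alg low[OF V] low[OF U] DD[OF D[OF U] D[OF V]] DD[OF D[OF U] D[OF U]] | simp)+
  from convergence_of_algebra[OF refl T] obtain G \<tau>0 where G: "0 \<le> G" "0 < \<tau>0" and conv: "\<forall>\<tau> w n. 0 < \<tau> \<and> \<tau> \<le> \<tau>0 \<and> scheme_run \<tau> w \<and> real n * \<tau> \<le> T
     \<longrightarrow> dual_norm (hs_dual s) (err \<tau> w n) \<le> ennreal (G * \<tau> powr 1) \<and> dual_norm (hs_dual s) (nm (w n)) \<le> M + 1"
    by (elim exE conjE)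
  show ?thesis
  proof (rule exI[of _ G], rule conjI[OF G(1)], rule exI[of _ \<tau>0], rule conjI[OF G(2)], intro allI impI)
    fix \<tau> w n
    assume *: "0 < \<tau> \<and> \<tau> \<le> \<tau>0 \<and> scheme_run \<tau> w \<and> real n * \<tau> \<le> T"
    show "dual_norm (hs_dual s) (err \<tau> w n) \<le> ennreal (G * \<tau>)"
      using conv[rule_format, OF *] * by simp
  qed
qed

text \<open>
  \<open>L\<^sup>2\<close> is no algebra, so the scheme is first controlled in \<open>\<ell>\<^sup>1\<close>.  The low order \<open>1/8\<close> suffices there,
  because only boundedness of the numerical solution is wanted; any \<open>\<gamma> \<in> (0, 1 - d/4)\<close> would do.  The
  estimate in \<open>\<ell>\<^sup>2\<close> then has order one by the critical product estimate.
\<close>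

lemma l2_convergence:
  assumes d: "CARD('d) < 4" and T: "0 \<le> T" and B: "0 \<le> B"
    and V: "tot (\<lambda>k. (ennreal (wt (1 + real CARD('d) / 4) k) * nm V k)\<^sup>2) \<le> (ennreal B)\<^sup>2"
    and U: "\<And>t. tot (\<lambda>k. (ennreal (wt (1 + real CARD('d) / 4) k) * nm (U t) k)\<^sup>2) \<le> (ennreal B)\<^sup>2"
  shows "\<exists>G\<ge>0. \<exists>\<tau>0>0. \<forall>\<tau> w. 0 < \<tau> \<and> \<tau> \<le> \<tau>0 \<and> scheme_run \<tau> w
     \<longrightarrow> (\<forall>n. real n * \<tau> \<le> T \<longrightarrow> dual_norm (l2_dual (\<lambda>_. 1)) (err \<tau> w n) \<le> ennreal (G * \<tau>))"
proof -
  define s where "s = real CARD('d) / 4"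
  have s: "0 < s" "1 + real CARD('d) / 4 = s + 1" by (simp_all add: s_def)
  note V = V[unfolded s(2)] and U = U[unfolded s(2)]
  note nV = l2_norm_le[OF V B] and nU = l2_norm_le[OF U B]
  obtain c0 where c0: "c0 > 0" "\<And>a::int ^ 'd \<Rightarrow> ennreal. tot a \<le> ennreal c0 * dual_norm (hs_dual (s + 1)) a"
  proof -
    have "real CARD('d) \<le> 3" using d by simp
    then have "real CARD('d) / 2 < s + 1" by (simp add: s_def)
    from tot_le_hs_norm[OF this] show ?thesis using that by blast
  qed
  obtain c1 where c1: "c1 > 0" "\<And>a::int ^ 'd \<Rightarrow> ennreal. tot (\<lambda>k. ennreal ((1 + norm (freq k)) powr (1/8)) * a k) \<le> ennreal c1 * dual_norm (hs_dual (s + 1)) a"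
  proof -
    have "real CARD('d) \<le> 3" using d by simp
    then have "real CARD('d) / 2 < s + 1 - 1/8" by (simp add: s_def)
    from weighted_tot_le[OF _ this] show ?thesis using that by auto
  qed
  \<comment> \<open>bounds the data and their derivatives of order \<open>1/8\<close> in \<open>\<ell>\<^sup>1\<close>\<close>
  define A where "A = ennreal c0 * ennreal B + ennreal c1 * ennreal B"
  have A: "A < \<infinity>" by (simp add: A_def ennreal_mult_less_top)
  have t0: "tot a \<le> A" if "dual_norm (hs_dual (s + 1)) a \<le> ennreal B" for a :: "int ^ 'd \<Rightarrow> ennreal"
  proof -
    have "tot a \<le> ennreal c0 * ennreal B"
      by (rule order_trans[OF c0(2)]) (intro mult_left_mono that; simp)
    then show ?thesis by (simp add: A_def add_increasing2)
  qed
  have t1: "tot (frac_deriv (1/8) a) \<le> A" if "dual_norm (hs_dual (s + 1)) a \<le> ennreal B" for a :: "int ^ 'd \<Rightarrow> ennreal"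
  proof -
    have "tot (frac_deriv (1/8) a) \<le> tot (\<lambda>k. ennreal ((1 + norm (freq k)) powr (1/8)) * a k)"
      unfolding frac_deriv_def by (intro tot_mono mult_right_mono ennreal_leI powr_mono2) auto
    also have "\<dots> \<le> ennreal c1 * ennreal B"
      by (rule order_trans[OF c1(2)]) (intro mult_left_mono that; simp)
    finally show ?thesis by (simp add: A_def add_increasing)
  qed
  have tc: "dual_norm l1_dual (cv a b) \<le> A + A * A" if "tot a \<le> A" "tot b \<le> A" for a b :: "int ^ 'd \<Rightarrow> ennreal"
    using mult_mono[OF that] by (simp add: dual_norm_l1 tot_cv add_increasing)
  interpret l1: gp_evolution V U T l1_dual l1_dual 1 "A + A * A" "1/8"
  proof
    show "A + A * A < \<infinity>" using A by (simp add: ennreal_mult_less_top)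
    show "dual_norm l1_dual (nm V) \<le> A + A * A" using t0[OF nV] by (simp add: dual_norm_l1 add_increasing2)
    show "dual_norm l1_dual (nm (U t)) \<le> A + A * A" for t
      using t0[OF nU, of t] by (simp add: dual_norm_l1 add_increasing2)
    show "dual_norm l1_dual (cv (frac_deriv (1/8) (nm (U t))) (frac_deriv (1/8) (nm V))) \<le> A + A * A" for t
      by (rule tc[OF t1[OF nU] t1[OF nV]])
    show "dual_norm l1_dual (cv (frac_deriv (1/8) (nm (U t))) (frac_deriv (1/8) (nm (U t)))) \<le> A + A * A" for t
      by (rule tc[OF t1[OF nU] t1[OF nU]])
    show "dual_norm l1_dual (cv (frac_deriv (1/8) (nm (U t))) (refl_seq (frac_deriv (1/8) (nm (U t))))) \<le> A + A * A" for t
      by (rule tc[OF t1[OF nU]]) (simp only: tot_uminus t1[OF nU])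
  qed (simp_all add: refl_inv_l1 dual_norm_l1 tot_cv)
  from l1.convergence_of_algebra[OF refl T] obtain G0 \<tau>0 where \<tau>0: "0 < \<tau>0" "\<tau>0 \<le> 1" and bd: "\<forall>\<tau> w n. 0 < \<tau> \<and> \<tau> \<le> \<tau>0 \<and> scheme_run \<tau> w \<and> real n * \<tau> \<le> T
     \<longrightarrow> dual_norm l1_dual (err \<tau> w n) \<le> ennreal (G0 * \<tau> powr (1/8)) \<and> dual_norm l1_dual (nm (w n)) \<le> A + A * A + 1"
    by (elim exE conjE)

  define K where "K = 2 powr s * 2 powr s * sqrt (8 ^ CARD('d))"
  \<comment> \<open>The last summand bounds the products of two first derivatives in \<open>\<ell>\<^sup>2\<close>.\<close>
  define M where "M = A + ennreal B + ennreal (2 * K * (sqrt 2 * B) * (sqrt 2 * B))"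
  have K: "0 \<le> K" by (simp add: K_def)
  have h: "tot (\<lambda>k. (ennreal (wt s k) * frac_deriv 1 a k)\<^sup>2) \<le> (ennreal (sqrt 2 * B))\<^sup>2"
    if "tot (\<lambda>k. (ennreal (wt (s + 1) k) * a k)\<^sup>2) \<le> (ennreal B)\<^sup>2" for a :: "int ^ 'd \<Rightarrow> ennreal"
  proof -
    have "tot (\<lambda>k. (ennreal (wt s k) * frac_deriv 1 a k)\<^sup>2) \<le> tot (\<lambda>k. (ennreal (sqrt 2))\<^sup>2 * (ennreal (wt (s + 1) k) * a k)\<^sup>2)"
      unfolding power_mult_distrib[symmetric] by (intro tot_mono power_mono wt_frac_deriv_le s) auto
    also have "\<dots> \<le> (ennreal (sqrt 2))\<^sup>2 * (ennreal B)\<^sup>2"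
      unfolding tot_cmult by (intro mult_left_mono that) auto
    also have "\<dots> = (ennreal (sqrt 2 * B))\<^sup>2" using B by (simp add: ennreal_mult power_mult_distrib)
    finally show ?thesis .
  qed
  have crit: "dual_norm (l2_dual (\<lambda>_. 1)) (cv a b) \<le> M"
    if "tot (\<lambda>k. (ennreal (wt s k) * a k)\<^sup>2) \<le> (ennreal (sqrt 2 * B))\<^sup>2"
      "tot (\<lambda>k. (ennreal (wt s k) * b k)\<^sup>2) \<le> (ennreal (sqrt 2 * B))\<^sup>2" for a b :: "int ^ 'd \<Rightarrow> ennreal"
  proof -
    have "dual_norm (l2_dual (\<lambda>_. 1)) (cv a b) \<le> ennreal (2 * K * (sqrt 2 * B) * (sqrt 2 * B))"
    proof (rule l2_cv_critical[where v="\<lambda>k. ennreal (1 / wt s k)" and p="\<lambda>k. norm (freq k)"])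
      show "ennreal (1 / wt s k) * ennreal (wt s k) = 1" for k :: "int ^ 'd"
        by (simp flip: ennreal_mult)
      show "tot (\<lambda>j::int ^ 'd. if norm (freq j) \<le> norm (freq i) then (ennreal (1 / wt s j))\<^sup>2 else 0) \<le> (ennreal K)\<^sup>2 * (ennreal (wt s i))\<^sup>2"
        for i :: "int ^ 'd"
        unfolding K_def s_def by (rule critical_weight)
    qed (use that B K in auto)
    then show ?thesis by (simp add: M_def add_increasing)
  qed
  have refl: "tot (\<lambda>k. (ennreal (wt s k) * refl_seq a k)\<^sup>2) = tot (\<lambda>k. (ennreal (wt s k) * a k)\<^sup>2)" for a :: "int ^ 'd \<Rightarrow> ennreal"
    by (subst tot_uminus[symmetric]) (simp add: wt_uminus)
  interpret l2: gp_evolution V U T "l2_dual (\<lambda>_. 1)" l1_dual 1 M 1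
  proof
    show "M < \<infinity>" using A by (simp add: M_def)
    show "dual_norm l1_dual (nm V) \<le> M" using t0[OF nV] by (simp add: dual_norm_l1 M_def add_increasing2 add.assoc)
    show "dual_norm l1_dual (nm (U t)) \<le> M" for t
      using t0[OF nU, of t] by (simp add: dual_norm_l1 M_def add_increasing2 add.assoc)
    show "dual_norm (l2_dual (\<lambda>_. 1)) (nm (U t)) \<le> M" for t
    proof -
      have "dual_norm (l2_dual (\<lambda>_. 1)) (nm (U t)) \<le> 1 * dual_norm (hs_dual (s + 1)) (nm (U t))"
        using mult_right_mono[OF wt_ge_1 norm_ge_zero]
        by (intro l2_dual_norm_le) (simp flip: ennreal_mult)
      also have "\<dots> \<le> ennreal B" using nU[of t] by simp
      finally show ?thesis by (simp add: M_def add_increasing add_increasing2)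
    qed
    show "dual_norm (l2_dual (\<lambda>_. 1)) (cv (frac_deriv 1 (nm (U t))) (frac_deriv 1 (nm V))) \<le> M" for t
      by (rule crit[OF h[OF U] h[OF V]])
    show "dual_norm (l2_dual (\<lambda>_. 1)) (cv (frac_deriv 1 (nm (U t))) (frac_deriv 1 (nm (U t)))) \<le> M" for t
      by (rule crit[OF h[OF U] h[OF U]])
    show "dual_norm (l2_dual (\<lambda>_. 1)) (cv (frac_deriv 1 (nm (U t))) (refl_seq (frac_deriv 1 (nm (U t))))) \<le> M" for t
      by (rule crit[OF h[OF U]]) (simp only: refl h[OF U])
  qed (simp_all add: refl_inv_l1 refl_inv_l2 dual_norm_l1 tot_cv l2_cv_l1)
  have "A + A * A + 1 < \<infinity>" using A by (simp add: ennreal_mult_less_top)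
  from l2.convergence_of_bounded[OF this T] obtain G where G: "0 \<le> G" and conv: "\<forall>\<tau> w. 0 < \<tau> \<and> \<tau> \<le> 1 \<and> scheme_run \<tau> w \<and>
     (\<forall>n. real n * \<tau> \<le> T \<longrightarrow> dual_norm l1_dual (nm (w n)) \<le> A + A * A + 1)
     \<longrightarrow> (\<forall>n. real n * \<tau> \<le> T \<longrightarrow> dual_norm (l2_dual (\<lambda>_. 1)) (err \<tau> w n) \<le> ennreal (G * \<tau> powr 1))"
    by (elim exE conjE)
  show ?thesis
  proof (rule exI[of _ G], rule conjI[OF G(1)], rule exI[of _ \<tau>0], rule conjI[OF \<tau>0(1)], intro allI impI)
    fix \<tau> w n
    assume *: "0 < \<tau> \<and> \<tau> \<le> \<tau>0 \<and> scheme_run \<tau> w" and n: "real n * \<tau> \<le> T"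
    have "dual_norm l1_dual (nm (w n)) \<le> A + A * A + 1" if "real n * \<tau> \<le> T" for n
      using bd[rule_format, of \<tau> w n] * that by simp
    with conv[rule_format, of \<tau> w n] * n \<tau>0
    show "dual_norm (l2_dual (\<lambda>_. 1)) (err \<tau> w n) \<le> ennreal (G * \<tau>)"
      by simp
  qed
qed

end

section \<open>The trigonometric system\<close>

lemma measure_torus: "measure (torus_measure :: (real ^ 'd) measure) (space torus_measure) = (2 * pi) ^ CARD('d)"
proof -
  have "measure (torus_measure :: (real ^ 'd) measure) (space torus_measure)
     = measure lborel (cbox 0 (\<chi> i. 2 * pi) :: (real ^ 'd) set)"
    by (simp add: space_restrict_space measure_restrict_space)
  also have "\<dots> = (2 * pi) ^ CARD('d)"
    by (subst content_cbox_cart) (auto simp: interval_ne_empty_cart)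
  finally show ?thesis .
qed

lemma finite_torus: "finite_measure (torus_measure :: (real ^ 'd) measure)"
proof
  have "emeasure lborel (cbox 0 (\<chi> i. 2 * pi) :: (real ^ 'd) set) \<noteq> \<infinity>"
    by (rule less_imp_neq) (rule emeasure_lborel_cbox_finite)
  then show "emeasure torus_measure (space (torus_measure :: (real ^ 'd) measure)) \<noteq> \<infinity>"
    by (simp add: emeasure_restrict_space space_restrict_space)
qed

lemma borel_imp_torus_measurable: "f \<in> borel_measurable borel \<Longrightarrow> f \<in> borel_measurable torus_measure"
  by (intro measurable_restrict_space1 measurable_completion) simp

lemma cis_inner_measurable [measurable]: "(\<lambda>x. cis (v \<bullet> x)) \<in> borel_measurable borel"
  by (intro borel_measurable_continuous_onI continuous_intros)

lemma cis_sum: "finite A \<Longrightarrow> cis (\<Sum>i\<in>A. f i) = (\<Prod>i\<in>A. cis (f i))"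
  by (induction A rule: finite_induct) (simp_all add: cis_mult[symmetric])

lemma integral_cis_int: "(\<integral>t. cis (real_of_int n * t) \<partial>seg 0 (2 * pi)) = 0" if "n \<noteq> 0"
proof -
  have "(\<integral>t. cis (real_of_int n * t) \<partial>seg 0 (2 * pi)) = of_real (2 * pi) * phi1 (\<i> * of_real (2 * pi * n))"
    using integral_seg_cis[of "2 * pi" 0 "real_of_int n"] by (simp add: mult.commute)
  also have "cis (2 * pi * n) = 1"
    using cis_multiple_2pi[of "real_of_int n"] by (simp add: mult_ac)
  then have "phi1 (\<i> * of_real (2 * pi * n)) = 0"
    using phi1_cis[of "2 * pi * n"] that by simp
  finally show ?thesis by simp
qed

text \<open>
  The integral over the cell factors over the coordinates, and the factor of a coordinate with
  \<open>k\<^sub>i \<noteq> 0\<close> vanishes.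
\<close>

lemma integral_character:
  fixes k :: "int ^ 'd"
  shows "(\<integral>x. cis (freq k \<bullet> x) \<partial>torus_measure) = (if k = 0 then of_real ((2 * pi) ^ CARD('d)) else 0)"
proof (cases "k = 0")
  case True
  then show ?thesis using measure_torus[where 'd='d] by (simp add: scaleR_conv_of_real)
next
  case False
  let ?B = "Basis :: (real ^ 'd) set" and ?Q = "cbox 0 (\<chi> i. 2 * pi) :: (real ^ 'd) set"
  define g where "g b t = indicator {0..2 * pi} t *\<^sub>R cis ((freq k \<bullet> b) * t)" for b :: "real ^ 'd" and t
  interpret product_sigma_finite "\<lambda>_ :: real ^ 'd. lborel :: real measure"
    by standard
  have g_int: "integrable lborel (g b)" for b
  proof -
    have "integrable lborel (\<lambda>t. indicator {0..2 * pi} t *\<^sub>R cis ((freq k \<bullet> b) * t))"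
      using borel_integrable_atLeastAtMost'[of 0 "2 * pi" "\<lambda>t. cis ((freq k \<bullet> b) * t)"]
      by (simp add: set_integrable_def continuous_intros)
    then show ?thesis by (simp add: g_def[abs_def])
  qed
  have "(\<integral>x. cis (freq k \<bullet> x) \<partial>torus_measure) = (\<integral>x. indicator ?Q x *\<^sub>R cis (freq k \<bullet> x) \<partial>lebesgue)"
    by (simp add: integral_restrict_space)
  also have "\<dots> = (\<integral>x. indicator ?Q x *\<^sub>R cis (freq k \<bullet> x) \<partial>lborel)"
    by (rule integral_completion) measurable
  also have "\<dots> = (\<integral>y. indicator ?Q (\<Sum>b\<in>?B. y b *\<^sub>R b) *\<^sub>R cis (freq k \<bullet> (\<Sum>b\<in>?B. y b *\<^sub>R b)) \<partial>Pi\<^sub>M ?B (\<lambda>_. lborel))"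
    by (subst lborel_eq, subst integral_distr) (auto simp: borel_measurable_scaleR)
  also have "\<dots> = (\<integral>y. (\<Prod>b\<in>?B. g b (y b)) \<partial>Pi\<^sub>M ?B (\<lambda>_. lborel))"
  proof (rule Bochner_Integration.integral_cong[OF refl])
    fix y :: "real ^ 'd \<Rightarrow> real"
    let ?x = "\<Sum>b\<in>?B. y b *\<^sub>R b"
    have 1: "cis (freq k \<bullet> ?x) = (\<Prod>b\<in>?B. cis ((freq k \<bullet> b) * y b))"
      by (simp add: inner_sum_right cis_sum mult.commute)
    have xb: "?x \<bullet> b = y b" if "b \<in> ?B" for b
      using that by (simp add: inner_sum_left_Basis)
    have top: "(\<chi> i. 2 * pi) \<bullet> b = 2 * pi" if "b \<in> ?B" for b
      using that by (auto simp: Basis_vec_def inner_axis)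
    have "?x \<in> ?Q \<longleftrightarrow> (\<forall>b\<in>?B. y b \<in> {0..2 * pi})"
      by (auto simp: mem_box xb top)
    then have 2: "indicator ?Q ?x = (\<Prod>b\<in>?B. indicator {0..2 * pi} (y b) :: real)"
      by (auto simp: indicator_def prod_zero_iff)
    show "indicator ?Q ?x *\<^sub>R cis (freq k \<bullet> ?x) = (\<Prod>b\<in>?B. g b (y b))"
      unfolding 1 2 g_def scaleR_conv_of_real[where 'a=complex] by (simp add: prod.distrib)
  qed
  also have "\<dots> = (\<Prod>b\<in>?B. \<integral>t. g b t \<partial>lborel)"
    by (rule product_integral_prod) (auto intro: g_int)
  also have "\<dots> = 0"
  proof -
    obtain i where i: "k $ i \<noteq> 0" using False by (auto simp: vec_eq_iff)
    have "(\<integral>t. g (axis i 1) t \<partial>lborel) = (\<integral>t. cis (real_of_int (k $ i) * t) \<partial>seg 0 (2 * pi))"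
      by (simp add: g_def integral_restrict_space freq_def inner_axis)
    also have "\<dots> = 0" by (rule integral_cis_int[OF i])
    finally show ?thesis by (intro prod_zero) (auto intro!: bexI[of _ "axis i 1"])
  qed
  finally show ?thesis using False by simp
qed

text \<open>
  Trigonometric polynomials.
\<close>

inductive trig :: "(real ^ 'd \<Rightarrow> complex) \<Rightarrow> bool" where
  trig_character: "trig (\<lambda>x. c * cis (freq k \<bullet> x))"
| trig_add: "trig f \<Longrightarrow> trig g \<Longrightarrow> trig (\<lambda>x. f x + g x)"

lemma trig_mult:
  assumes "trig f" "trig g" shows "trig (\<lambda>x. f x * g x)"
  using assms
proof (induction f rule: trig.induct)
  case (trig_character c k)
  then show ?case
  proof (induction g rule: trig.induct)
    case (trig_character c' k')
    have "(\<lambda>x. c * cis (freq k \<bullet> x) * (c' * cis (freq k' \<bullet> x))) = (\<lambda>x. (c * c') * cis (freq (k + k') \<bullet> x))"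
      by (simp add: freq_add inner_add_left cis_mult[symmetric] mult_ac)
    then show ?case by (simp only: trig.trig_character)
  next
    case (trig_add f g)
    then show ?case by (simp only: distrib_left trig.trig_add)
  qed
next
  case (trig_add f1 f2)
  then show ?case by (simp only: distrib_right trig.trig_add)
qed

text \<open>
  A continuous map onto a product of circles.  Trigonometric polynomials factor through it and separate
  the points of its image, and it is injective on the open cell.
\<close>

definition torus_embed :: "real ^ 'd \<Rightarrow> complex ^ 'd" where
  "torus_embed x = (\<chi> i. cis (x $ i))"

lemma continuous_torus_embed: "continuous_on A torus_embed"
  unfolding torus_embed_def by (intro continuous_intros)

lemma trig_coordinate:
  fixes i :: "'d::finite"
  shows "trig (\<lambda>x. of_real (Re (torus_embed x $ i)))" "trig (\<lambda>x. of_real (Im (torus_embed x $ i)))"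
proof -
  have f: "freq (axis i 1 :: int ^ 'd) \<bullet> x = x $ i" "freq (axis i (- 1)) \<bullet> x = - (x $ i)" for x :: "real ^ 'd"
    by (simp_all add: freq_def inner_vec_def axis_def if_distrib[of "\<lambda>c. c * _"] if_distrib[of real_of_int] cong: if_cong)
  have "of_real (Re (torus_embed x $ i)) = 1/2 * cis (freq (axis i 1) \<bullet> x) + 1/2 * cis (freq (axis i (- 1)) \<bullet> x)"
    "of_real (Im (torus_embed x $ i)) = - \<i> / 2 * cis (freq (axis i 1) \<bullet> x) + \<i> / 2 * cis (freq (axis i (- 1)) \<bullet> x)" for x
    by (simp_all add: f torus_embed_def complex_eq_iff)
  then show "trig (\<lambda>x. of_real (Re (torus_embed x $ i)))" "trig (\<lambda>x. of_real (Im (torus_embed x $ i)))"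
    by (simp_all only: trig.intros)
qed

lemma trig_const: "trig (\<lambda>_. c)"
  using trig_character[of c 0] by simp

text \<open>
  Stone--Weierstrass on the product of circles.
\<close>

lemma trig_approximation:
  fixes g :: "complex ^ 'd \<Rightarrow> real"
  defines "S \<equiv> torus_embed ` cbox 0 (\<chi> i. 2 * pi)"
  assumes g: "continuous_on S g" and e: "0 < e"
  obtains p where "trig p" "\<And>x. x \<in> cbox 0 (\<chi> i. 2 * pi) \<Longrightarrow> cmod (of_real (g (torus_embed x)) - p x) < e"
proof -
  let ?P = "\<lambda>h. continuous_on S h \<and> trig (\<lambda>x. of_real (h (torus_embed x)))"
  have "\<exists>h. ?P h \<and> (\<forall>z\<in>S. \<bar>g z - h z\<bar> < e)"
  proof (rule Stone_Weierstrass_HOL)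
    show "compact S" unfolding S_def
      by (intro compact_continuous_image continuous_torus_embed compact_cbox)
    show "?P (\<lambda>x. c)" for c by (simp add: trig_const)
    show "?P (\<lambda>x. f x + g x)" "?P (\<lambda>x. f x * g x)" if "?P f \<and> ?P g" for f g
      using that by (auto intro!: continuous_intros trig_add trig_mult)
    show "\<exists>f. ?P f \<and> f x \<noteq> f y" if xy: "x \<in> S \<and> y \<in> S \<and> x \<noteq> y" for x y
    proof -
      obtain i where i: "x $ i \<noteq> y $ i" using xy by (auto simp: vec_eq_iff)
      have c: "?P (\<lambda>z. Re (z $ i))" "?P (\<lambda>z. Im (z $ i))"
        using trig_coordinate[of i] by (auto intro!: continuous_intros)
      from i have "Re (x $ i) \<noteq> Re (y $ i) \<or> Im (x $ i) \<noteq> Im (y $ i)" by (auto simp: complex_eq_iff)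
      then show ?thesis using c by blast
    qed
  qed (use g e in auto)
  then obtain h where h: "?P h" "\<And>z. z \<in> S \<Longrightarrow> \<bar>g z - h z\<bar> < e" by blast
  show ?thesis
  proof (rule that[of "\<lambda>x. of_real (h (torus_embed x))"])
    fix x :: "real ^ 'd" assume "x \<in> cbox 0 (\<chi> i. 2 * pi)"
    then show "cmod (of_real (g (torus_embed x)) - of_real (h (torus_embed x))) < e"
      using h(2)[of "torus_embed x"] by (simp add: S_def flip: of_real_diff)
  qed (use h in simp)
qed

lemma torus_embed_inj:
  assumes "x \<in> box 0 (\<chi> i. 2 * pi)" "y \<in> box 0 (\<chi> i. 2 * pi)" "torus_embed x = torus_embed y"
  shows "x = y"
proof -
  have "x $ i = y $ i" for i
  proof -
    have "cis (x $ i) = cis (y $ i)" using assms(3) by (simp add: torus_embed_def vec_eq_iff)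
    then obtain n :: int where n: "x $ i = y $ i + 2 * pi * n"
      unfolding cis_conv_exp exp_eq by (auto simp: complex_eq_iff mult_ac)
    have xy: "0 < x $ i" "x $ i < 2 * pi" "0 < y $ i" "y $ i < 2 * pi"
      using assms by (auto simp: mem_box_cart)
    have "2 * pi * real_of_int n < 2 * pi * 1" "2 * pi * (- 1) < 2 * pi * real_of_int n"
      using n xy by linarith+
    then have "real_of_int n < 1" "- 1 < real_of_int n"
      by (simp_all only: mult_less_cancel_left_pos pi_gt_zero mult_pos_pos zero_less_numeral)
    then have "n = 0" by linarith
    then show ?thesis using n by simp
  qed
  then show ?thesis by (simp add: vec_eq_iff)
qed

lemma integrable_mult_bounded:
  fixes f h :: "real ^ 'd \<Rightarrow> complex"
  assumes f: "integrable torus_measure f" and h: "h \<in> borel_measurable torus_measure" "\<And>x. x \<in> cbox 0 (\<chi> i. 2 * pi) \<Longrightarrow> cmod (h x) \<le> B"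
  shows "integrable torus_measure (\<lambda>x. f x * h x)"
proof (rule Bochner_Integration.integrable_bound[where f="\<lambda>x. of_real B * f x"])
  show "integrable torus_measure (\<lambda>x. of_real B * f x)" using f by simp
  show "(\<lambda>x. f x * h x) \<in> borel_measurable torus_measure" using f h by auto
  show "AE x in torus_measure. norm (f x * h x) \<le> norm (of_real B * f x)"
  proof (rule AE_I2)
    fix x :: "real ^ 'd" assume "x \<in> space torus_measure"
    then have "cmod (h x) \<le> \<bar>B\<bar>" using h(2)[of x] by (simp add: space_restrict_space)
    then show "norm (f x * h x) \<le> norm (of_real B * f x)"
      by (simp add: norm_mult mult.commute[of "cmod (f x)"] mult_right_mono)
  qed
qed

section \<open>Uniqueness of Fourier coefficients\<close>

lemma orthogonal_trig:
  fixes f :: "real ^ 'd \<Rightarrow> complex"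
  assumes f: "integrable torus_measure f"
    and orth: "\<And>k. (\<integral>x. f x * cis (freq k \<bullet> x) \<partial>torus_measure) = 0"
    and "trig p"
  shows "integrable torus_measure (\<lambda>x. f x * p x) \<and> (\<integral>x. f x * p x \<partial>torus_measure) = 0"
  using \<open>trig p\<close>
proof (induction p rule: trig.induct)
  case (trig_character c k)
  have "integrable torus_measure (\<lambda>x. f x * cis (freq k \<bullet> x))"
    by (rule integrable_mult_bounded[OF f, of _ 1]) (auto intro!: borel_imp_torus_measurable cis_inner_measurable)
  moreover have "(\<lambda>x. f x * (c * cis (freq k \<bullet> x))) = (\<lambda>x. c * (f x * cis (freq k \<bullet> x)))" by auto
  ultimately show ?case using orth[of k] by simp
next
  case (trig_add p q)
  then show ?case by (simp add: distrib_left)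
qed

lemma orthogonal_continuous:
  fixes f :: "real ^ 'd \<Rightarrow> complex" and g :: "complex ^ 'd \<Rightarrow> real"
  assumes f: "integrable torus_measure f"
    and orth: "\<And>k. (\<integral>x. f x * cis (freq k \<bullet> x) \<partial>torus_measure) = 0"
    and g: "continuous_on UNIV g" "\<And>z. \<bar>g z\<bar> \<le> 1"
  shows "(\<integral>x. f x * of_real (g (torus_embed x)) \<partial>torus_measure) = 0"
proof -
  let ?h = "\<lambda>x. of_real (g (torus_embed x)) :: complex"
  let ?I = "\<integral>x. f x * ?h x \<partial>torus_measure" and ?N = "\<integral>x. cmod (f x) \<partial>torus_measure"
  have h_meas: "?h \<in> borel_measurable torus_measure"
    by (intro borel_imp_torus_measurable borel_measurable_continuous_onI continuous_intros
        continuous_on_compose2[OF g(1) continuous_torus_embed]) auto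
  have h_int: "integrable torus_measure (\<lambda>x. f x * ?h x)"
    by (rule integrable_mult_bounded[OF f h_meas, of 1]) (simp add: g)
  have "cmod ?I \<le> e * ?N" if e: "0 < e" for e
  proof -
    have "continuous_on (torus_embed ` cbox 0 (\<chi> i. 2 * pi)) g" using g(1) by (rule continuous_on_subset) auto
    from trig_approximation[OF this e] obtain p where p: "trig p"
      "\<And>x. x \<in> cbox 0 (\<chi> i. 2 * pi) \<Longrightarrow> cmod (?h x - p x) < e" by metis
    note tp = orthogonal_trig[OF f orth p(1)]
    have d_int: "integrable torus_measure (\<lambda>x. f x * ?h x - f x * p x)"
      using tp h_int by simp
    have "?I = (\<integral>x. f x * ?h x - f x * p x \<partial>torus_measure)"
      using tp h_int by (simp add: Bochner_Integration.integral_diff)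
    then have "cmod ?I \<le> (\<integral>x. cmod (f x * ?h x - f x * p x) \<partial>torus_measure)"
      by (simp add: integral_norm_bound)
    also have "\<dots> \<le> (\<integral>x. e * cmod (f x) \<partial>torus_measure)"
    proof (rule integral_mono)
      fix x :: "real ^ 'd" assume "x \<in> space torus_measure"
      then have "cmod (?h x - p x) \<le> e" using p(2)[of x] by (simp add: space_restrict_space)
      then have "cmod (f x) * cmod (?h x - p x) \<le> cmod (f x) * e" by (intro mult_left_mono) auto
      then show "cmod (f x * ?h x - f x * p x) \<le> e * cmod (f x)"
        by (simp add: norm_mult mult.commute flip: right_diff_distrib)
    qed (use d_int f in auto)
    finally show ?thesis by simp
  qed
  note bound = this
  have N: "0 \<le> ?N" by simp
  then have quot: "?N / (?N + 1) \<le> 1" by (intro divide_le_eq_1[THEN iffD2]) linarith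
  have "cmod ?I \<le> 0"
  proof (rule field_le_epsilon)
    fix e :: real assume "0 < e"
    have "cmod ?I \<le> e / (?N + 1) * ?N" using N \<open>0 < e\<close> by (intro bound) (simp add: add_nonneg_pos)
    also have "\<dots> = e * (?N / (?N + 1))" by simp
    also have "\<dots> \<le> e * 1" by (rule mult_left_mono[OF quot]) (use \<open>0 < e\<close> in simp)
    finally show "cmod ?I \<le> 0 + e" by simp
  qed
  then show ?thesis by simp
qed

lemma AE_torus_box: "AE x in torus_measure. x \<in> box 0 (\<chi> i. 2 * pi)"
proof -
  have "negligible (cbox 0 (\<chi> i. 2 * pi) - box 0 (\<chi> i. 2 * pi) :: (real ^ 'd) set)"
    by (rule negligible_frontier_interval)
  then have "AE x in lebesgue. x \<notin> (cbox 0 (\<chi> i. 2 * pi) - box 0 (\<chi> i. 2 * pi) :: (real ^ 'd) set)"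
    unfolding negligible_iff_null_sets by (rule AE_not_in)
  then have "AE x in lebesgue. x \<in> cbox 0 (\<chi> i. 2 * pi) \<longrightarrow> x \<in> (box 0 (\<chi> i. 2 * pi) :: (real ^ 'd) set)"
    by eventually_elim auto
  then show ?thesis by (subst AE_restrict_space_iff) auto
qed

text \<open>
  The indicator of the compact image of \<open>K\<close> is the pointwise limit of the continuous functions
  \<open>max 0 (1 - n dist(z, C))\<close>, so orthogonality passes to it by dominated convergence.
\<close>

lemma orthogonal_compact:
  fixes f :: "real ^ 'd \<Rightarrow> complex"
  assumes f: "integrable torus_measure f"
    and orth: "\<And>k. (\<integral>x. f x * cis (freq k \<bullet> x) \<partial>torus_measure) = 0"
    and K: "compact K" "K \<subseteq> box 0 (\<chi> i. 2 * pi)"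
  shows "(\<integral>x. f x * indicator K x \<partial>torus_measure) = 0"
proof (cases "K = {}")
  case False
  define C where "C = torus_embed ` K"
  have C: "closed C" "C \<noteq> {}"
    unfolding C_def using False
    by (auto intro!: compact_imp_closed compact_continuous_image continuous_torus_embed K)
  define g where "g n z = max 0 (1 - real n * infdist z C)" for n z
  have g_cont: "continuous_on UNIV (g n)" for n
    unfolding g_def by (intro continuous_intros)
  have g_le: "\<bar>g n z\<bar> \<le> 1" for n z
    using infdist_nonneg[of z C] by (simp add: g_def)
  have g_lim: "(\<lambda>n. g n z) \<longlonglongrightarrow> indicator C z" for z
  proof (cases "z \<in> C")
    case True
    then have "infdist z C = 0" by simp
    then show ?thesis using True by (simp add: g_def)
  next
    case False
    then have pos: "0 < infdist z C"
      using C by (metis in_closed_iff_infdist_zero infdist_nonneg less_eq_real_def)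
    obtain N where N: "1 < real N * infdist z C" using pos by (metis reals_Archimedean3)
    have "g n z = 0" if "N \<le> n" for n
    proof -
      have "real N * infdist z C \<le> real n * infdist z C" using that pos by (intro mult_right_mono) auto
      then show ?thesis using N by (simp add: g_def)
    qed
    then have "(\<lambda>n. g n z) \<longlonglongrightarrow> 0" by (intro tendsto_eventually eventually_sequentiallyI[of N])
    then show ?thesis using False by simp
  qed
  have meas: "(\<lambda>x. of_real (g n (torus_embed x)) :: complex) \<in> borel_measurable torus_measure" for n
    by (intro borel_imp_torus_measurable borel_measurable_continuous_onI continuous_intros
        continuous_on_compose2[OF g_cont continuous_torus_embed]) auto
  have eq: "AE x in torus_measure. torus_embed x \<in> C \<longleftrightarrow> x \<in> K"
    using AE_torus_box
  proof eventually_elim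
    case (elim x)
    then show ?case unfolding C_def using torus_embed_inj K(2) by blast
  qed
  have Km: "K \<in> sets lebesgue" using K by (simp add: compact_imp_closed)
  have "(\<lambda>n. \<integral>x. f x * of_real (g n (torus_embed x)) \<partial>torus_measure) \<longlonglongrightarrow> (\<integral>x. f x * indicator K x \<partial>torus_measure)"
  proof (rule integral_dominated_convergence[where w="\<lambda>x. cmod (f x)"])
    have "(indicator K :: _ \<Rightarrow> complex) \<in> borel_measurable torus_measure"
      by (intro measurable_restrict_space1 borel_measurable_indicator Km)
    then show "(\<lambda>x. f x * indicator K x) \<in> borel_measurable torus_measure"
      using f by auto
    show "(\<lambda>x. f x * of_real (g n (torus_embed x))) \<in> borel_measurable torus_measure" for n
      using f meas[of n] by auto
    show "AE x in torus_measure. (\<lambda>n. f x * of_real (g n (torus_embed x))) \<longlonglongrightarrow> f x * indicator K x"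
      using eq
    proof eventually_elim
      case (elim x)
      have "(\<lambda>n. f x * of_real (g n (torus_embed x))) \<longlonglongrightarrow> f x * of_real (indicator C (torus_embed x))"
        by (intro tendsto_intros g_lim)
      also have "of_real (indicator C (torus_embed x)) = (indicator K x :: complex)"
        using elim by (simp add: indicator_def)
      finally show ?case .
    qed
    show "AE x in torus_measure. cmod (f x * of_real (g n (torus_embed x))) \<le> cmod (f x)" for n
      using g_le[of n] by (intro AE_I2) (simp add: norm_mult mult_left_le)
  qed (use f in auto)
  moreover have "(\<integral>x. f x * of_real (g n (torus_embed x)) \<partial>torus_measure) = 0" for n
    by (rule orthogonal_continuous[OF f orth g_cont g_le])
  ultimately show ?thesis by (simp add: LIMSEQ_const_iff)
qed simp

text \<open>
  Inner regularity: if \<open>g > 0\<close> on a set of positive measure, then also on a compact subset of positive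
  measure, where the integral of \<open>g\<close> would be positive.
\<close>

lemma AE_nonpos_of_compact_integrals:
  fixes g :: "real ^ 'd \<Rightarrow> real"
  assumes g: "integrable torus_measure g"
    and int: "\<And>K. compact K \<Longrightarrow> K \<subseteq> box 0 (\<chi> i. 2 * pi) \<Longrightarrow> (\<integral>x. g x * indicator K x \<partial>torus_measure) = 0"
  shows "AE x in torus_measure. g x \<le> 0"
proof -
  let ?Q = "cbox 0 (\<chi> i. 2 * pi) :: (real ^ 'd) set" and ?B = "box 0 (\<chi> i. 2 * pi) :: (real ^ 'd) set"
  define A where "A = {x \<in> space torus_measure. 0 < g x} \<inter> ?B"
  have [measurable]: "g \<in> borel_measurable torus_measure" using g by auto
  have "{x \<in> space torus_measure. 0 < g x} \<in> sets torus_measure"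
    by measurable
  then have "{x \<in> space torus_measure. 0 < g x} \<in> sets lebesgue"
    by (auto simp: sets_restrict_space_iff)
  then have A: "A \<in> sets lebesgue" unfolding A_def by auto
  have null: "emeasure lebesgue K = 0" if K: "compact K" "K \<subseteq> A" for K
  proof -
    have Km: "K \<in> sets lebesgue" using K by (simp add: compact_imp_closed)
    have KB: "K \<subseteq> ?B" "K \<subseteq> ?Q" using K box_subset_cbox[of 0 "\<chi> i. 2 * pi"] by (auto simp: A_def)
    have Km': "K \<in> sets torus_measure" using Km KB by (simp add: sets_restrict_space_iff)
    have Ki: "integrable torus_measure (\<lambda>x. g x * indicator K x)"
      by (rule integrable_real_mult_indicator[OF Km' g])
    have nn: "0 \<le> g x * indicator K x" for x
      using K(2) by (auto simp: A_def indicator_def intro: less_imp_le)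
    have "AE x in torus_measure. g x * indicator K x = 0"
      using integral_nonneg_eq_0_iff_AE[OF Ki] nn int[OF K(1) KB(1)] by simp
    then have "AE x in torus_measure. x \<notin> K"
    proof eventually_elim
      case (elim x) then show ?case using K(2) by (auto simp: A_def)
    qed
    then have "emeasure torus_measure K = 0"
      using AE_iff_measurable[of K torus_measure "\<lambda>x. x \<notin> K"] Km' KB by (auto simp: space_restrict_space)
    then show ?thesis using KB by (subst (asm) emeasure_restrict_space) auto
  qed
  have "emeasure lebesgue A \<le> ennreal e" if "0 < e" for e
  proof -
    from sets_lebesgue_inner_closed[OF A that] obtain K where
      K: "closed K" "K \<subseteq> A" "A - K \<in> lmeasurable" "emeasure lebesgue (A - K) < ennreal e" by metis
    have "bounded K" using K(2) by (rule bounded_subset[rotated]) (auto simp: A_def intro: bounded_subset[OF bounded_box])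
    then have "compact K" using K(1) by (simp add: compact_eq_bounded_closed)
    have "A = K \<union> (A - K)" using K(2) by auto
    moreover have "K \<in> sets lebesgue" "A - K \<in> sets lebesgue"
      using K(1) fmeasurableD[OF K(3)] by simp_all
    ultimately have "emeasure lebesgue A \<le> emeasure lebesgue K + emeasure lebesgue (A - K)"
      by (metis emeasure_subadditive)
    then show ?thesis using null[OF \<open>compact K\<close> K(2)] K(4) by simp
  qed
  then have "emeasure lebesgue A = 0"
    by (metis ennreal_le_epsilon add_0 le_zero_eq zero_le)
  then have "A \<in> null_sets lebesgue" using A by auto
  then have "AE x in lebesgue. x \<notin> A" by (rule AE_not_in)
  then have "AE x in lebesgue. x \<in> ?Q \<longrightarrow> x \<notin> A" by eventually_elim auto
  then have "AE x in torus_measure. x \<notin> A" by (subst AE_restrict_space_iff) auto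
  with AE_torus_box show ?thesis
  proof eventually_elim
    case (elim x)
    then show ?case using box_subset_cbox[of 0 "\<chi> i. 2 * pi"] by (auto simp: A_def space_restrict_space)
  qed
qed

text \<open>
  The real part of \<open>c f\<close> is nonpositive almost everywhere for \<open>c = 1, -1, i, -i\<close>.
\<close>

lemma fourier_uniqueness:
  fixes f :: "real ^ 'd \<Rightarrow> complex"
  assumes f: "integrable torus_measure f"
    and orth: "\<And>k. (\<integral>x. f x * cis (freq k \<bullet> x) \<partial>torus_measure) = 0"
  shows "AE x in torus_measure. f x = 0"
proof -
  have nonpos: "AE x in torus_measure. Re (c * f x) \<le> 0" for c
  proof (rule AE_nonpos_of_compact_integrals)
    show "integrable torus_measure (\<lambda>x. Re (c * f x))" using f by auto
    fix K :: "(real ^ 'd) set" assume K: "compact K" "K \<subseteq> box 0 (\<chi> i. 2 * pi)"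
    have Km: "K \<in> sets lebesgue" using K by (simp add: compact_imp_closed)
    have ind: "(indicator K :: _ \<Rightarrow> complex) \<in> borel_measurable torus_measure"
      by (intro measurable_restrict_space1 borel_measurable_indicator Km)
    have "integrable torus_measure (\<lambda>x. f x * indicator K x)"
      by (rule integrable_mult_bounded[OF f ind, of 1]) (simp add: indicator_def)
    then have int: "integrable torus_measure (\<lambda>x. c * (f x * indicator K x))" by simp
    have "(\<integral>x. Re (c * f x) * indicator K x \<partial>torus_measure) = (\<integral>x. Re (c * (f x * indicator K x)) \<partial>torus_measure)"
      by (intro Bochner_Integration.integral_cong) (auto simp: indicator_def)
    also have "\<dots> = Re (\<integral>x. c * (f x * indicator K x) \<partial>torus_measure)"
      by (rule integral_Re[OF int])
    also have "\<dots> = 0" using orthogonal_compact[OF f orth K] by simp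
    finally show "(\<integral>x. Re (c * f x) * indicator K x \<partial>torus_measure) = 0" .
  qed
  show ?thesis
    using nonpos[of 1] nonpos[of "- 1"] nonpos[of \<i>] nonpos[of "- \<i>"]
    by eventually_elim (simp add: complex_eq_iff)
qed

section \<open>Square integrable functions and their coefficients\<close>

lemma integrable_square_integrable:
  fixes f :: "real ^ 'd \<Rightarrow> complex"
  assumes "f \<in> borel_measurable torus_measure" "integrable torus_measure (\<lambda>x. (cmod (f x))\<^sup>2)"
  shows "integrable torus_measure f"
proof -
  interpret finite_measure "torus_measure :: (real ^ 'd) measure" by (rule finite_torus)
  have "integrable torus_measure (\<lambda>x. cmod (f x))"
    by (rule square_integrable_imp_integrable) (use assms in auto)
  then show ?thesis using assms(1) by (rule integrable_norm_cancel)
qed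

lemma torus_L2_integrable: "f \<in> torus_L2 \<Longrightarrow> integrable torus_measure f"
  by (auto simp: torus_L2_def intro: integrable_square_integrable)

lemma torus_L2_measurable: "f \<in> torus_L2 \<Longrightarrow> f \<in> borel_measurable torus_measure"
  by (simp add: torus_L2_def)

lemma torus_L2_add:
  assumes f: "f \<in> torus_L2" and g: "g \<in> torus_L2" shows "(\<lambda>x. f x + g x) \<in> torus_L2"
proof -
  have "integrable torus_measure (\<lambda>x. (cmod (f x + g x))\<^sup>2)"
  proof (rule Bochner_Integration.integrable_bound)
    show "integrable torus_measure (\<lambda>x. 2 * (cmod (f x))\<^sup>2 + 2 * (cmod (g x))\<^sup>2)"
      using f g by (simp add: torus_L2_def)
    show "(\<lambda>x. (cmod (f x + g x))\<^sup>2) \<in> borel_measurable torus_measure"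
      using f g by (auto simp: torus_L2_def)
    have "(cmod (f x + g x))\<^sup>2 \<le> 2 * (cmod (f x))\<^sup>2 + 2 * (cmod (g x))\<^sup>2" for x
    proof -
      have "(cmod (f x + g x))\<^sup>2 \<le> (cmod (f x) + cmod (g x))\<^sup>2"
        by (intro power_mono norm_triangle_ineq) auto
      also have "\<dots> \<le> 2 * (cmod (f x))\<^sup>2 + 2 * (cmod (g x))\<^sup>2"
        using zero_le_power2[of "cmod (f x) - cmod (g x)"] by (simp add: power2_eq_square algebra_simps)
      finally show ?thesis .
    qed
    then show "AE x in torus_measure. norm ((cmod (f x + g x))\<^sup>2) \<le> norm (2 * (cmod (f x))\<^sup>2 + 2 * (cmod (g x))\<^sup>2)"
      by (intro AE_I2) simp
  qed
  then show ?thesis using f g by (auto simp: torus_L2_def torus_periodic_def)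
qed

lemma torus_L2_cmult:
  assumes f: "f \<in> torus_L2" shows "(\<lambda>x. c * f x) \<in> torus_L2"
  using assms by (auto simp: torus_L2_def torus_periodic_def norm_mult power_mult_distrib)

lemma torus_L2_diff:
  assumes f: "f \<in> torus_L2" and g: "g \<in> torus_L2" shows "(\<lambda>x. f x - g x) \<in> torus_L2"
  using torus_L2_add[OF f torus_L2_cmult[OF g, of "-1"]] by simp

lemma torus_L2_sum:
  assumes "finite A" "\<And>i. i \<in> A \<Longrightarrow> f i \<in> torus_L2" shows "(\<lambda>x. \<Sum>i\<in>A. f i x) \<in> torus_L2"
  using assms
proof (induction A rule: finite_induct)
  case empty
  show ?case by (simp add: torus_L2_def torus_periodic_def)
qed (simp add: torus_L2_add)

text \<open>
  Coefficients with respect to the characters themselves; unlike \<open>fourier_coeff\<close>, they turn products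
  into convolutions without a constant.
\<close>

definition fc :: "(real ^ 'd \<Rightarrow> complex) \<Rightarrow> int ^ 'd \<Rightarrow> complex" where
  "fc f k = (\<integral>x. f x * cis (- (freq k \<bullet> x)) \<partial>torus_measure) / of_real ((2 * pi) ^ CARD('d))"

lemma fourier_coeff_fc:
  fixes f :: "real ^ 'd \<Rightarrow> complex"
  shows "fourier_coeff f k = of_real (sqrt ((2 * pi) ^ CARD('d))) * fc f k"
proof -
  let ?N = "(2 * pi) ^ CARD('d) :: real"
  have "fourier_coeff f k = (\<integral>x. f x * cis (- (freq k \<bullet> x)) \<partial>torus_measure) / of_real (sqrt ?N)"
    unfolding fourier_coeff_def by (simp add: cis_conv_exp)
  also have "of_real (sqrt ?N) * of_real (sqrt ?N) = (of_real ?N :: complex)"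
    by (simp flip: of_real_mult)
  then have "(\<integral>x. f x * cis (- (freq k \<bullet> x)) \<partial>torus_measure) / of_real (sqrt ?N)
     = of_real (sqrt ?N) * ((\<integral>x. f x * cis (- (freq k \<bullet> x)) \<partial>torus_measure) / of_real ?N)"
    by (simp add: field_simps)
  finally show ?thesis by (simp add: fc_def)
qed

lemma cis_freq_measurable: "(\<lambda>x. cis (- (freq k \<bullet> x))) \<in> borel_measurable torus_measure"
  by (intro borel_imp_torus_measurable borel_measurable_continuous_onI continuous_intros)

lemma integrable_mult_cis:
  fixes f :: "real ^ 'd \<Rightarrow> complex"
  shows "integrable torus_measure f \<Longrightarrow> integrable torus_measure (\<lambda>x. f x * cis (- (freq k \<bullet> x)))"
  by (rule integrable_mult_bounded[where B=1, OF _ cis_freq_measurable]) auto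

lemma fc_add:
  assumes "integrable torus_measure f" "integrable torus_measure g"
  shows "fc (\<lambda>x. f x + g x) k = fc f k + fc g k"
  using integrable_mult_cis[OF assms(1), of k] integrable_mult_cis[OF assms(2), of k]
  by (simp add: fc_def distrib_right add_divide_distrib)

lemma fc_diff:
  assumes "integrable torus_measure f" "integrable torus_measure g"
  shows "fc (\<lambda>x. f x - g x) k = fc f k - fc g k"
  using integrable_mult_cis[OF assms(1), of k] integrable_mult_cis[OF assms(2), of k]
  by (simp add: fc_def left_diff_distrib diff_divide_distrib)

lemma fc_cmult: "fc (\<lambda>x. c * f x) k = c * fc f k"
  by (simp add: fc_def mult.assoc)

lemma fc_sum:
  assumes "finite A" "\<And>i. i \<in> A \<Longrightarrow> integrable torus_measure (f i)"
  shows "fc (\<lambda>x. \<Sum>i\<in>A. f i x) k = (\<Sum>i\<in>A. fc (f i) k)"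
  using assms
proof (induction A rule: finite_induct)
  case (insert i A)
  then show ?case by (simp add: fc_add)
qed (simp add: fc_def)

lemma fc_cong_AE:
  assumes "AE x in torus_measure. f x = g x" "f \<in> borel_measurable torus_measure" "g \<in> borel_measurable torus_measure"
  shows "fc f k = fc g k"
proof -
  have "(\<integral>x. f x * cis (- (freq k \<bullet> x)) \<partial>torus_measure) = (\<integral>x. g x * cis (- (freq k \<bullet> x)) \<partial>torus_measure)"
    using assms(1) by (intro integral_cong_AE borel_measurable_times assms cis_freq_measurable) auto
  then show ?thesis by (simp add: fc_def)
qed

text \<open>
  The inequality \<open>A\<^sup>2 \<le> N Q\<close> between the integrals \<open>A\<close> of \<open>|f|\<close> and \<open>Q\<close> of \<open>|f|\<^sup>2\<close> expresses that the
  variance of \<open>|f|\<close> is nonnegative.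
\<close>

lemma norm_fc_le:
  fixes f :: "real ^ 'd \<Rightarrow> complex"
  assumes f: "f \<in> torus_L2"
  shows "cmod (fc f k) \<le> L2_norm_torus f / sqrt ((2 * pi) ^ CARD('d))"
proof -
  let ?N = "(2 * pi) ^ CARD('d) :: real" and ?M = "torus_measure :: (real ^ 'd) measure"
  define A where "A = (\<integral>x. cmod (f x) \<partial>?M)"
  define Q where "Q = (\<integral>x. (cmod (f x))\<^sup>2 \<partial>?M)"
  interpret finite_measure ?M by (rule finite_torus)
  have N: "0 < ?N" by simp
  have int: "integrable ?M (\<lambda>x. cmod (f x))" "integrable ?M (\<lambda>x. (cmod (f x))\<^sup>2)"
    using torus_L2_integrable[OF f] f by (auto simp: torus_L2_def)
  have "0 \<le> (\<integral>x. (cmod (f x) - A / ?N)\<^sup>2 \<partial>?M)" by simp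
  also have "\<dots> = (\<integral>x. (cmod (f x))\<^sup>2 - 2 * (A / ?N) * cmod (f x) + (A / ?N)\<^sup>2 \<partial>?M)"
    by (simp add: power2_diff algebra_simps)
  also have "\<dots> = Q - 2 * (A / ?N) * A + (A / ?N)\<^sup>2 * ?N"
    using int measure_torus[where 'd='d] by (simp add: A_def Q_def)
  also have "\<dots> = Q - A\<^sup>2 / ?N" using N by (simp add: power2_eq_square field_simps)
  finally have "A\<^sup>2 \<le> ?N * Q" using N by (simp add: field_simps)
  then have "A \<le> sqrt ?N * sqrt Q"
    by (metis real_sqrt_mult real_le_rsqrt)
  moreover have "cmod (fc f k) \<le> A / ?N"
  proof -
    have "cmod (\<integral>x. f x * cis (- (freq k \<bullet> x)) \<partial>?M) \<le> (\<integral>x. cmod (f x * cis (- (freq k \<bullet> x))) \<partial>?M)"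
      by (rule integral_norm_bound)
    then show ?thesis using N by (simp add: fc_def A_def norm_divide norm_mult divide_right_mono norm_power)
  qed
  ultimately have "cmod (fc f k) \<le> sqrt ?N * sqrt Q / ?N"
    using N by (meson divide_right_mono less_imp_le order_trans)
  also have "\<dots> = sqrt Q / sqrt ?N"
  proof -
    have "s * q / (s * s) = q / s" if "0 < s" for s q :: real using that by simp
    from this[of "sqrt ?N" "sqrt Q"] N show ?thesis by (simp only: real_sqrt_gt_0_iff real_sqrt_mult_self abs_of_pos)
  qed
  finally show ?thesis by (simp add: L2_norm_torus_def Q_def)
qed

section \<open>Absolutely convergent Fourier series\<close>

definition series :: "(int ^ 'd \<Rightarrow> complex) \<Rightarrow> real ^ 'd \<Rightarrow> complex" where
  "series c x = csum (\<lambda>k. c k * cis (freq k \<bullet> x))"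

lemma series_measurable: "series c \<in> borel_measurable torus_measure"
proof -
  have "(\<lambda>x. series c x) \<in> borel_measurable borel"
    unfolding series_def
    by (intro borel_measurable_csum borel_measurable_times borel_measurable_const cis_inner_measurable)
  then show ?thesis by (intro borel_imp_torus_measurable) simp
qed

lemma series_bounded:
  assumes "tot (nm c) < \<infinity>"
  shows "cmod (series c x) \<le> enn2real (tot (nm c))"
proof -
  have "ennreal (cmod (series c x)) \<le> tot (nm c)"
    using csum_norm_le[of "\<lambda>k. c k * cis (freq k \<bullet> x)"] by (simp add: series_def norm_mult)
  also have "\<dots> = ennreal (enn2real (tot (nm c)))" using assms by simp
  finally show ?thesis by simp
qed

lemma series_periodic:
  fixes c :: "int ^ 'd \<Rightarrow> complex" shows "torus_periodic (series c)"
proof -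
  have "cis (freq k \<bullet> (x + axis i (2 * pi))) = cis (freq k \<bullet> x)" for k :: "int ^ 'd" and x i
  proof -
    have "freq k \<bullet> axis i (2 * pi) = 2 * pi * real_of_int (k $ i)"
      by (simp add: inner_axis freq_def)
    moreover have "cis (2 * pi * real_of_int (k $ i)) = 1"
      using cis_multiple_2pi[of "real_of_int (k $ i)"] by (simp add: mult_ac)
    ultimately show ?thesis by (simp add: inner_add_right flip: cis_mult)
  qed
  then show ?thesis by (simp add: torus_periodic_def series_def)
qed

lemma bounded_AE_torus_L2:
  fixes f :: "real ^ 'd \<Rightarrow> complex"
  assumes "torus_periodic f" "f \<in> borel_measurable torus_measure" "AE x in torus_measure. cmod (f x) \<le> B"
  shows "f \<in> torus_L2"
proof -
  interpret finite_measure "torus_measure :: (real ^ 'd) measure" by (rule finite_torus)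
  have "integrable torus_measure (\<lambda>x. (cmod (f x))\<^sup>2)"
  proof (rule integrable_const_bound[where B="B\<^sup>2"])
    show "AE x in torus_measure. norm ((cmod (f x))\<^sup>2) \<le> B\<^sup>2"
      using assms(3) by eventually_elim (simp add: power_mono)
  qed (use assms in auto)
  then show ?thesis using assms by (simp add: torus_L2_def)
qed

lemma series_torus_L2: "tot (nm c) < \<infinity> \<Longrightarrow> series c \<in> torus_L2"
  by (rule bounded_AE_torus_L2[OF series_periodic series_measurable]) (use series_bounded in blast)

lemma csum_delta: "csum (\<lambda>k. if k = l then z else 0) = z"
proof -
  have "(\<lambda>k. if k = l then z else 0) = (\<lambda>k. indicator {l} k *\<^sub>R z)" by auto
  then show ?thesis by simp
qed

lemma fc_series:
  fixes c :: "int ^ 'd \<Rightarrow> complex"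
  assumes c: "tot (nm c) < \<infinity>" shows "fc (series c) = c"
proof
  fix l
  let ?N = "(2 * pi) ^ CARD('d) :: real" and ?M = "torus_measure :: (real ^ 'd) measure"
  interpret finite_measure ?M by (rule finite_torus)
  let ?f = "\<lambda>k x. c k * cis (freq k \<bullet> x) * cis (- (freq l \<bullet> x))"
  have f: "?f k = (\<lambda>x. c k * cis (freq (k - l) \<bullet> x))" for k
    by (simp add: freq_diff mult.assoc cis_mult inner_diff_left)
  have "(\<integral>x. series c x * cis (- (freq l \<bullet> x)) \<partial>?M) = (\<integral>x. csum (\<lambda>k. ?f k x) \<partial>?M)"
    by (simp add: series_def)
  also have "\<dots> = csum (\<lambda>k. \<integral>x. ?f k x \<partial>?M)"
  proof (rule csum_swap)
    show "sigma_finite_measure ?M" ..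
    show "?f k \<in> borel_measurable ?M" for k
      unfolding f by (intro borel_imp_torus_measurable borel_measurable_times borel_measurable_const cis_inner_measurable)
    have "tot (\<lambda>k. \<integral>\<^sup>+x. cmod (?f k x) \<partial>?M) = tot (nm c) * emeasure ?M (space ?M)"
      by (simp add: norm_mult tot_multc)
    also have "\<dots> < \<infinity>"
    proof -
      have "emeasure ?M (space ?M) < \<infinity>" by (rule finite_emeasure_space[unfolded less_top infinity_ennreal_def, folded infinity_ennreal_def])
      then show ?thesis using c by (simp only: ennreal_mult_less_top infinity_ennreal_def simp_thms)
    qed
    finally show "tot (\<lambda>k. \<integral>\<^sup>+x. cmod (?f k x) \<partial>?M) < \<infinity>" .
  qed
  also have "\<dots> = csum (\<lambda>k. if k = l then c l * of_real ?N else 0)"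
    by (intro Bochner_Integration.integral_cong) (auto simp: f integral_character)
  also have "\<dots> = c l * of_real ?N" by (rule csum_delta)
  finally show "fc (series c) l = c l" by (simp add: fc_def)
qed

text \<open>
  The product of two absolutely convergent series, rearranged along \<open>k = j + (k - j)\<close>.
\<close>

lemma series_mult:
  fixes a b :: "int ^ 'd \<Rightarrow> complex"
  assumes a: "tot (nm a) < \<infinity>" and b: "tot (nm b) < \<infinity>"
  shows "series a x * series b x = series (conv a b) x"
proof -
  let ?e = "\<lambda>k. cis (freq k \<bullet> x)"
  have e: "a j * b (k - j) * ?e k = (a j * ?e j) * (b (k - j) * ?e (k - j))" for j k
  proof -
    have "?e j * ?e (k - j) = ?e k" by (simp add: cis_mult freq_diff inner_diff_left)
    then have "(a j * ?e j) * (b (k - j) * ?e (k - j)) = a j * b (k - j) * (?e j * ?e (k - j))"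
      by (simp only: mult_ac)
    then show ?thesis using \<open>?e j * ?e (k - j) = ?e k\<close> by simp
  qed
  have "series (conv a b) x = csum (\<lambda>k. csum (\<lambda>j. a j * b (k - j) * ?e k))"
    by (simp add: series_def conv_def)
  also have "\<dots> = csum (\<lambda>k. csum (\<lambda>j. (a j * ?e j) * (b (k - j) * ?e (k - j))))"
    unfolding e ..
  also have "\<dots> = csum (\<lambda>j. csum (\<lambda>k. (a j * ?e j) * (b (k - j) * ?e (k - j))))"
  proof (rule csum_swap)
    show "sigma_finite_measure (count_space (UNIV :: (int ^ 'd) set))"
      by (rule sigma_finite_measure_count_space)
    have "tot (\<lambda>j. tot (\<lambda>k. ennreal (cmod ((a j * ?e j) * (b (k - j) * ?e (k - j))))))
       = tot (\<lambda>j. tot (\<lambda>k. nm a j * nm b (k - j)))"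
      by (simp add: norm_mult ennreal_mult)
    also have "\<dots> = tot (cv (nm a) (nm b))"
      unfolding cv_def by (rule tot_swap)
    also have "\<dots> < \<infinity>" using a b by (simp add: tot_cv ennreal_mult_less_top)
    finally show "tot (\<lambda>j. tot (\<lambda>k. ennreal (cmod ((a j * ?e j) * (b (k - j) * ?e (k - j)))))) < \<infinity>" .
  qed simp
  also have "\<dots> = csum (\<lambda>j. (a j * ?e j) * series b x)"
  proof (rule Bochner_Integration.integral_cong[OF refl])
    fix j :: "int ^ 'd"
    have bij: "bij_betw (\<lambda>k. k - j) UNIV UNIV"
      by (rule bij_betw_byWitness[of _ "\<lambda>k. k + j"]) auto
    have "csum (\<lambda>k. b (k - j) * ?e (k - j)) = series b x"
      unfolding series_def by (rule integral_bij_count_space[OF bij, of "\<lambda>k. b k * ?e k"])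
    then show "csum (\<lambda>k. (a j * ?e j) * (b (k - j) * ?e (k - j))) = (a j * ?e j) * series b x"
      by simp
  qed
  also have "\<dots> = series a x * series b x"
    by (simp add: series_def)
  finally show ?thesis ..
qed

lemma series_cnj:
  fixes a :: "int ^ 'd \<Rightarrow> complex" shows "cnj (series a x) = series (conj_seq a) x"
proof -
  have bij: "bij_betw uminus UNIV (UNIV :: (int ^ 'd) set)"
    by (rule bij_betw_byWitness[of _ uminus]) auto
  have "cnj (series a x) = csum (\<lambda>k. cnj (a k * cis (freq k \<bullet> x)))"
    unfolding series_def by (rule Bochner_Integration.integral_cnj[symmetric])
  also have "\<dots> = csum (\<lambda>k. cnj (a (- k) * cis (freq (- k) \<bullet> x)))"
    by (rule integral_bij_count_space[OF bij, symmetric])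
  also have "\<dots> = series (conj_seq a) x"
    by (simp add: series_def conj_seq_def cis_cnj freq_uminus)
  finally show ?thesis .
qed

text \<open>
  The Wiener algebra, up to null sets: square integrable functions with summable coefficients.
\<close>

definition wiener :: "(real ^ 'd \<Rightarrow> complex) set" where
  "wiener = {f \<in> torus_L2. tot (nm (fc f)) < \<infinity>}"

lemma wiener_AE_series:
  assumes "f \<in> wiener" shows "AE x in torus_measure. f x = series (fc f) x"
proof -
  have f: "f \<in> torus_L2" and c: "tot (nm (fc f)) < \<infinity>" using assms by (auto simp: wiener_def)
  let ?g = "\<lambda>x. f x - series (fc f) x"
  have int: "integrable torus_measure f" "integrable torus_measure (series (fc f))"
    by (intro torus_L2_integrable f series_torus_L2 c)+
  have "fc ?g k = 0" for k
    using fc_diff[OF int] fc_series[OF c] by simp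
  then have "(\<integral>x. ?g x * cis (- (freq k \<bullet> x)) \<partial>torus_measure) = 0" for k
    by (simp add: fc_def)
  from this[of "- k" for k] have "(\<integral>x. ?g x * cis (freq k \<bullet> x) \<partial>torus_measure) = 0" for k
    by (simp add: freq_uminus)
  then have "AE x in torus_measure. ?g x = 0"
    by (intro fourier_uniqueness) (use int in auto)
  then show ?thesis by eventually_elim simp
qed

lemma wienerI:
  assumes "torus_periodic f" "f \<in> borel_measurable torus_measure" "AE x in torus_measure. f x = series c x" "tot (nm c) < \<infinity>"
  shows "f \<in> wiener" "fc f = c"
proof -
  have "AE x in torus_measure. cmod (f x) \<le> enn2real (tot (nm c))"
    using assms(3) by eventually_elim (simp add: series_bounded[OF assms(4)])
  then have L2: "f \<in> torus_L2" by (rule bounded_AE_torus_L2[OF assms(1,2)])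
  have "fc f k = fc (series c) k" for k
    by (rule fc_cong_AE[OF assms(3,2) series_measurable])
  then show "fc f = c" using fc_series[OF assms(4)] by auto
  then show "f \<in> wiener" using L2 assms(4) by (simp add: wiener_def)
qed

lemma wiener_mult:
  assumes f: "f \<in> wiener" and g: "g \<in> wiener"
  shows "(\<lambda>x. f x * g x) \<in> wiener" "fc (\<lambda>x. f x * g x) = conv (fc f) (fc g)"
proof -
  have fin: "tot (nm (fc f)) < \<infinity>" "tot (nm (fc g)) < \<infinity>" using f g by (auto simp: wiener_def)
  have 1: "torus_periodic (\<lambda>x. f x * g x)"
    using f g by (simp add: wiener_def torus_L2_def torus_periodic_def)
  have 2: "(\<lambda>x. f x * g x) \<in> borel_measurable torus_measure"
    using f g by (auto simp: wiener_def torus_L2_def)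
  have 3: "AE x in torus_measure. f x * g x = series (conv (fc f) (fc g)) x"
    using wiener_AE_series[OF f] wiener_AE_series[OF g]
    by eventually_elim (simp add: series_mult[OF fin, symmetric])
  show "(\<lambda>x. f x * g x) \<in> wiener" "fc (\<lambda>x. f x * g x) = conv (fc f) (fc g)"
    by (rule wienerI[OF 1 2 3 tot_nm_conv_finite[OF fin]])+
qed

lemma wiener_cnj:
  assumes f: "f \<in> wiener"
  shows "(\<lambda>x. cnj (f x)) \<in> wiener" "fc (\<lambda>x. cnj (f x)) = conj_seq (fc f)"
proof -
  have fin: "tot (nm (conj_seq (fc f))) < \<infinity>" using f unfolding tot_nm_conj_seq by (auto simp: wiener_def)
  have 1: "torus_periodic (\<lambda>x. cnj (f x))"
    using f by (simp add: wiener_def torus_L2_def torus_periodic_def)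
  have "(\<lambda>z. cnj z) \<in> borel_measurable borel"
    by (intro borel_measurable_continuous_onI continuous_intros)
  then have 2: "(\<lambda>x. cnj (f x)) \<in> borel_measurable torus_measure"
    using f measurable_compose[of f torus_measure borel cnj] by (auto simp: wiener_def torus_L2_def)
  have 3: "AE x in torus_measure. cnj (f x) = series (conj_seq (fc f)) x"
    using wiener_AE_series[OF f] by eventually_elim (simp add: series_cnj[symmetric])
  show "(\<lambda>x. cnj (f x)) \<in> wiener" "fc (\<lambda>x. cnj (f x)) = conj_seq (fc f)"
    by (rule wienerI[OF 1 2 3 fin])+
qed

lemma wiener_add:
  assumes f: "f \<in> wiener" and g: "g \<in> wiener"
  shows "(\<lambda>x. f x + g x) \<in> wiener" "fc (\<lambda>x. f x + g x) = (\<lambda>k. fc f k + fc g k)"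
proof -
  have L: "f \<in> torus_L2" "g \<in> torus_L2" and fin: "tot (nm (fc f)) < \<infinity>" "tot (nm (fc g)) < \<infinity>"
    using f g by (auto simp: wiener_def)
  show eq: "fc (\<lambda>x. f x + g x) = (\<lambda>k. fc f k + fc g k)"
    by (rule ext) (intro fc_add torus_L2_integrable L)
  have "tot (nm (\<lambda>k. fc f k + fc g k)) \<le> tot (nm (fc f)) + tot (nm (fc g))"
    unfolding tot_add[symmetric] by (intro tot_mono) (simp add: norm_triangle_ineq flip: ennreal_plus)
  also have "\<dots> < \<infinity>" using fin by simp
  finally show "(\<lambda>x. f x + g x) \<in> wiener"
    using torus_L2_add[OF L] by (simp add: wiener_def eq)
qed

lemma wiener_cmult:
  assumes f: "f \<in> wiener"
  shows "(\<lambda>x. c * f x) \<in> wiener" "fc (\<lambda>x. c * f x) = (\<lambda>k. c * fc f k)"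
proof -
  show eq: "fc (\<lambda>x. c * f x) = (\<lambda>k. c * fc f k)" by (rule ext) (rule fc_cmult)
  show "(\<lambda>x. c * f x) \<in> wiener"
    using f torus_L2_cmult[of f c]
    by (simp add: wiener_def eq norm_mult ennreal_mult tot_cmult ennreal_mult_less_top)
qed

text \<open>
  The multiplier operator picks some square integrable function with the prescribed coefficients; such a
  function exists because the series of these coefficients is one.
\<close>

lemma wiener_multiplier:
  assumes f: "f \<in> wiener" and m: "\<And>k. cmod (m k) \<le> 1"
  shows "fourier_multiplier m f \<in> wiener" "fc (fourier_multiplier m f) = (\<lambda>k. m k * fc f k)"
proof -
  have fin: "tot (nm (\<lambda>k. m k * fc f k)) < \<infinity>"
    using f by (intro tot_multiplier m) (simp add: wiener_def)
  let ?P = "\<lambda>g. g \<in> torus_L2 \<and> (\<forall>k. fourier_coeff g k = m k * fourier_coeff f k)"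
  have "?P (series (\<lambda>k. m k * fc f k))"
    using series_torus_L2[OF fin] fc_series[OF fin] by (simp add: fourier_coeff_fc)
  then have P: "?P (fourier_multiplier m f)" unfolding fourier_multiplier_def by (rule someI[where P="?P"])
  then show eq: "fc (fourier_multiplier m f) = (\<lambda>k. m k * fc f k)"
    by (auto simp: fourier_coeff_fc)
  show "fourier_multiplier m f \<in> wiener" using P fin by (simp add: wiener_def eq)
qed

text \<open>
  Parseval's identity, read off from the coefficient of \<open>f cnj f\<close> at frequency \<open>0\<close>.
\<close>

lemma wiener_L2_norm:
  fixes f :: "real ^ 'd \<Rightarrow> complex"
  assumes f: "f \<in> wiener"
  shows "L2_norm_torus f = sqrt ((2 * pi) ^ CARD('d) * (\<integral>k. (cmod (fc f k))\<^sup>2 \<partial>count_space UNIV))"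
    and "integrable (count_space UNIV) (\<lambda>k. (cmod (fc f k))\<^sup>2)"
proof -
  let ?N = "(2 * pi) ^ CARD('d) :: real"
  let ?c = "fc f"
  note g = wiener_mult[OF f wiener_cnj(1)[OF f]]
  have fin: "tot (nm ?c) < \<infinity>" "tot (nm (conj_seq ?c)) < \<infinity>" using f unfolding tot_nm_conj_seq by (auto simp: wiener_def)
  have sq: "f x * cnj (f x) = of_real ((cmod (f x))\<^sup>2)" for x by (rule complex_norm_square[symmetric])
  have sqc: "?c j * conj_seq ?c (0 - j) = of_real ((cmod (?c j))\<^sup>2)" for j
    unfolding conj_seq_def complex_norm_square by simp
  have int: "integrable (count_space UNIV) (\<lambda>j. of_real ((cmod (?c j))\<^sup>2) :: complex)"
    using integrable_conv[OF fin, of 0] unfolding sqc .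
  then show "integrable (count_space UNIV) (\<lambda>k. (cmod (fc f k))\<^sup>2)"
    by (simp only: complex_of_real_integrable_eq)
  have "fc (\<lambda>x. f x * cnj (f x)) 0 = conv ?c (conj_seq ?c) 0"
    using g(2) wiener_cnj(2)[OF f] by simp
  also have "\<dots> = of_real (\<integral>k. (cmod (?c k))\<^sup>2 \<partial>count_space UNIV)"
    unfolding conv_def sqc by (rule integral_complex_of_real)
  finally have "(\<integral>x. of_real ((cmod (f x))\<^sup>2) \<partial>torus_measure) / of_real ?N
     = (of_real (\<integral>k. (cmod (?c k))\<^sup>2 \<partial>count_space UNIV) :: complex)"
    unfolding fc_def sq by simp
  then have "of_real ((\<integral>x. (cmod (f x))\<^sup>2 \<partial>torus_measure) / ?N)
     = (of_real (\<integral>k. (cmod (?c k))\<^sup>2 \<partial>count_space UNIV) :: complex)"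
    by (simp only: integral_complex_of_real of_real_divide)
  then have "(\<integral>x. (cmod (f x))\<^sup>2 \<partial>torus_measure) = ?N * (\<integral>k. (cmod (?c k))\<^sup>2 \<partial>count_space UNIV)"
    unfolding of_real_eq_iff by (simp add: field_simps)
  then show "L2_norm_torus f = sqrt (?N * (\<integral>k. (cmod (fc f k))\<^sup>2 \<partial>count_space UNIV))"
    by (simp add: L2_norm_torus_def)
qed

section \<open>Sobolev norms in terms of coefficients\<close>

text \<open>
  The constant between the two normalizations of the coefficients.
\<close>

definition vol_root :: "nat \<Rightarrow> real" where
  "vol_root d = sqrt ((2 * pi) ^ d)"

lemma vol_root_pos [simp]: "0 < vol_root d" "0 \<le> vol_root d" "vol_root d \<noteq> 0"
proof -
  show "0 < vol_root d" by (simp add: vol_root_def)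
  then show "0 \<le> vol_root d" "vol_root d \<noteq> 0" by simp_all
qed

lemma vol_root_sq: "(2 * pi) ^ d = (vol_root d)\<^sup>2"
  by (simp add: vol_root_def)

lemma sobolev_weight_fc:
  fixes f :: "real ^ 'd \<Rightarrow> complex"
  shows "(1 + norm (freq k) powr (2 * s)) * (cmod (fourier_coeff f k))\<^sup>2
    = (vol_root CARD('d))\<^sup>2 * (wt s k * cmod (fc f k))\<^sup>2"
  unfolding fourier_coeff_fc vol_root_def[symmetric]
  by (simp add: norm_mult power_mult_distrib wt_sq)

lemma sobolev_torus_L2: "f \<in> sobolev s \<Longrightarrow> f \<in> torus_L2"
  by (simp add: sobolev_def)

lemma sobolev_norm_nonneg: "0 \<le> sobolev_norm s f"
  by (auto simp: sobolev_norm_def L2_norm_torus_def intro!: infsum_nonneg mult_nonneg_nonneg add_nonneg_nonneg)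

lemma sobolev_imp_hs_norm:
  fixes f :: "real ^ 'd \<Rightarrow> complex"
  assumes f: "f \<in> sobolev s" and s: "0 < s" and B: "sobolev_norm s f \<le> vol_root CARD('d) * B"
  shows "tot (\<lambda>k. (ennreal (wt s k) * nm (fc f) k)\<^sup>2) \<le> (ennreal B)\<^sup>2"
    and "dual_norm (hs_dual s) (nm (fc f)) \<le> ennreal B"
proof -
  let ?r = "vol_root CARD('d)"
  let ?N = "?r\<^sup>2"
  let ?g = "\<lambda>k. ?N * (wt s k * cmod (fc f k))\<^sup>2"
  have "0 \<le> ?r * B" using B sobolev_norm_nonneg[of s f] by linarith
  then have B0: "0 \<le> B" using vol_root_pos(1)[of "CARD('d)"] by (simp add: zero_le_mult_iff)
  have sm: "?g summable_on UNIV"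
    using f s by (simp add: sobolev_def sobolev_weight_fc)
  have norm: "sobolev_norm s f = sqrt (\<Sum>\<^sub>\<infinity>k. ?g k)"
    using s by (simp add: sobolev_norm_def sobolev_weight_fc)
  have le: "(\<Sum>k\<in>F. (wt s k * cmod (fc f k))\<^sup>2) \<le> B\<^sup>2" if "finite F" for F
  proof -
    have "?N * (\<Sum>k\<in>F. (wt s k * cmod (fc f k))\<^sup>2) = (\<Sum>k\<in>F. ?g k)"
      by (rule sum_distrib_left)
    also have "\<dots> \<le> (\<Sum>\<^sub>\<infinity>k. ?g k)"
      by (rule finite_sum_le_infsum[OF sm that]) auto
    also have "\<dots> = (sobolev_norm s f)\<^sup>2"
      unfolding norm by (simp add: infsum_nonneg)
    also have "\<dots> \<le> (?r * B)\<^sup>2"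
      by (intro power_mono B sobolev_norm_nonneg)
    also have "\<dots> = ?N * B\<^sup>2" by (simp add: power_mult_distrib)
    finally show ?thesis by simp
  qed
  have "tot (\<lambda>k. (ennreal (wt s k) * nm (fc f) k)\<^sup>2) = tot (\<lambda>k. ennreal ((wt s k * cmod (fc f k))\<^sup>2))"
    by (simp add: ennreal_power flip: ennreal_mult)
  also have "\<dots> \<le> ennreal (B\<^sup>2)"
    by (rule tot_le_freq_box) (auto intro: le finite_freq_box)
  also have "\<dots> = (ennreal B)\<^sup>2" using B0 by (simp add: ennreal_power)
  finally show *: "tot (\<lambda>k. (ennreal (wt s k) * nm (fc f) k)\<^sup>2) \<le> (ennreal B)\<^sup>2" .
  show "dual_norm (hs_dual s) (nm (fc f)) \<le> ennreal B"
    by (rule l2_norm_le[OF * B0])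
qed

lemma sobolev_imp_hs_norm_self:
  fixes f :: "real ^ 'd \<Rightarrow> complex"
  assumes "f \<in> sobolev s" "0 < s"
  shows "dual_norm (hs_dual s) (nm (fc f)) \<le> ennreal (sobolev_norm s f / vol_root CARD('d))"
  by (rule sobolev_imp_hs_norm(2)[OF assms]) simp

lemma hs_norm_imp_sobolev:
  fixes f :: "real ^ 'd \<Rightarrow> complex"
  assumes f: "f \<in> torus_L2" and s: "0 < s" and B: "dual_norm (hs_dual s) (nm (fc f)) \<le> ennreal B" "0 \<le> B"
  shows "f \<in> sobolev s" "sobolev_norm s f \<le> vol_root CARD('d) * B"
proof -
  let ?r = "vol_root CARD('d)"
  let ?N = "?r\<^sup>2"
  let ?g = "\<lambda>k. ?N * (wt s k * cmod (fc f k))\<^sup>2"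
  have le: "(\<Sum>k\<in>F. ?g k) \<le> ?N * B\<^sup>2" if "finite F" for F
    unfolding sum_distrib_left[symmetric]
    by (intro mult_left_mono l2_norm_bound_sum B that) auto
  have sm: "?g summable_on UNIV"
    by (rule nonneg_bdd_above_summable_on) (auto intro!: bdd_aboveI2[where M="?N * B\<^sup>2"] le simp del: power_mult_distrib)
  then show "f \<in> sobolev s"
    using f by (simp add: sobolev_def sobolev_weight_fc)
  have "(\<Sum>\<^sub>\<infinity>k. ?g k) \<le> ?N * B\<^sup>2"
    by (rule infsum_le_finite_sums[OF sm]) (rule le)
  then have "sqrt (\<Sum>\<^sub>\<infinity>k. ?g k) \<le> sqrt (?N * B\<^sup>2)" by simp
  also have "\<dots> = ?r * B" using B by (simp add: real_sqrt_mult)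
  finally show "sobolev_norm s f \<le> ?r * B"
    using s by (simp add: sobolev_norm_def sobolev_weight_fc)
qed

lemma sobolev_diff:
  fixes f g :: "real ^ 'd \<Rightarrow> complex"
  assumes f: "f \<in> sobolev s" and g: "g \<in> sobolev s" and s: "0 < s"
  shows "(\<lambda>x. f x - g x) \<in> sobolev s"
    "sobolev_norm s f \<le> sobolev_norm s g + sobolev_norm s (\<lambda>x. f x - g x)"
proof -
  let ?r = "vol_root CARD('d)" and ?h = "\<lambda>x. f x - g x"
  have r: "0 < ?r" by simp
  have L: "f \<in> torus_L2" "g \<in> torus_L2" "?h \<in> torus_L2"
    using f g by (auto intro: torus_L2_diff sobolev_torus_L2)
  have h: "fc ?h k = fc f k - fc g k" for k
    by (intro fc_diff torus_L2_integrable L)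
  have nf: "dual_norm (hs_dual s) (nm (fc f)) \<le> ennreal (sobolev_norm s f / ?r)"
    and ng: "dual_norm (hs_dual s) (nm (fc g)) \<le> ennreal (sobolev_norm s g / ?r)"
    by (intro sobolev_imp_hs_norm_self f g s)+
  have nn: "0 \<le> sobolev_norm s p / ?r" for p :: "real ^ 'd \<Rightarrow> complex"
    using sobolev_norm_nonneg[of s p] r by simp
  have pw: "nm (fc ?h) k \<le> nm (fc f) k + nm (fc g) k" for k
    unfolding h by (simp add: norm_triangle_ineq4 flip: ennreal_plus)
  have "dual_norm (hs_dual s) (nm (fc ?h)) \<le> dual_norm (hs_dual s) (nm (fc f)) + dual_norm (hs_dual s) (nm (fc g))"
    by (rule order_trans[OF dual_norm_mono dual_norm_add]) (rule pw)
  also have "\<dots> \<le> ennreal (sobolev_norm s f / ?r + sobolev_norm s g / ?r)"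
    unfolding ennreal_plus[OF nn nn] by (intro add_mono nf ng)
  finally have bd: "dual_norm (hs_dual s) (nm (fc ?h)) \<le> ennreal (sobolev_norm s f / ?r + sobolev_norm s g / ?r)" .
  show hs: "?h \<in> sobolev s"
    by (rule hs_norm_imp_sobolev(1)[OF L(3) s bd]) (intro add_nonneg_nonneg nn)
  have nh: "dual_norm (hs_dual s) (nm (fc ?h)) \<le> ennreal (sobolev_norm s ?h / ?r)"
    by (rule sobolev_imp_hs_norm_self[OF hs s])
  have pw': "nm (fc f) k \<le> nm (fc g) k + nm (fc ?h) k" for k
    unfolding h using norm_triangle_sub[of "fc f k" "fc g k"] by (simp flip: ennreal_plus)
  have "dual_norm (hs_dual s) (nm (fc f)) \<le> dual_norm (hs_dual s) (nm (fc g)) + dual_norm (hs_dual s) (nm (fc ?h))"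
    by (rule order_trans[OF dual_norm_mono dual_norm_add]) (rule pw')
  also have "\<dots> \<le> ennreal (sobolev_norm s g / ?r + sobolev_norm s ?h / ?r)"
    unfolding ennreal_plus[OF nn nn] by (intro add_mono ng nh)
  finally have "sobolev_norm s f \<le> ?r * (sobolev_norm s g / ?r + sobolev_norm s ?h / ?r)"
    using nn[of g] nn[of ?h] by (intro hs_norm_imp_sobolev(2)[OF L(1) s]) auto
  then show "sobolev_norm s f \<le> sobolev_norm s g + sobolev_norm s ?h"
    using r by (simp add: distrib_left)
qed

lemma sobolev_norm_minus_commute:
  "sobolev_norm s (\<lambda>x. f x - g x) = sobolev_norm s (\<lambda>x. g x - f x)"
proof -
  have "fourier_coeff (\<lambda>x. f x - g x) k = - fourier_coeff (\<lambda>x. g x - f x) k" for k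
    using fc_cmult[of "-1" "\<lambda>x. g x - f x" k] by (simp add: fourier_coeff_fc)
  then show ?thesis by (simp add: sobolev_norm_def L2_norm_torus_def norm_minus_commute)
qed

lemma norm_fc_le_sobolev_norm:
  fixes f :: "real ^ 'd \<Rightarrow> complex"
  assumes f: "f \<in> sobolev s" and s: "0 < s"
  shows "cmod (fc f k) \<le> sobolev_norm s f / vol_root CARD('d)"
proof -
  let ?B = "sobolev_norm s f / vol_root CARD('d)"
  have B: "0 \<le> ?B" by (intro divide_nonneg_nonneg sobolev_norm_nonneg) simp
  have "(\<Sum>j\<in>{k}. (wt s j * cmod (fc f j))\<^sup>2) \<le> ?B\<^sup>2"
    by (intro l2_norm_bound_sum sobolev_imp_hs_norm_self f s B) auto
  then have "wt s k * cmod (fc f k) \<le> ?B"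
    using B power2_le_imp_le[of "wt s k * cmod (fc f k)" ?B] by simp
  then show ?thesis
    using mult_right_mono[OF wt_ge_1[of s k] norm_ge_zero[of "fc f k"]] by simp
qed

lemma sobolev_wiener:
  fixes f :: "real ^ 'd \<Rightarrow> complex"
  assumes f: "f \<in> sobolev s" and s: "real CARD('d) / 2 < s"
  shows "f \<in> wiener"
proof -
  have s0: "0 < s" using s by (smt (verit) of_nat_0_le_iff divide_nonneg_pos)
  obtain c where c: "\<And>a::int ^ 'd \<Rightarrow> ennreal. tot a \<le> ennreal c * dual_norm (hs_dual s) a"
    using tot_le_hs_norm[OF s] by blast
  have "tot (nm (fc f)) \<le> ennreal c * ennreal (sobolev_norm s f / vol_root CARD('d))"
    by (rule order_trans[OF c]) (intro mult_left_mono sobolev_imp_hs_norm_self f s0, simp)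
  also have "\<dots> < \<infinity>" by (simp add: ennreal_mult_less_top)
  finally show ?thesis using f by (simp add: wiener_def sobolev_torus_L2)
qed

lemma l2_norm_imp_L2_norm_le:
  fixes f :: "real ^ 'd \<Rightarrow> complex"
  assumes f: "f \<in> wiener" and B: "dual_norm (l2_dual (\<lambda>_. 1)) (nm (fc f)) \<le> ennreal B" "0 \<le> B"
  shows "L2_norm_torus f \<le> vol_root CARD('d) * B"
proof -
  let ?g = "\<lambda>k. (cmod (fc f k))\<^sup>2"
  have "ennreal (\<integral>k. ?g k \<partial>count_space UNIV) = tot (\<lambda>k. ennreal (?g k))"
    by (rule nn_integral_eq_integral[symmetric, OF wiener_L2_norm(2)[OF f]]) auto
  also have "\<dots> \<le> ennreal (B\<^sup>2)"
  proof (rule tot_le_freq_box)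
    fix R
    show "(\<Sum>k\<in>freq_box R. ?g k) \<le> B\<^sup>2"
      using l2_norm_bound_sum[of "\<lambda>_. 1" "\<lambda>k. cmod (fc f k)" B "freq_box R"] B
        finite_freq_box[of R, where 'd='d] by simp
  qed simp
  finally have "(\<integral>k. ?g k \<partial>count_space UNIV) \<le> B\<^sup>2" by simp
  then have "sqrt ((vol_root CARD('d))\<^sup>2 * (\<integral>k. ?g k \<partial>count_space UNIV)) \<le> sqrt ((vol_root CARD('d))\<^sup>2 * B\<^sup>2)"
    by (intro real_sqrt_le_mono mult_left_mono) auto
  then show ?thesis unfolding wiener_L2_norm(1)[OF f] vol_root_sq using B by (simp add: real_sqrt_mult)
qed

section \<open>The scheme and the mild solution in terms of coefficients\<close>

lemma wiener_op_exp:
  assumes f: "f \<in> wiener"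
  shows "op_iLap exp \<xi> f \<in> wiener" "fc (op_iLap exp \<xi> f) = (\<lambda>k. cis (- (\<xi> * sq_freq k)) * fc f k)"
proof -
  have m: "exp (- \<i> * of_real (\<xi> * (norm (freq k))\<^sup>2)) = cis (- (\<xi> * sq_freq k))" for k
    by (simp add: cis_conv_exp sq_freq_def)
  note * = wiener_multiplier[OF f, of "\<lambda>k. cis (- (\<xi> * sq_freq k))"]
  show "op_iLap exp \<xi> f \<in> wiener" "fc (op_iLap exp \<xi> f) = (\<lambda>k. cis (- (\<xi> * sq_freq k)) * fc f k)"
    unfolding op_iLap_def m using * by simp_all
qed

lemma wiener_op_phi1:
  assumes f: "f \<in> wiener"
  shows "op_iLap phi1 (- \<xi>) f \<in> wiener" "fc (op_iLap phi1 (- \<xi>) f) = (\<lambda>k. phi1 (\<i> * of_real (\<xi> * sq_freq k)) * fc f k)"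
proof -
  have m: "phi1 (- \<i> * of_real (- \<xi> * (norm (freq k))\<^sup>2)) = phi1 (\<i> * of_real (\<xi> * sq_freq k))" for k
    by (simp add: sq_freq_def)
  note * = wiener_multiplier[OF f, of "\<lambda>k. phi1 (\<i> * of_real (\<xi> * sq_freq k))", OF norm_phi1_le]
  show "op_iLap phi1 (- \<xi>) f \<in> wiener" "fc (op_iLap phi1 (- \<xi>) f) = (\<lambda>k. phi1 (\<i> * of_real (\<xi> * sq_freq k)) * fc f k)"
    unfolding op_iLap_def m using * by simp_all
qed

lemma wiener_nonlinearity:
  assumes V: "V \<in> wiener" and f: "f \<in> wiener"
  shows "(\<lambda>x. V x * f x + (f x)\<^sup>2 * cnj (f x)) \<in> wiener"
    "fc (\<lambda>x. V x * f x + (f x)\<^sup>2 * cnj (f x)) = gp_rhs (fc V) (fc f)"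
proof -
  have eq: "(\<lambda>x. V x * f x + (f x)\<^sup>2 * cnj (f x)) = (\<lambda>x. f x * V x + f x * f x * cnj (f x))"
    by (simp add: power2_eq_square mult.commute)
  note ff = wiener_mult[OF f f]
  note c = wiener_cnj[OF f]
  note fff = wiener_mult[OF ff(1) c(1)]
  note fV = wiener_mult[OF f V]
  note s = wiener_add[OF fV(1) fff(1)]
  show "(\<lambda>x. V x * f x + (f x)\<^sup>2 * cnj (f x)) \<in> wiener" unfolding eq by (rule s(1))
  show "fc (\<lambda>x. V x * f x + (f x)\<^sup>2 * cnj (f x)) = gp_rhs (fc V) (fc f)"
    unfolding eq s(2) fV(2) fff(2) ff(2) c(2) by (simp add: gp_rhs_def[abs_def] cubic_def)
qed

lemma wiener_scheme:
  assumes V: "V \<in> wiener" and u0: "u0 \<in> wiener"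
  shows "GP_scheme V u0 \<tau> n \<in> wiener"
    and "fc (GP_scheme V u0 \<tau> (Suc n)) = gp_step (fc V) \<tau> (fc (GP_scheme V u0 \<tau> n))"
proof -
  have *: "F \<in> wiener \<and> fc F = gp_step (fc V) \<tau> (fc w)"
    if w: "w \<in> wiener" and F: "F = op_iLap exp \<tau> (\<lambda>x. w x - \<i> * of_real \<tau> *
           (w x * op_iLap phi1 (- \<tau>) V x + (w x)\<^sup>2 * op_iLap phi1 (- 2 * \<tau>) (\<lambda>y. cnj (w y)) x))" for w F
  proof -
    note pV = wiener_op_phi1[OF V, of \<tau>]
    note c = wiener_cnj[OF w]
    note pc = wiener_op_phi1[OF c(1), of "2 * \<tau>"]
    note ww = wiener_mult[OF w w]
    note 1 = wiener_mult[OF w pV(1)]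
    note 2 = wiener_mult[OF ww(1) pc(1)]
    note 3 = wiener_add[OF 1(1) 2(1)]
    note 4 = wiener_cmult[OF 3(1), of "- (\<i> * of_real \<tau>)"]
    note 5 = wiener_add[OF w 4(1)]
    note 6 = wiener_op_exp[OF 5(1), of \<tau>]
    have F': "F = op_iLap exp \<tau> (\<lambda>x. w x + - (\<i> * of_real \<tau>) * (w x * op_iLap phi1 (- \<tau>) V x
        + w x * w x * op_iLap phi1 (- (2 * \<tau>)) (\<lambda>x. cnj (w x)) x))"
      by (simp add: F power2_eq_square)
    have "fc F = gp_step (fc V) \<tau> (fc w)"
      unfolding F' 6(2) 5(2) 4(2) 3(2) 2(2) 1(2) ww(2) pc(2) c(2) pV(2)
      by (simp add: gp_step_def[abs_def] cubic_def mult_ac)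
    then show ?thesis using 6(1) unfolding F' by simp
  qed
  show w: "GP_scheme V u0 \<tau> n \<in> wiener" for n
  proof (induction n)
    case (Suc n)
    then show ?case using *[OF Suc refl] by (simp add: Let_def)
  qed (simp add: u0)
  show "fc (GP_scheme V u0 \<tau> (Suc n)) = gp_step (fc V) \<tau> (fc (GP_scheme V u0 \<tau> n))"
    using *[OF w refl] by (simp add: Let_def)
qed

text \<open>
  Coefficients are continuous functionals on \<open>L\<^sup>2\<close>, so they map Riemann sums that converge in \<open>L\<^sup>2\<close> to
  convergent Riemann sums.
\<close>

lemma fc_L2_integral:
  fixes F :: "real \<Rightarrow> real ^ 'd \<Rightarrow> complex"
  assumes "has_L2_integral F I a b"
  shows "((\<lambda>\<zeta>. fc (F \<zeta>) k) has_integral fc I k) {a..b}"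
  unfolding has_integral_real
proof (intro allI impI)
  let ?r = "vol_root CARD('d)"
  fix e :: real assume e: "0 < e"
  have r: "0 < ?r" by simp
  have I: "I \<in> torus_L2" and F: "\<And>\<zeta>. \<zeta> \<in> {a..b} \<Longrightarrow> F \<zeta> \<in> torus_L2"
    using assms by (auto simp: has_L2_integral_def)
  have pos: "0 < e * ?r" using e r by simp
  define close where "close \<D> \<longleftrightarrow> L2_norm_torus (\<lambda>x. (\<Sum>(\<zeta>, K)\<in>\<D>. measure lborel K *\<^sub>R F \<zeta> x) - I x) < e * ?r"
    for \<D> :: "(real \<times> real set) set"
  have "\<exists>\<gamma>. gauge \<gamma> \<and> (\<forall>\<D>. \<D> tagged_division_of {a..b} \<and> \<gamma> fine \<D> \<longrightarrow> close \<D>)"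
    unfolding close_def
    by (rule assms[unfolded has_L2_integral_def, THEN conjunct2, THEN conjunct2, rule_format, OF pos])
  then obtain \<gamma> where \<gamma>: "gauge \<gamma>" and fine: "\<forall>\<D>. \<D> tagged_division_of {a..b} \<and> \<gamma> fine \<D> \<longrightarrow> close \<D>"
    by (elim exE conjE)
  show "\<exists>\<gamma>. gauge \<gamma> \<and> (\<forall>\<D>. \<D> tagged_division_of {a..b} \<and> \<gamma> fine \<D> \<longrightarrow>
        norm ((\<Sum>(x, K)\<in>\<D>. measure lborel K *\<^sub>R fc (F x) k) - fc I k) < e)"
  proof (intro exI[of _ \<gamma>] conjI \<gamma> allI impI)
    fix \<D> assume D: "\<D> tagged_division_of {a..b} \<and> \<gamma> fine \<D>"
    let ?G = "\<lambda>p x. of_real (measure lborel (snd p)) * F (fst p) x :: complex"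
    have fin: "finite \<D>" using D by (blast dest: tagged_division_ofD(1))
    have G: "?G p \<in> torus_L2" if "p \<in> \<D>" for p
    proof -
      have "fst p \<in> {a..b}" using that D by (metis prod.collapse tagged_division_ofD(2,3) subsetD)
      then show ?thesis by (intro torus_L2_cmult F)
    qed
    let ?S = "\<lambda>x. \<Sum>p\<in>\<D>. ?G p x"
    have S: "?S \<in> torus_L2" by (rule torus_L2_sum[OF fin G])
    have S_eq: "?S x = (\<Sum>(\<zeta>, K)\<in>\<D>. measure lborel K *\<^sub>R F \<zeta> x)" for x
      by (simp add: case_prod_unfold scaleR_conv_of_real)
    have "fc (\<lambda>x. ?S x - I x) k = fc ?S k - fc I k"
      by (intro fc_diff torus_L2_integrable S I)
    also have "fc ?S k = (\<Sum>p\<in>\<D>. fc (?G p) k)"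
      by (rule fc_sum[OF fin]) (intro torus_L2_integrable G)
    also have "\<dots> = (\<Sum>(x, K)\<in>\<D>. measure lborel K *\<^sub>R fc (F x) k)"
      by (simp add: fc_cmult case_prod_unfold scaleR_conv_of_real)
    finally have eq: "fc (\<lambda>x. ?S x - I x) k = (\<Sum>(x, K)\<in>\<D>. measure lborel K *\<^sub>R fc (F x) k) - fc I k" .
    have "cmod (fc (\<lambda>x. ?S x - I x) k) \<le> L2_norm_torus (\<lambda>x. ?S x - I x) / ?r"
      unfolding vol_root_def by (rule norm_fc_le) (intro torus_L2_diff S I)
    also have "\<dots> < e * ?r / ?r"
      using fine[rule_format, OF D] r unfolding S_eq close_def by (intro divide_strict_right_mono)
    also have "\<dots> = e" using r by simp
    finally show "norm ((\<Sum>(x, K)\<in>\<D>. measure lborel K *\<^sub>R fc (F x) k) - fc I k) < e"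
      unfolding eq .
  qed
qed

lemma integral_seg_eq:
  fixes f :: "real \<Rightarrow> complex"
  assumes "integrable (seg a b) f"
  shows "(\<integral>s. f s \<partial>seg a b) = integral {a..b} f" "f integrable_on {a..b}"
proof -
  have "set_integrable lborel {a..b} f"
    using assms by (simp add: set_integrable_def integrable_restrict_space)
  from set_borel_integral_eq_integral[OF this]
  show "(\<integral>s. f s \<partial>seg a b) = integral {a..b} f" "f integrable_on {a..b}"
    by (simp_all add: set_lebesgue_integral_def integral_restrict_space)
qed

text \<open>
  The coefficients of the solution, extended constantly beyond \<open>[0, T]\<close>, so that they are bounded and
  measurable on the whole line.
\<close>

definition clamped_coeffs :: "real \<Rightarrow> (real \<Rightarrow> real ^ 'd \<Rightarrow> complex) \<Rightarrow> real \<Rightarrow> int ^ 'd \<Rightarrow> complex" where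
  "clamped_coeffs T u s = fc (u (max 0 (min T s)))"

lemma clamped_coeffs_eq: "0 \<le> t \<Longrightarrow> t \<le> T \<Longrightarrow> clamped_coeffs T u t = fc (u t)"
  by (simp add: clamped_coeffs_def max_def min_def)

lemma clamped_in: "0 \<le> T \<Longrightarrow> max 0 (min T s) \<in> {0..T}" for s T :: real
  by auto

lemma clamped_coeffs_measurable:
  fixes u :: "real \<Rightarrow> real ^ 'd \<Rightarrow> complex"
  assumes u: "continuous_in_sobolev s {0..T} u" and s: "0 < s" and T: "0 \<le> T"
  shows "(\<lambda>t. clamped_coeffs T u t k) \<in> borel_measurable borel"
proof (rule borel_measurable_continuous_onI)
  let ?r = "vol_root CARD('d)"
  have "continuous_on {0..T} (\<lambda>t. fc (u t) k)"
    unfolding continuous_on_def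
  proof
    fix t assume t: "t \<in> {0..T}"
    have lim: "((\<lambda>t'. sobolev_norm s (\<lambda>x. u t' x - u t x)) \<longlongrightarrow> 0) (at t within {0..T})"
      using u t by (simp add: continuous_in_sobolev_def)
    have S: "u t' \<in> sobolev s" if "t' \<in> {0..T}" for t'
      using u that by (simp add: continuous_in_sobolev_def)
    have "((\<lambda>t'. fc (u t') k - fc (u t) k) \<longlongrightarrow> 0) (at t within {0..T})"
    proof (rule Lim_null_comparison)
      have "((\<lambda>t'. sobolev_norm s (\<lambda>x. u t' x - u t x) / ?r) \<longlongrightarrow> 0 / ?r) (at t within {0..T})"
        by (intro tendsto_divide lim tendsto_const) simp
      then show "((\<lambda>t'. sobolev_norm s (\<lambda>x. u t' x - u t x) / ?r) \<longlongrightarrow> 0) (at t within {0..T})" by simp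
      show "\<forall>\<^sub>F t' in at t within {0..T}. norm (fc (u t') k - fc (u t) k) \<le> sobolev_norm s (\<lambda>x. u t' x - u t x) / ?r"
        unfolding eventually_at_filter
      proof (intro always_eventually allI impI)
        fix t' assume t': "t' \<noteq> t" "t' \<in> {0..T}"
        have "fc (\<lambda>x. u t' x - u t x) k = fc (u t') k - fc (u t) k"
          by (intro fc_diff torus_L2_integrable sobolev_torus_L2[OF S] t t')
        then show "norm (fc (u t') k - fc (u t) k) \<le> sobolev_norm s (\<lambda>x. u t' x - u t x) / ?r"
          using norm_fc_le_sobolev_norm[OF sobolev_diff(1)[OF S[OF t'(2)] S[OF t] s] s, of k] by simp
      qed
    qed
    then show "((\<lambda>t. fc (u t) k) \<longlongrightarrow> fc (u t) k) (at t within {0..T})"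
      by (simp add: LIM_zero_iff)
  qed
  then show "continuous_on UNIV (\<lambda>t. clamped_coeffs T u t k)"
    unfolding clamped_coeffs_def
    by (rule continuous_on_compose2) (use T in \<open>auto intro!: continuous_intros\<close>)
qed

lemma sobolev_norm_bounded:
  fixes u :: "real \<Rightarrow> real ^ 'd \<Rightarrow> complex"
  assumes u: "continuous_in_sobolev s {0..T} u" and s: "0 < s" and T: "0 \<le> T"
  obtains B where "\<And>t. t \<in> {0..T} \<Longrightarrow> sobolev_norm s (u t) \<le> B"
proof -
  have S: "u t \<in> sobolev s" if "t \<in> {0..T}" for t
    using u that by (simp add: continuous_in_sobolev_def)
  have "continuous_on {0..T} (\<lambda>t. sobolev_norm s (u t))"
    unfolding continuous_on_def
  proof
    fix t assume t: "t \<in> {0..T}"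
    have "((\<lambda>t'. sobolev_norm s (u t') - sobolev_norm s (u t)) \<longlongrightarrow> 0) (at t within {0..T})"
    proof (rule Lim_null_comparison)
      show "((\<lambda>t'. sobolev_norm s (\<lambda>x. u t' x - u t x)) \<longlongrightarrow> 0) (at t within {0..T})"
        using u t by (simp add: continuous_in_sobolev_def)
      show "\<forall>\<^sub>F t' in at t within {0..T}. norm (sobolev_norm s (u t') - sobolev_norm s (u t)) \<le> sobolev_norm s (\<lambda>x. u t' x - u t x)"
        unfolding eventually_at_filter
      proof (intro always_eventually allI impI)
        fix t' assume t': "t' \<noteq> t" "t' \<in> {0..T}"
        show "norm (sobolev_norm s (u t') - sobolev_norm s (u t)) \<le> sobolev_norm s (\<lambda>x. u t' x - u t x)"
          using sobolev_diff(2)[OF S[OF t'(2)] S[OF t] s] sobolev_diff(2)[OF S[OF t] S[OF t'(2)] s]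
          by (simp add: sobolev_norm_minus_commute[of s "u t" "u t'"] abs_le_iff)
      qed
    qed
    then show "((\<lambda>t. sobolev_norm s (u t)) \<longlongrightarrow> sobolev_norm s (u t)) (at t within {0..T})"
      by (simp add: LIM_zero_iff)
  qed
  then have "bounded ((\<lambda>t. sobolev_norm s (u t)) ` {0..T})"
    by (intro compact_imp_bounded compact_continuous_image) auto
  then obtain B where "\<forall>x\<in>(\<lambda>t. sobolev_norm s (u t)) ` {0..T}. norm x \<le> B"
    unfolding bounded_iff by blast
  then have "sobolev_norm s (u t) \<le> B" if "t \<in> {0..T}" for t
    using that by (force simp: abs_le_iff)
  then show ?thesis by (rule that)
qed

text \<open>
  Multiplied by \<open>cis (t * sq_freq k)\<close>, Duhamel's formula has an integrand that does not depend on \<open>t\<close>;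
  the formula between two times is the difference of two formulas that start at \<open>0\<close>.
\<close>

lemma mild_solution_coeffs:
  fixes u :: "real \<Rightarrow> real ^ 'd \<Rightarrow> complex"
  assumes mild: "mild_solution_GP V u0 T u" and T: "0 \<le> T"
    and V: "V \<in> wiener" and u0: "u0 \<in> wiener" and u: "\<And>t. t \<in> {0..T} \<Longrightarrow> u t \<in> wiener"
    and meas: "\<And>k. (\<lambda>t. clamped_coeffs T u t k) \<in> borel_measurable borel"
    and B: "B < \<infinity>" "\<And>t. t \<in> {0..T} \<Longrightarrow> tot (nm (fc (u t))) \<le> B"
  shows "gp_duhamel (fc V) (clamped_coeffs T u) T" "clamped_coeffs T u 0 = fc u0"
proof -
  let ?U = "clamped_coeffs T u"
  let ?R = "\<lambda>k s. cis (s * sq_freq k) * gp_rhs (fc V) (?U s) k"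
  define B' where "B' = B + tot (nm (fc V))"
  have B': "B' < \<infinity>" "tot (nm (fc V)) \<le> B'" "tot (nm (?U s)) \<le> B'" for s
  proof -
    show "B' < \<infinity>" using B(1) V by (simp add: B'_def wiener_def)
    show "tot (nm (fc V)) \<le> B'" by (simp add: B'_def)
    show "tot (nm (?U s)) \<le> B'"
      unfolding clamped_coeffs_def B'_def by (rule add_increasing2[OF zero_le B(2)[OF clamped_in[OF T]]])
  qed
  note int = integrable_twisted_rhs[OF meas B']
  have int0: "integrable (seg a b) (?R k)" for a b k
    using int[where t=0] by simp
  have base: "cis (t * sq_freq k) * ?U t k = fc u0 k - \<i> * (\<integral>s. ?R k s \<partial>seg 0 t)" if t: "t \<in> {0..T}" for t k
  proof -
    let ?F = "\<lambda>\<zeta>. op_iLap exp (t - \<zeta>) (\<lambda>x. V x * u \<zeta> x + (u \<zeta> x)\<^sup>2 * cnj (u \<zeta> x))"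
    obtain I where I: "has_L2_integral ?F I 0 t"
      and AE: "AE x in torus_measure. u t x = op_iLap exp t u0 x - \<i> * I x"
      using mild t unfolding mild_solution_GP_def by blast
    have IL: "I \<in> torus_L2" using I by (simp add: has_L2_integral_def)
    note e0 = wiener_op_exp[OF u0, of t]
    have eL: "op_iLap exp t u0 \<in> torus_L2" using e0(1) by (simp add: wiener_def)
    have fF: "fc (?F \<zeta>) k = cis ((\<zeta> - t) * sq_freq k) * gp_rhs (fc V) (?U \<zeta>) k" if "\<zeta> \<in> {0..t}" for \<zeta>
    proof -
      have z: "\<zeta> \<in> {0..T}" using that t by auto
      note nl = wiener_nonlinearity[OF V u[OF z]]
      have "?U \<zeta> = fc (u \<zeta>)" using z by (intro clamped_coeffs_eq) auto
      then show ?thesis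
        unfolding wiener_op_exp(2)[OF nl(1)] nl(2) by (simp add: algebra_simps)
    qed
    have "fc I k = integral {0..t} (\<lambda>\<zeta>. fc (?F \<zeta>) k)"
      by (rule integral_unique[OF fc_L2_integral[OF I, of k], symmetric])
    also have "\<dots> = integral {0..t} (\<lambda>\<zeta>. cis ((\<zeta> - t) * sq_freq k) * gp_rhs (fc V) (?U \<zeta>) k)"
      by (rule Henstock_Kurzweil_Integration.integral_cong) (rule fF)
    also have "\<dots> = (\<integral>s. cis ((s - t) * sq_freq k) * gp_rhs (fc V) (?U s) k \<partial>seg 0 t)"
      by (rule integral_seg_eq(1)[OF int, symmetric])
    finally have I_eq: "fc I k = (\<integral>s. cis ((s - t) * sq_freq k) * gp_rhs (fc V) (?U s) k \<partial>seg 0 t)" .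
    have "cis (t * sq_freq k) * fc I k = (\<integral>s. cis (t * sq_freq k) * (cis ((s - t) * sq_freq k) * gp_rhs (fc V) (?U s) k) \<partial>seg 0 t)"
      unfolding I_eq by simp
    also have "\<dots> = (\<integral>s. ?R k s \<partial>seg 0 t)"
      by (intro Bochner_Integration.integral_cong refl) (simp add: mult.assoc[symmetric] cis_mult left_diff_distrib)
    finally have cI: "cis (t * sq_freq k) * fc I k = (\<integral>s. ?R k s \<partial>seg 0 t)" .
    have "fc (u t) k = fc (\<lambda>x. op_iLap exp t u0 x - \<i> * I x) k"
      using u[OF t] torus_L2_diff[OF eL torus_L2_cmult[OF IL, of \<i>]]
      by (intro fc_cong_AE[OF AE] torus_L2_measurable) (auto simp: wiener_def)
    also have "\<dots> = fc (op_iLap exp t u0) k - fc (\<lambda>x. \<i> * I x) k"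
      by (intro fc_diff torus_L2_integrable eL torus_L2_cmult IL)
    also have "\<dots> = cis (- (t * sq_freq k)) * fc u0 k - \<i> * fc I k"
      by (simp add: e0(2) fc_cmult)
    finally have "cis (t * sq_freq k) * fc (u t) k = cis (t * sq_freq k) * cis (- (t * sq_freq k)) * fc u0 k - \<i> * (cis (t * sq_freq k) * fc I k)"
      by (simp add: right_diff_distrib)
    then show ?thesis
      unfolding cI using t by (simp add: cis_mult clamped_coeffs_eq)
  qed
  have "?U 0 k = fc u0 k" for k
  proof -
    have "integral {0..0} (?R k) = 0" by simp
    then have "(\<integral>s. ?R k s \<partial>seg 0 0) = 0" using integral_seg_eq(1)[OF int0, of 0 0 k] by simp
    then show ?thesis using base[of 0 k] T by simp
  qed
  then show "?U 0 = fc u0" by auto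
  show "gp_duhamel (fc V) ?U T"
  proof
    show "(\<lambda>s. ?U s k) \<in> borel_measurable borel" for k by (rule meas)
    fix t t' k assume t: "0 \<le> t" "t \<le> t'" "t' \<le> T"
    have split: "(\<integral>s. ?R k s \<partial>seg 0 t) + (\<integral>s. ?R k s \<partial>seg t t') = (\<integral>s. ?R k s \<partial>seg 0 t')"
      unfolding integral_seg_eq(1)[OF int0]
      by (rule Henstock_Kurzweil_Integration.integral_combine[OF t(1,2) integral_seg_eq(2)[OF int0]])
    have tt: "t \<in> {0..T}" "t' \<in> {0..T}" using t by auto
    show "cis (t' * sq_freq k) * ?U t' k - cis (t * sq_freq k) * ?U t k
        = - \<i> * (\<integral>s. cis (s * sq_freq k) * gp_rhs (fc V) (?U s) k \<partial>seg t t')"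
      unfolding base[OF tt(1)] base[OF tt(2)] split[symmetric] by (simp add: distrib_left)
  qed
qed

section \<open>Convergence of the scheme\<close>

theorem theorem1p1:
  fixes u0 V :: "real ^ 'd \<Rightarrow> complex"
    and u :: "real \<Rightarrow> real ^ 'd \<Rightarrow> complex"
    and T r \<epsilon> r1 :: real
  assumes "CARD('d) \<in> {1, 2, 3}"
    and "T > 0" and "r \<ge> 0" and "0 < \<epsilon>" and "\<epsilon> < 1 / 4"
    and "r1 = data_regularity CARD('d) \<epsilon> r"
    and "u0 \<in> sobolev r1" and "V \<in> sobolev r1"
    and "continuous_in_sobolev r1 {0..T} u"
    and "mild_solution_GP V u0 T u"
  shows "\<exists>\<tau>min>0. \<exists>C>0. \<forall>\<tau>. 0 < \<tau> \<and> \<tau> \<le> \<tau>min \<longrightarrow>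
    (\<forall>n. real n * \<tau> \<le> T \<longrightarrow>
       (\<lambda>x. GP_scheme V u0 \<tau> n x - u (real n * \<tau>) x) \<in> sobolev r \<and>
       sobolev_norm r (\<lambda>x. GP_scheme V u0 \<tau> n x - u (real n * \<tau>) x) \<le> C * \<tau>)"
proof -
  note d = assms(1) and T = assms(2) and r0 = assms(3) and eps = assms(4) and r1 = assms(6)
    and u0 = assms(7) and V = assms(8) and u = assms(9) and mild = assms(10)
  let ?r = "vol_root CARD('d)" and ?U = "clamped_coeffs T u"
  have T0: "0 \<le> T" using T by simp
  have d4: "CARD('d) < 4" using d by auto
  have r1_gt: "real CARD('d) / 2 < r1"
    using d eps by (auto simp: r1 data_regularity_def)
  then have r1_pos: "0 < r1" by (smt (verit) of_nat_0_le_iff divide_nonneg_pos)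
  have u_sob: "u t \<in> sobolev r1" if "t \<in> {0..T}" for t
    using u that by (simp add: continuous_in_sobolev_def)
  have W: "V \<in> wiener" "u0 \<in> wiener" "\<And>t. t \<in> {0..T} \<Longrightarrow> u t \<in> wiener"
    by (intro sobolev_wiener[OF _ r1_gt] V u0 u_sob; assumption)+
  obtain B0 where B0: "\<And>t. t \<in> {0..T} \<Longrightarrow> sobolev_norm r1 (u t) \<le> B0"
    by (rule sobolev_norm_bounded[OF u r1_pos T0]) blast
  define B where "B = max B0 (sobolev_norm r1 V) / ?r"
  have le_B: "sobolev_norm r1 V \<le> ?r * B" "\<And>t. t \<in> {0..T} \<Longrightarrow> sobolev_norm r1 (u t) \<le> ?r * B"
    by (simp_all add: B_def max.coboundedI1 B0)
  have "0 \<le> ?r * B" using le_B(1) sobolev_norm_nonneg[of r1 V] by linarith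
  then have B: "0 \<le> B" by (simp add: B_def zero_le_divide_iff)
  note V_sq = sobolev_imp_hs_norm(1)[OF V r1_pos le_B(1)] and V_le = sobolev_imp_hs_norm(2)[OF V r1_pos le_B(1)]
  have U_sq: "tot (\<lambda>k. (ennreal (wt r1 k) * nm (?U t) k)\<^sup>2) \<le> (ennreal B)\<^sup>2"
    and U_le: "dual_norm (hs_dual r1) (nm (?U t)) \<le> ennreal B" for t
    unfolding clamped_coeffs_def
    by (intro sobolev_imp_hs_norm u_sob r1_pos le_B clamped_in T0)+
  obtain c where c: "\<And>a::int ^ 'd \<Rightarrow> ennreal. tot a \<le> ennreal c * dual_norm (hs_dual r1) a"
    using tot_le_hs_norm[OF r1_gt] by blast
  have tot_U: "tot (nm (fc (u t))) \<le> ennreal c * ennreal B" if "t \<in> {0..T}" for t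
  proof (rule order_trans[OF c], rule mult_left_mono)
    show "dual_norm (hs_dual r1) (nm (fc (u t))) \<le> ennreal B"
      using U_le[of t] that by (simp add: clamped_coeffs_eq)
  qed simp
  have "ennreal c * ennreal B < \<infinity>" by (simp add: ennreal_mult_less_top)
  note coeffs = mild_solution_coeffs[OF mild T0 W(1,2,3) clamped_coeffs_measurable[OF u r1_pos T0] this tot_U]
  interpret gp_duhamel "fc V" ?U T by (rule coeffs(1))
  let ?w = "\<lambda>\<tau> n. fc (GP_scheme V u0 \<tau> n)"
  have w: "?w \<tau> 0 = ?U 0" "?w \<tau> (Suc n) = gp_step (fc V) \<tau> (?w \<tau> n)" for \<tau> n
    using coeffs(2) by (simp, intro wiener_scheme(2)[OF W(1,2)])
  let ?e = "\<lambda>\<tau> n x. GP_scheme V u0 \<tau> n x - u (real n * \<tau>) x"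
  have e_wiener: "?e \<tau> n \<in> wiener" and e_fc: "nm (fc (?e \<tau> n)) = nm (\<lambda>k. ?U (real n * \<tau>) k - ?w \<tau> n k)"
    if "0 < \<tau>" "real n * \<tau> \<le> T" for \<tau> n
  proof -
    have t: "real n * \<tau> \<in> {0..T}" using that by simp
    have eq: "?e \<tau> n = (\<lambda>x. GP_scheme V u0 \<tau> n x + (- 1) * u (real n * \<tau>) x)" by simp
    note m = wiener_cmult[OF W(3)[OF t], of "- 1"]
    note a = wiener_add[OF wiener_scheme(1)[OF W(1,2)] m(1), of \<tau> n]
    show "?e \<tau> n \<in> wiener" unfolding eq by (rule a(1))
    show "nm (fc (?e \<tau> n)) = nm (\<lambda>k. ?U (real n * \<tau>) k - ?w \<tau> n k)"
      unfolding eq a(2) m(2) using t by (simp add: clamped_coeffs_eq norm_minus_commute)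
  qed
  \<comment> \<open>\<open>G\<close> may be zero; the constant in the theorem must be positive\<close>
  have "\<exists>G\<ge>0. \<exists>\<tau>0>0. \<forall>\<tau> n. 0 < \<tau> \<and> \<tau> \<le> \<tau>0 \<and> real n * \<tau> \<le> T \<longrightarrow>
      ?e \<tau> n \<in> sobolev r \<and> sobolev_norm r (?e \<tau> n) \<le> ?r * (G * \<tau>)"
  proof (cases "r = 0")
    case True
    have r1': "r1 = 1 + real CARD('d) / 4" using True d by (auto simp: r1 data_regularity_def)
    from l2_convergence[OF d4 T0 B V_sq[unfolded r1'] U_sq[unfolded r1']] obtain G \<tau>0 where G: "0 \<le> G" "0 < \<tau>0"
      and conv: "\<forall>\<tau> w. 0 < \<tau> \<and> \<tau> \<le> \<tau>0 \<and> scheme_run \<tau> w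
       \<longrightarrow> (\<forall>n. real n * \<tau> \<le> T \<longrightarrow> dual_norm (l2_dual (\<lambda>_. 1)) (err \<tau> w n) \<le> ennreal (G * \<tau>))"
      by (elim exE conjE)
    show ?thesis
    proof (rule exI[of _ G], rule conjI[OF G(1)], rule exI[of _ \<tau>0], rule conjI[OF G(2)], intro allI impI)
      fix \<tau> n assume *: "0 < \<tau> \<and> \<tau> \<le> \<tau>0 \<and> real n * \<tau> \<le> T"
      then have e: "?e \<tau> n \<in> wiener" by (intro e_wiener) auto
      have "dual_norm (l2_dual (\<lambda>_. 1)) (nm (fc (?e \<tau> n))) \<le> ennreal (G * \<tau>)"
        using conv[rule_format, of \<tau> "?w \<tau>" n] * w by (simp add: e_fc)
      then have "L2_norm_torus (?e \<tau> n) \<le> ?r * (G * \<tau>)"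
        using * G by (intro l2_norm_imp_L2_norm_le e) auto
      then show "?e \<tau> n \<in> sobolev r \<and> sobolev_norm r (?e \<tau> n) \<le> ?r * (G * \<tau>)"
        using e True by (simp add: sobolev_def sobolev_norm_def wiener_def)
    qed
  next
    case False
    then have r: "0 < r" using r0 by simp
    \<comment> \<open>The error is estimated in \<open>H\<^sup>s\<close>, which for \<open>r \<le> d/2\<close> is stronger than \<open>H\<^sup>r\<close>.\<close>
    define s where "s = r1 - 1"
    have s: "real CARD('d) / 2 < s" "r \<le> s" "r1 = s + 1"
      using r eps by (auto simp: s_def r1 data_regularity_def)
    have "ennreal B < \<infinity>" by simp
    from sobolev_convergence[OF s(1) T0 this V_le[unfolded s(3)] U_le[unfolded s(3)]] obtain G \<tau>0 where G: "0 \<le> G" "0 < \<tau>0"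
      and conv: "\<forall>\<tau> w n. 0 < \<tau> \<and> \<tau> \<le> \<tau>0 \<and> scheme_run \<tau> w \<and> real n * \<tau> \<le> T
       \<longrightarrow> dual_norm (hs_dual s) (err \<tau> w n) \<le> ennreal (G * \<tau>)"
      by (elim exE conjE)
    have G2: "0 \<le> sqrt 2 * G" using G by simp
    show ?thesis
    proof (rule exI[of _ "sqrt 2 * G"], rule conjI[OF G2], rule exI[of _ \<tau>0], rule conjI[OF G(2)], intro allI impI)
      fix \<tau> n assume *: "0 < \<tau> \<and> \<tau> \<le> \<tau>0 \<and> real n * \<tau> \<le> T"
      then have e: "?e \<tau> n \<in> torus_L2" using e_wiener[of \<tau> n] by (simp add: wiener_def)
      have "dual_norm (hs_dual r) (nm (fc (?e \<tau> n))) \<le> ennreal (sqrt 2) * dual_norm (hs_dual s) (nm (fc (?e \<tau> n)))"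
        by (rule wt_norm_mono[OF r s(2)])
      also have "\<dots> \<le> ennreal (sqrt 2) * ennreal (G * \<tau>)"
        using conv[rule_format, of \<tau> "?w \<tau>" n] * w by (intro mult_left_mono) (simp_all add: e_fc)
      also have "\<dots> = ennreal (sqrt 2 * G * \<tau>)"
        using * G by (simp add: mult.assoc flip: ennreal_mult)
      finally have "dual_norm (hs_dual r) (nm (fc (?e \<tau> n))) \<le> ennreal (sqrt 2 * G * \<tau>)" .
      from hs_norm_imp_sobolev[OF e r this] * G
      show "?e \<tau> n \<in> sobolev r \<and> sobolev_norm r (?e \<tau> n) \<le> ?r * (sqrt 2 * G * \<tau>)"
        by simp
    qed
  qed
  then obtain G \<tau>0 where G: "0 \<le> G" "0 < \<tau>0" and conv: "\<forall>\<tau> n. 0 < \<tau> \<and> \<tau> \<le> \<tau>0 \<and> real n * \<tau> \<le> T \<longrightarrow>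
      ?e \<tau> n \<in> sobolev r \<and> sobolev_norm r (?e \<tau> n) \<le> ?r * (G * \<tau>)"
    by (elim exE conjE)
  have C: "0 < ?r * G + 1" using G by (simp add: add_nonneg_pos)
  show ?thesis
  proof (rule exI[of _ \<tau>0], rule conjI[OF G(2)], rule exI[of _ "?r * G + 1"], rule conjI[OF C], intro allI impI)
    fix \<tau> n assume \<tau>: "0 < \<tau> \<and> \<tau> \<le> \<tau>0" and n: "real n * \<tau> \<le> T"
    have *: "?e \<tau> n \<in> sobolev r \<and> sobolev_norm r (?e \<tau> n) \<le> ?r * (G * \<tau>)"
      using conv \<tau> n by blast
    have "?r * (G * \<tau>) \<le> (?r * G + 1) * \<tau>" using \<tau> by (simp add: distrib_right mult.assoc)
    with * show "?e \<tau> n \<in> sobolev r \<and> sobolev_norm r (?e \<tau> n) \<le> (?r * G + 1) * \<tau>"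
      by linarith
  qed
qed

end
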